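(* As $X \to +\infty$, the lower bound $$g(X)\geq \left(\frac{390}{449}-o(1)\right)\ln X$$ holds. (Numerically, $\frac{390}{449}=0.86859\ldots$.)
   Context: Let $\mathcal S=\{s_1<s_2<s_3<\ldots\}$ be the increasing sequence of all natural numbers (positive integers) which can be represented as a sum of two squares of integers (the integer $0$ is allowed as one of the squared integers). For real $X\ge 2$ let $g(X)=\max_{n:\, s_{n+1}\leq X}(s_{n+1}-s_n)$ be the largest gap between consecutive elements of $\mathcal S$ that do not exceed $X$. $\ln$ is the natural logarithm and $o(1)$ denotes a quantity tending to $0$ as $X\to+\infty$. *)

theory Defs
  imports Complex_Main "HOL-Library.Infinite_Set"
begin

definition sums_of_two_squares :: "nat set" where
  "sums_of_two_squares = {n. n > 0 \<and> (\<exists>a b :: int. int n = a\<^sup>2 + b\<^sup>2)}"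

(* Indexing starts at 0: the value at n is the (n+1)-st smallest element. *)
definition s :: "nat \<Rightarrow> nat" where
  "s = enumerate sums_of_two_squares"

definition gaps_upto :: "real \<Rightarrow> nat set" where
  "gaps_upto X = {s (Suc n) - s n | n. real (s (Suc n)) \<le> X}"

definition g :: "real \<Rightarrow> nat" where
  "g X = Max (gaps_upto X)"

(* The remaining facts show that s and, for X >= 2, the maximum in g are well defined;
   by strict monotonicity the subtraction of natural numbers in a gap never truncates. *)

lemma infinite_sums_of_two_squares: "infinite sums_of_two_squares"
proof -
  have "(\<lambda>k. (Suc k)\<^sup>2) ` UNIV \<subseteq> sums_of_two_squares"
  proof clarify
    fix k :: nat
    have "int ((Suc k)\<^sup>2) = (int (Suc k))\<^sup>2 + 0\<^sup>2" by simp
    moreover have "(Suc k)\<^sup>2 > 0" by simp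
    ultimately show "(Suc k)\<^sup>2 \<in> sums_of_two_squares"
      unfolding sums_of_two_squares_def by blast
  qed
  moreover have "inj (\<lambda>k. (Suc k)\<^sup>2)"
    by (rule injI) (simp only: power2_eq_iff_nonneg le0 nat.inject)
  then have "infinite (range (\<lambda>k. (Suc k)\<^sup>2))"
    by (rule range_inj_infinite)
  ultimately show ?thesis
    using finite_subset by blast
qed

lemma range_s: "range s = sums_of_two_squares"
  by (simp add: s_def range_enumerate infinite_sums_of_two_squares)

lemma strict_mono_s: "strict_mono s"
  by (simp add: s_def strict_mono_enumerate infinite_sums_of_two_squares)

lemma finite_gaps_upto: "finite (gaps_upto X)"
proof -
  have "gaps_upto X \<subseteq> {..nat \<lfloor>X\<rfloor>}"
    unfolding gaps_upto_def by (auto simp: le_nat_floor intro: le_trans[OF diff_le_self])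
  then show ?thesis
    using finite_subset by blast
qed

lemma gaps_upto_nonempty:
  assumes "X \<ge> 2"
  shows "gaps_upto X \<noteq> {}"
proof -
  have "int 1 = 1\<^sup>2 + 0\<^sup>2" "int 2 = 1\<^sup>2 + 1\<^sup>2" by simp_all
  then have "1 \<in> range s" "2 \<in> range s"
    unfolding range_s sums_of_two_squares_def by (blast intro: zero_less_one zero_less_numeral)+
  then obtain i j where ij: "s i = 1" "s j = 2" by (metis imageE)
  then have "i < j" using strict_mono_less[OF strict_mono_s, of i j] by simp
  then have "s (Suc i) \<le> 2" 
    using strict_mono_less_eq[OF strict_mono_s, of "Suc i" j] ij by simp
  then have "real (s (Suc i)) \<le> X" using assms by linarith
  then show ?thesis unfolding gaps_upto_def by blast
qed

end

theory Submission
  imports Defs "HOL-Complex_Analysis.Complex_Analysis" "HOL-Number_Theory.Number_Theory"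
    "HOL-Real_Asymp.Real_Asymp"
begin

text \<open>
  To find \<open>k\<close> consecutive integers \<open>y + 1, \<dots>, y + k\<close> none of which is a sum of two squares, choose \<open>y\<close> by the
  Chinese remainder theorem so that \<open>4 (y + j)\<close> is congruent to \<open>4 j - 1\<close> modulo a product \<open>Q\<close> of powers of
  primes congruent to 3 modulo 4. Since \<open>4 j - 1\<close> is 3 modulo 4, it contains some such prime to an odd power, and
  then so does \<open>y + j\<close>. Small primes enter \<open>Q\<close> with a high power, at negligible total cost. Primes above
  \<open>r k\<close> enter only to the first power: among the translates \<open>y + 2 ^ A t Q\<close> (with \<open>A\<close> as below) there is one for which none of the relevant
  \<open>y + j\<close> is divisible by the square of a large prime.

  The prime 2 is used as well: fixing \<open>y\<close> to be \<open>c\<close> modulo \<open>2 ^ A\<close> excludes every \<open>j\<close> such that \<open>j + c\<close> has odd part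
  3 modulo 4, and a large prime is needed only if it divides some \<open>4 j - 1\<close> with \<open>j\<close> not excluded. A prime
  \<open>p\<close> above \<open>4 k / 5\<close> divides only one \<open>4 j - 1\<close> and is needed for half of all \<open>c\<close>; for \<open>p\<close> in the
  intervals from \<open>4 k / 9\<close> to \<open>4 k / 5\<close> and from \<open>4 k / 13\<close> to \<open>4 k / 9\<close> the proportions are 3/4 and 15/16. On average
  over \<open>c\<close> the logarithm of the modulus is therefore asymptotically at most
  \<open>\<theta>(4k)/2 + \<theta>(4k/5)/4 + 3 \<theta>(4k/9)/16 + \<theta>(4k/13)/16\<close>, where \<open>\<theta>\<close> sums \<open>ln p\<close> over primes that are 3 modulo 4, and
  \<open>\<theta>(x) \<le> (1/2 + o(1)) x\<close> turns this into \<open>(449/390 + o(1)) k\<close>.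

  The bound on \<open>\<theta>\<close> is half of the prime number theorem modulo 4. It follows from Newman's Tauberian theorem and the
  non-vanishing of \<open>\<zeta>\<close> and of \<open>L(\<cdot>, \<chi>)\<close>, for the nontrivial character modulo 4, on the line of real part 1.
\<close>

section \<open>Newman's Tauberian theorem\<close>

text \<open>Since \<open>4 y = -1\<close> modulo \<open>Q\<close>, the number
  \<open>4 (y + j)\<close> agrees with \<open>4 j - 1\<close> there, so at a prime entering
  \<open>Q\<close> with a power above \<open>4 k\<close> the multiplicities of \<open>y + j\<close>
  and \<open>4 j - 1\<close> are equal. Securing this at every prime would need squares of the large
  ones and double the main cost; for those, multiplicity exactly 1 in \<open>y + j\<close> is forced
  instead, whatever it is in \<open>4 j - 1\<close>.

  A cofactor \<open>m\<close> with \<open>p m = 4 j - 1\<close> must be 1 modulo 4, so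
  \<open>m\<close> is 1, 5, 9, 13, ... and \<open>p m < 4 k\<close>. This is the origin of the
  thresholds \<open>4 k / 5\<close>, \<open>4 k / 9\<close>, \<open>4 k / 13\<close>: below each of
  them one more \<open>j\<close> may belong to \<open>p\<close>, and these \<open>j\<close> are
  spaced by \<open>p\<close>. The coefficients 1/2, 1/4, 3/16, 1/16 are the increments of the
  proportions 1/2, 3/4, 15/16, 1, and 2 (1/2 + 1/20 + 1/48 + 1/208) = 449/390. Without the prime 2
  the whole of \<open>\<theta>(4k)\<close>, about \<open>2 k\<close>, would be paid, giving only the
  constant 1/2.\<close>

lemma powr_diff_MVT:
  fixes a b c :: real
  assumes "0 < a" "a < b"
  obtains x where "a < x" "x < b" "b powr c - a powr c = (b - a) * (c * x powr (c - 1))"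
proof -
  have "\<exists>x>a. x < b \<and> b powr c - a powr c = (b - a) * (c * x powr (c - 1))"
    using assms by (intro MVT2) (auto intro!: derivative_eq_intros)
  then show ?thesis using that by blast
qed

text \<open>By the mean value theorem, as \<open>t powr (-1 - x)\<close> decreases. The resulting
  tail bound carries a factor \<open>1 / x\<close> that the contour kernel, proportional to
  \<open>Re z\<close>, will cancel.\<close>

lemma powr_Suc_le_telescope:
  assumes "x > 0" "n \<ge> 1"
  shows "real (Suc n) powr (-1 - x) \<le> (real n powr -x - real (Suc n) powr -x) / x"
proof -
  obtain y where y: "real n < y" "y < real (Suc n)"
    "real (Suc n) powr -x - real n powr -x = (real (Suc n) - real n) * (-x * y powr (-x - 1))"
    using powr_diff_MVT[of "real n" "real (Suc n)" "-x"] assms by auto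
  have "real (Suc n) powr (-1 - x) \<le> y powr (-1 - x)"
    using y assms by (intro powr_mono2') auto
  also have "y powr (-1 - x) = (real n powr -x - real (Suc n) powr -x) / x"
    using y(3) assms by (simp add: field_simps minus_diff_commute)
  finally show ?thesis .
qed

text \<open>Comparison with the integral of \<open>t powr (y - 1)\<close>. For \<open>y > 1\<close>
  the integrand increases and the last summand is left over, whence the term
  \<open>1 / real N\<close>.\<close>

lemma sum_powr_minus_one_le:
  assumes y: "y > 0" and N: "N \<ge> 1"
  shows "(\<Sum>n\<in>{1..N}. real n powr (y - 1)) \<le> real N powr y * (1 / y + 1 / real N)"
proof (cases "y \<le> 1")
  case True
  have "(\<Sum>n\<in>{1..N}. real n powr (y - 1)) \<le> real N powr y / y"
    using N
  proof (induction N rule: nat_induct_at_least)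
    case base
    then show ?case using True y by simp
  next
    case (Suc n)
    obtain x where x: "real n < x" "x < real (Suc n)"
      "real (Suc n) powr y - real n powr y = (real (Suc n) - real n) * (y * x powr (y - 1))"
      using powr_diff_MVT[of "real n" "real (Suc n)" y] Suc by auto
    have "real (Suc n) powr (y - 1) \<le> x powr (y - 1)"
      using x True Suc by (intro powr_mono2') auto
    also have "\<dots> = (real (Suc n) powr y - real n powr y) / y"
      using x(3) y by (simp add: field_simps)
    finally show ?case using Suc by (simp add: diff_divide_distrib)
  qed
  also have "\<dots> \<le> real N powr y * (1 / y + 1 / real N)"
    by (simp add: field_simps)
  finally show ?thesis .
next
  case False
  have "(\<Sum>n\<in>{1..N}. real n powr (y - 1)) \<le> real N powr y / y + real N powr (y - 1)"
    using N
  proof (induction N rule: nat_induct_at_least)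
    case base
    then show ?case using False y by simp
  next
    case (Suc n)
    obtain x where x: "real n < x" "x < real (Suc n)"
      "real (Suc n) powr y - real n powr y = (real (Suc n) - real n) * (y * x powr (y - 1))"
      using powr_diff_MVT[of "real n" "real (Suc n)" y] Suc by auto
    have "real n powr (y - 1) \<le> x powr (y - 1)"
      using x False Suc by (intro powr_mono2) auto
    also have "\<dots> = (real (Suc n) powr y - real n powr y) / y"
      using x(3) y by (simp add: field_simps)
    finally show ?case using Suc by (simp add: diff_divide_distrib)
  qed
  also have "\<dots> = real N powr y * (1 / y + 1 / real N)"
    using N by (simp add: powr_diff field_simps)
  finally show ?thesis .
qed

lemma norm_of_nat_powr: "n > 0 \<Longrightarrow> norm (of_nat n powr z :: complex) = real n powr Re z"
  using norm_powr_real_powr[of "of_nat n" z] by simp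

lemma removable_quotient:
  assumes "f holomorphic_on S" "open S" "f a = 0"
  obtains q where "q holomorphic_on S" "\<And>z. f z = (z - a) * q z"
proof
  define q where "q = (\<lambda>z. if z = a then deriv f a else (f z - f a) / (z - a))"
  show "q holomorphic_on S"
    unfolding q_def using assms by (intro pole_lemma_open)
  show "f z = (z - a) * q z" for z
    using assms by (auto simp: q_def)
qed

text \<open>Cauchy's integral formula cut into two arcs. Subtracting \<open>f 0 / z\<close> leaves
  an entire function, with integral 0 over the closed circle, while \<open>f 0 / z\<close>
  contributes \<open>\<i> * f 0\<close> times the angle of each arc.\<close>

lemma contour_integral_two_semicircles:
  assumes f: "f holomorphic_on UNIV" and R: "R > 0"
  shows "contour_integral (part_circlepath 0 R (-pi/2) (pi/2)) (\<lambda>z. f z / z) +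
         contour_integral (part_circlepath 0 R (pi/2) (3*pi/2)) (\<lambda>z. f z / z) = 2 * pi * \<i> * f 0"
proof -
  have "(\<lambda>z. f z - f 0) holomorphic_on UNIV" by (intro holomorphic_intros f)
  then obtain q where q: "q holomorphic_on UNIV" "\<And>z. f z - f 0 = (z - 0) * q z"
    by (rule removable_quotient[where a = 0]) auto
  let ?A = "part_circlepath 0 R (-pi/2) (pi/2)" and ?B = "part_circlepath 0 R (pi/2) (3*pi/2)"
  have nz: "z \<noteq> 0" if "z \<in> path_image (part_circlepath 0 R s t)" for z s t
    using path_image_part_circlepath_subset'[of R 0 s t] that R by auto
  have qi: "q contour_integrable_on part_circlepath 0 R s t" for s t
    using q(1) by (intro contour_integrable_holomorphic_simple[of _ UNIV]) auto
  have inv: "((\<lambda>z. f 0 / z) has_contour_integral (f 0 * \<i> * of_real (t - s))) (part_circlepath 0 R s t)"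
    if "s < t" for s t
  proof (subst has_contour_integral_part_circlepath_iff[OF that])
    have eq: "(f 0 / (0 + of_real R * cis u) * of_real R * \<i> * cis u) = f 0 * \<i>" for u
      using R by (simp add: field_simps)
    have "((\<lambda>_. f 0 * \<i>) has_integral (t - s) *\<^sub>R (f 0 * \<i>)) {s..t}"
      using has_integral_const_real[of "f 0 * \<i>" s t] that by simp
    then show "((\<lambda>u. f 0 / (0 + of_real R * cis u) * of_real R * \<i> * cis u) has_integral f 0 * \<i> * of_real (t - s)) {s..t}"
      unfolding eq by (simp add: scaleR_conv_of_real mult_ac)
  qed
  have eq: "contour_integral (part_circlepath 0 R s t) (\<lambda>z. f z / z) =
        contour_integral (part_circlepath 0 R s t) q + f 0 * \<i> * of_real (t - s)" if "s < t" for s t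
  proof -
    have "contour_integral (part_circlepath 0 R s t) (\<lambda>z. f z / z) =
          contour_integral (part_circlepath 0 R s t) (\<lambda>z. q z + f 0 / z)"
    proof (rule contour_integral_cong)
      fix z assume "z \<in> path_image (part_circlepath 0 R s t)"
      then have "z \<noteq> 0" by (rule nz)
      moreover have "f z = z * q z + f 0" using q(2)[of z] by (simp add: algebra_simps)
      ultimately show "f z / z = q z + f 0 / z" by (simp add: add_divide_distrib)
    qed simp
    also have "\<dots> = contour_integral (part_circlepath 0 R s t) q + f 0 * \<i> * of_real (t - s)"
      using inv[OF that] qi
      by (simp add: contour_integral_add contour_integral_unique has_contour_integral_integrable)
    finally show ?thesis .
  qed
  have ends: "pathfinish ?A = pathstart ?B" "pathfinish ?B = pathstart ?A"
  proof -
    have "cis (3 * pi / 2) = cis (-pi/2)"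
      using cos_3over2_pi sin_3over2_pi by (simp add: complex_eq_iff)
    then show "pathfinish ?B = pathstart ?A" by (simp add: cis_conv_exp)
  qed auto
  have "(q has_contour_integral 0) (?A +++ ?B)"
    using q(1) ends by (intro Cauchy_theorem_convex_simple[of _ UNIV]) auto
  then have "contour_integral ?A q + contour_integral ?B q = 0"
    using qi by (metis contour_integral_join contour_integral_unique valid_path_part_circlepath)
  then show ?thesis
    by (simp add: eq algebra_simps add_eq_0_iff)
qed

text \<open>Integration by parts against \<open>exp (z * l) / l\<close>: the exponential has norm 1
  on the imaginary axis, so the boundary terms and the remaining integral are all of order
  \<open>1 / l\<close>. Later \<open>l\<close> is \<open>ln N\<close>.\<close>

lemma segment_oscillation_bound:
  fixes r :: real
  assumes h: "h holomorphic_on S" "open S" and seg: "\<And>y. of_real y * \<i> \<in> S"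
  obtains C where "C \<ge> 0" "\<And>l::real. l > 0 \<Longrightarrow>
    norm (contour_integral (linepath (of_real r * \<i>) (-(of_real r * \<i>))) (\<lambda>z. h z * exp (z * of_real l))) \<le> C / l"
proof -
  let ?a = "of_real r * \<i>"
  let ?L = "linepath ?a (-?a)"
  have segim: "\<exists>y. z = of_real y * \<i>" if "z \<in> closed_segment ?a (-?a)" for z
  proof -
    from that obtain u where "z = (1 - u) *\<^sub>R ?a + u *\<^sub>R (-?a)" by (auto simp: in_segment)
    then have "z = of_real ((1 - 2 * u) * r) * \<i>"
      by (simp add: scaleR_conv_of_real algebra_simps)
    then show ?thesis by blast
  qed
  have sub: "closed_segment ?a (-?a) \<subseteq> S" using segim seg by blast
  have dh: "deriv h holomorphic_on S" using h by (intro holomorphic_deriv)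
  have "compact (deriv h ` closed_segment ?a (-?a))"
    using holomorphic_on_imp_continuous_on[OF dh] sub continuous_on_subset
    by (intro compact_continuous_image) auto
  then obtain D where D: "D > 0" "\<And>z. z \<in> closed_segment ?a (-?a) \<Longrightarrow> norm (deriv h z) \<le> D"
    unfolding compact_eq_bounded_closed bounded_pos by auto
  define C where "C = norm (h (-?a)) + norm (h ?a) + D * norm (-?a - ?a)"
  show ?thesis
  proof
    show "C \<ge> 0" using D by (simp add: C_def)
    fix l :: real assume l: "l > 0"
    define F where "F = (\<lambda>z. h z * exp (z * of_real l) / of_real l)"
    define J where "J = (\<lambda>z. deriv h z * exp (z * of_real l) / of_real l)"
    have F: "(F has_field_derivative J z + h z * exp (z * of_real l)) (at z within closed_segment ?a (-?a))"
      if "z \<in> closed_segment ?a (-?a)" for z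
    proof -
      have "(h has_field_derivative deriv h z) (at z within closed_segment ?a (-?a))"
        using holomorphic_derivI[OF h] that sub by (meson DERIV_subset subsetD top_greatest)
      then show ?thesis unfolding F_def J_def using l
        by (auto intro!: derivative_eq_intros simp: field_simps)
    qed
    have int: "((\<lambda>z. J z + h z * exp (z * of_real l)) has_contour_integral F (-?a) - F ?a) ?L"
      using contour_integral_primitive[of "closed_segment ?a (-?a)" F "\<lambda>z. J z + h z * exp (z * of_real l)" ?L] F
      by auto
    have nexp: "norm (exp (z * of_real l)) = 1" if "z \<in> closed_segment ?a (-?a)" for z
      using segim[OF that] by (auto simp: norm_exp_eq_Re)
    have Jh: "J contour_integrable_on ?L"
      unfolding J_def using sub
      by (intro contour_integrable_holomorphic_simple[OF _ h(2)] holomorphic_intros dh) (use l in auto)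
    have I: "norm (contour_integral ?L J) \<le> (D / l) * norm (-?a - ?a)"
    proof (rule contour_integral_bound_linepath[OF Jh])
      fix z assume "z \<in> closed_segment ?a (-?a)"
      then show "norm (J z) \<le> D / l"
        using D l nexp by (simp add: J_def norm_mult norm_divide divide_right_mono)
    qed (use D l in auto)
    have hh: "(\<lambda>z. h z * exp (z * of_real l)) contour_integrable_on ?L"
      using sub by (intro contour_integrable_holomorphic_simple[OF _ h(2)] holomorphic_intros h) auto
    have "contour_integral ?L J + contour_integral ?L (\<lambda>z. h z * exp (z * of_real l)) = F (-?a) - F ?a"
      using contour_integral_unique[OF int] contour_integral_add[OF Jh hh] by simp
    then have "contour_integral ?L (\<lambda>z. h z * exp (z * of_real l)) = F (-?a) - F ?a - contour_integral ?L J"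
      by (simp add: algebra_simps)
    then have "norm (contour_integral ?L (\<lambda>z. h z * exp (z * of_real l))) \<le>
        norm (F (-?a)) + norm (F ?a) + norm (contour_integral ?L J)"
      using norm_triangle_ineq4[of "F (-?a) - F ?a" "contour_integral ?L J"] norm_triangle_ineq4[of "F (-?a)" "F ?a"]
      by simp
    also have "\<dots> \<le> norm (h (-?a)) / l + norm (h ?a) / l + (D / l) * norm (-?a - ?a)"
      using I l nexp[of ?a] nexp[of "-?a"] by (intro add_mono) (auto simp: F_def norm_mult norm_divide)
    also have "\<dots> = C / l" by (simp add: C_def add_divide_distrib)
    finally show "norm (contour_integral ?L (\<lambda>z. h z * exp (z * of_real l))) \<le> C / l" .
  qed
qed

text \<open>Newman's kernel is real on the circle and vanishes where the circle meets the imaginary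
  axis; its factor \<open>Re z\<close> offsets the \<open>1 / Re z\<close> in the bounds for the
  tail and for the partial sum.\<close>

lemma semicircle_kernel:
  assumes "norm z = R" "R > 0"
  shows "(1 + z\<^sup>2 / of_real (R\<^sup>2)) / z = of_real (2 * Re z / R\<^sup>2)"
proof -
  have z: "z \<noteq> 0" using assms by auto
  have zz: "of_real (R\<^sup>2) = z * cnj z"
    using assms complex_norm_square by metis
  have "(1 + z\<^sup>2 / of_real (R\<^sup>2)) / z = (cnj z + z) / of_real (R\<^sup>2)"
    unfolding zz using z by (simp add: field_simps power2_eq_square)
  also have "\<dots> = of_real (2 * Re z / R\<^sup>2)"
    by (simp add: complex_add_cnj add.commute)
  finally show ?thesis .
qed

text \<open>The triangle inequality of Newman's contour argument: \<open>u\<close> and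
  \<open>v\<close> are the integrals of the full function over the right arc and the diameter,
  \<open>w\<close> and \<open>b\<close> those of the partial sum over the right and left arcs, and
  \<open>t\<close> is the value given by Cauchy's formula.\<close>

lemma norm_le_of_parts:
  fixes u v w b d t :: complex
  assumes "u - w = d" "norm d \<le> D" "norm b \<le> B" "w + b = t" "u + v = 0" "norm v \<le> V"
  shows "norm t \<le> V + D + B"
proof -
  have "t = b - v - d" using assms(1,4,5) by (auto simp: algebra_simps add_eq_0_iff)
  then show ?thesis
    using norm_triangle_ineq4[of "b - v" d] norm_triangle_ineq4[of b v] assms by simp
qed

text \<open>Since \<open>G 0 = 0\<close>, the function \<open>G z / z\<close> has no pole, so the left part of
  the usual contour can be taken to be a diameter, on which the integral is controlled by oscillation.\<close>

lemma newman_vanishing: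
  fixes a :: "nat \<Rightarrow> complex"
  assumes M: "\<And>n. norm (a n) \<le> M" "M > 0"
    and S: "open S" "{z. Re z \<ge> 0} \<subseteq> S" and G: "G holomorphic_on S" "G 0 = 0"
    and sums: "\<And>z. Re z > 0 \<Longrightarrow> (\<lambda>n. a (Suc n) * of_nat (Suc n) powr (-1 - z)) sums G z"
  shows "(\<lambda>N. \<Sum>n\<in>{1..N}. a n / of_nat n) \<longlonglongrightarrow> 0"
proof -
  define T where "T = (\<lambda>N z. \<Sum>n\<in>{1..N}. a n * of_nat n powr (-1 - z))"
  define E where "E = (\<lambda>N (z::complex). exp (z * of_real (ln (real N))))"
  have T_holo: "T N holomorphic_on X" for N X
    unfolding T_def by (auto intro!: holomorphic_intros)
  have E_holo: "E N holomorphic_on X" for N X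
    unfolding E_def by (auto intro!: holomorphic_intros)
  have norm_E: "norm (E N z) = real N powr Re z" if "N \<ge> 1" for N z
    using that by (simp add: E_def norm_exp_eq_Re powr_def)
  obtain q where q: "q holomorphic_on S" "\<And>z. G z = (z - 0) * q z"
    using removable_quotient[OF G(1) S(1) G(2)] by blast
  have T_left: "norm (T N z) \<le> M * (real N powr (-Re z) * (1 / (-Re z) + 1 / real N))"
    if "N \<ge> 1" "Re z < 0" for N z
  proof -
    have "norm (T N z) \<le> (\<Sum>n\<in>{1..N}. M * real n powr (-1 - Re z))"
      unfolding T_def
    proof (rule sum_norm_le)
      fix n assume "n \<in> {1..N}"
      then show "norm (a n * of_nat n powr (-1 - z)) \<le> M * real n powr (-1 - Re z)"
        using M(1)[of n] M(2)
        by (auto simp: norm_mult norm_of_nat_powr uminus_add_conv_diff minus_diff_commute intro!: mult_mono)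
    qed
    also have "\<dots> = M * (\<Sum>n\<in>{1..N}. real n powr (-Re z - 1))"
      by (simp add: sum_distrib_left minus_diff_commute)
    also have "\<dots> \<le> M * (real N powr (-Re z) * (1 / (-Re z) + 1 / real N))"
      using sum_powr_minus_one_le[of "-Re z" N] that M(2) by (intro mult_left_mono) auto
    finally show ?thesis .
  qed
  have tail: "norm (G z - T N z) \<le> M * (real N powr (-Re z) / Re z)" if "N \<ge> 1" "Re z > 0" for N z
  proof -
    have "(\<lambda>n. a (Suc (n + N)) * of_nat (Suc (n + N)) powr (-1 - z)) sums
        (G z - (\<Sum>n<N. a (Suc n) * of_nat (Suc n) powr (-1 - z)))"
      using sums_iff_shift[of "\<lambda>n. a (Suc n) * of_nat (Suc n) powr (-1 - z)" N] sums[OF that(2)] by simp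
    moreover have "(\<Sum>n<N. a (Suc n) * of_nat (Suc n) powr (-1 - z)) = T N z"
      unfolding T_def by (rule sum.reindex_bij_witness[of _ "\<lambda>n. n - 1" Suc]) auto
    ultimately have s1: "(\<lambda>n. a (Suc (n + N)) * of_nat (Suc (n + N)) powr (-1 - z)) sums (G z - T N z)"
      by simp
    have "(\<lambda>n. real (n + N) powr - Re z) \<longlonglongrightarrow> 0"
      using that(2) by real_asymp
    then have "(\<lambda>n. real (n + N) powr - Re z - real (Suc n + N) powr - Re z) sums (real (0 + N) powr - Re z - 0)"
      by (rule telescope_sums')
    then have s2: "(\<lambda>n. M * ((real (n + N) powr - Re z - real (Suc n + N) powr - Re z) / Re z)) sums
        (M * ((real (0 + N) powr - Re z - 0) / Re z))"
      by (intro sums_mult sums_divide)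
    have "norm (G z - T N z) \<le> M * ((real (0 + N) powr - Re z - 0) / Re z)"
    proof (rule norm_sums_le[OF s1 s2])
      fix n
      have "norm (a (Suc (n + N)) * of_nat (Suc (n + N)) powr (-1 - z)) \<le> M * real (Suc (n + N)) powr (-1 - Re z)"
        using M(1)[of "Suc (n+N)"] by (auto simp: norm_mult norm_of_nat_powr simp del: of_nat_Suc intro!: mult_mono)
      also have "\<dots> \<le> M * ((real (n + N) powr - Re z - real (Suc n + N) powr - Re z) / Re z)"
        using powr_Suc_le_telescope[of "Re z" "n + N"] that M(2) by (intro mult_left_mono) auto
      finally show "norm (a (Suc (n + N)) * of_nat (Suc (n + N)) powr (-1 - z)) \<le> 
         M * ((real (n + N) powr - Re z - real (Suc n + N) powr - Re z) / Re z)" .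
    qed
    then show ?thesis by simp
  qed
  \<comment> \<open>\<open>C\<close> may depend on \<open>R\<close> but not on \<open>N\<close>.
    Letting \<open>N\<close> grow first leaves \<open>2 * M / R\<close>, half of it from each
    semicircle, and \<open>R\<close> is arbitrary.\<close>
  have key: "\<exists>C\<ge>0. \<forall>N\<ge>2. norm (T N 0) \<le> C / ln (real N) + 2 * M / R + M / real N" if R: "R > 0" for R
  proof -
    let ?A = "part_circlepath 0 R (-pi/2) (pi/2)" and ?B = "part_circlepath 0 R (pi/2) (3*pi/2)"
    let ?L = "linepath (of_real R * \<i>) (-(of_real R * \<i>))"
    define k where "k = (\<lambda>z::complex. 1 + z\<^sup>2 / of_real (R\<^sup>2))"
    have k_holo: "k holomorphic_on X" for X
      unfolding k_def using R by (auto intro!: holomorphic_intros)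
    have "(\<lambda>z. q z * k z) holomorphic_on S" by (intro holomorphic_intros q k_holo)
    moreover have "of_real y * \<i> \<in> S" for y using S(2) by auto
    ultimately obtain C where C: "C \<ge> 0" "\<And>l::real. l > 0 \<Longrightarrow>
        norm (contour_integral ?L (\<lambda>z. q z * k z * exp (z * of_real l))) \<le> C / l"
      using segment_oscillation_bound[OF _ S(1), of "\<lambda>z. q z * k z" R] by metis
    have Aim: "norm z = R \<and> Re z \<ge> 0" if "z \<in> path_image ?A" for z
    proof -
      have "-pi/2 \<le> pi/2" by simp
      from that[unfolded path_image_part_circlepath[OF this]] obtain t where
        t: "z = of_real R * exp (\<i> * of_real t)" "-pi/2 \<le> t" "t \<le> pi/2" by auto
      then show ?thesis using R by (auto simp: norm_mult Re_exp intro!: mult_nonneg_nonneg cos_ge_zero)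
    qed
    have Bim: "norm z = R \<and> Re z \<le> 0" if "z \<in> path_image ?B" for z
    proof -
      have "pi/2 \<le> 3*pi/2" by simp
      from that[unfolded path_image_part_circlepath[OF this]] obtain t where
        t: "z = of_real R * exp (\<i> * of_real t)" "pi/2 \<le> t" "t \<le> 3*pi/2" by auto
      have "0 \<le> cos (t - pi)" using t by (intro cos_ge_zero) auto
      then have "cos t \<le> 0" by (simp add: cos_diff)
      then show ?thesis using R t by (auto simp: norm_mult Re_exp mult_nonneg_nonpos)
    qed
    have Lim: "Re z = 0 \<and> norm z \<le> R" if "z \<in> closed_segment (of_real R * \<i>) (-(of_real R * \<i>))" for z
    proof -
      from that obtain u where u: "0 \<le> u" "u \<le> 1" "z = (1 - u) *\<^sub>R (of_real R * \<i>) + u *\<^sub>R (-(of_real R * \<i>))"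
        by (auto simp: in_segment)
      have z: "z = of_real ((1 - 2 * u) * R) * \<i>"
        unfolding u by (simp add: scaleR_conv_of_real algebra_simps)
      have "\<bar>(1 - 2 * u) * R\<bar> \<le> 1 * R"
        unfolding abs_mult using u R by (intro mult_mono) auto
      then show ?thesis unfolding z norm_mult by (simp del: of_real_mult)
    qed
    define D where "D = {z. Re z \<ge> 0} \<inter> cball 0 R"
    have D: "convex D" "D \<subseteq> S" using S(2) by (auto simp: D_def convex_halfspace_Re_ge intro!: convex_Int)
    show ?thesis
    proof (rule exI[of _ C], intro conjI allI impI C(1))
      fix N :: nat assume N: "N \<ge> 2"
      \<comment> \<open>Away from 0 this is \<open>G z * k z * E N z / z\<close>. Written with
        \<open>q\<close> it is holomorphic at 0 too, so Cauchy's theorem applies to the right arc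
        closed by the diameter through 0.\<close>
      define H where "H = (\<lambda>z. q z * k z * E N z)"
      define P where "P = (\<lambda>z. (G z - T N z) * E N z * of_real (2 * Re z / R\<^sup>2))"
      have H_holo: "H holomorphic_on S" unfolding H_def by (intro holomorphic_intros q k_holo E_holo)
      have AS: "path_image ?A \<subseteq> S" using Aim S(2) by auto
      have LS: "path_image ?L \<subseteq> S" using Lim S(2) by auto
      have HA: "H contour_integrable_on ?A" and HL: "H contour_integrable_on ?L"
        using AS LS by (auto intro!: contour_integrable_holomorphic_simple[OF H_holo S(1)])
      have "exp (\<i> * of_real (pi/2)) = \<i>" "exp (\<i> * of_real (-pi/2)) = -\<i>"
        by (simp_all only: complex_eq_iff flip: cis_conv_exp) simp_all
      then have ends: "pathfinish ?A = of_real R * \<i>" "pathstart ?A = -(of_real R * \<i>)"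
        by (simp_all only: pathfinish_part_circlepath pathstart_part_circlepath) simp_all
      have "(H has_contour_integral 0) (?A +++ ?L)"
      proof (rule Cauchy_theorem_convex_simple)
        show "H holomorphic_on D" using H_holo D holomorphic_on_subset by blast
        show "convex D" by (rule D)
        show "path_image (?A +++ ?L) \<subseteq> D"
          by (rule subset_trans[OF path_image_join_subset], intro Un_least subsetI)
             (use Aim Lim in \<open>auto simp: D_def\<close>)
      qed (use ends in \<open>auto intro!: valid_path_join simp del: pathfinish_part_circlepath pathstart_part_circlepath\<close>)
      then have HAL: "contour_integral ?A H + contour_integral ?L H = 0"
        using HA HL by (metis contour_integral_join contour_integral_unique valid_path_part_circlepath valid_path_linepath)
      have HL_le: "norm (contour_integral ?L H) \<le> C / ln (real N)"
        using C(2)[of "ln (real N)"] N unfolding H_def E_def by simp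
      \<comment> \<open>The partial sum is entire, so for it the left half of the circle is
        available although \<open>G\<close> is only given on \<open>S\<close>.\<close>
      define f where "f = (\<lambda>z. T N z * k z * E N z)"
      have f_holo: "f holomorphic_on UNIV" unfolding f_def by (intro holomorphic_intros T_holo k_holo E_holo)
      have fz: "f z / z = T N z * E N z * of_real (2 * Re z / R\<^sup>2)" if "norm z = R" for z
      proof -
        have "f z / z = T N z * E N z * (k z / z)" by (simp add: f_def)
        then show ?thesis unfolding k_def semicircle_kernel[OF that R] .
      qed
      have fz_int: "(\<lambda>z. f z / z) contour_integrable_on part_circlepath 0 R s t" for s t
      proof (rule contour_integrable_holomorphic_simple[of _ "-{0}"])
        show "(\<lambda>z. f z / z) holomorphic_on - {0}"
          using f_holo by (intro holomorphic_intros) (auto intro: holomorphic_on_subset)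
        show "path_image (part_circlepath 0 R s t) \<subseteq> - {0}"
          using path_image_part_circlepath_subset'[of R 0 s t] R by auto
      qed auto
      have HP: "H z - f z / z = P z" if "norm z = R" for z
      proof -
        have "z \<noteq> 0" using that R by auto
        then have "H z = G z * k z * E N z / z" using q(2)[of z] by (simp add: H_def)
        also have "\<dots> = G z * E N z * (k z / z)" by simp
        finally have "H z = G z * E N z * of_real (2 * Re z / R\<^sup>2)"
          unfolding k_def semicircle_kernel[OF that R] .
        with fz[OF that] show ?thesis unfolding P_def by (simp only: left_diff_distrib)
      qed
      have "contour_integral ?A H - contour_integral ?A (\<lambda>z. f z / z) = contour_integral ?A (\<lambda>z. H z - f z / z)"
        using HA fz_int by (simp add: contour_integral_diff)
      moreover have "norm (contour_integral ?A (\<lambda>z. H z - f z / z)) \<le> (2 * M / R\<^sup>2) * R * \<bar>pi/2 - (-pi/2)\<bar>"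
      proof (rule contour_integral_bound_part_circlepath)
        show "(\<lambda>z. H z - f z / z) contour_integrable_on ?A"
          using HA fz_int by (intro contour_integrable_diff)
        fix z assume "z \<in> path_image ?A"
        then have z: "norm z = R" "Re z \<ge> 0" using Aim by auto
        \<comment> \<open>The tail estimate requires \<open>Re z > 0\<close>; at the two end points
          of the arc the kernel vanishes instead.\<close>
        show "norm (H z - f z / z) \<le> 2 * M / R\<^sup>2"
        proof (cases "Re z = 0")
          case True
          then show ?thesis using HP[OF z(1)] M(2) by (simp add: P_def)
        next
          case False
          with z have z0: "Re z > 0" by simp
          have "norm (P z) = norm (G z - T N z) * real N powr Re z * (2 * Re z / R\<^sup>2)"
            using z0 N by (simp add: P_def norm_mult norm_E norm_divide norm_power)
          also have "\<dots> \<le> (M * (real N powr (-Re z) / Re z)) * real N powr Re z * (2 * Re z / R\<^sup>2)"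
            using tail[OF _ z0, of N] N z0 by (intro mult_right_mono) auto
          also have "\<dots> = 2 * M / R\<^sup>2"
            using z0 N by (simp add: powr_minus field_simps)
          finally show ?thesis using HP[OF z(1)] by simp
        qed
      qed (use M R in auto)
      moreover have "norm (contour_integral ?B (\<lambda>z. f z / z)) \<le>
          (2 * M / R\<^sup>2 + 2 * M / (R * real N)) * R * \<bar>3*pi/2 - pi/2\<bar>"
      proof (rule contour_integral_bound_part_circlepath)
        show "(\<lambda>z. f z / z) contour_integrable_on ?B" by (rule fz_int)
        fix z assume "z \<in> path_image ?B"
        then have z: "norm z = R" "Re z \<le> 0" using Bim by auto
        show "norm (f z / z) \<le> 2 * M / R\<^sup>2 + 2 * M / (R * real N)"
        proof (cases "Re z = 0")
          case True
          then have "f z / z = 0" unfolding fz[OF z(1)] by simp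
          moreover have "0 \<le> 2 * M / R\<^sup>2 + 2 * M / (R * real N)" using M(2) R by simp
          ultimately show ?thesis by (simp only: norm_zero)
        next
          case False
          with z have z0: "Re z < 0" by simp
          have "norm (f z / z) = norm (T N z) * real N powr Re z * (2 * (-Re z) / R\<^sup>2)"
            unfolding fz[OF z(1)] using z0 N by (simp add: norm_mult norm_E norm_divide norm_power)
          also have "\<dots> \<le> (M * (real N powr (-Re z) * (1 / (-Re z) + 1 / real N))) * real N powr Re z * (2 * (-Re z) / R\<^sup>2)"
          proof (intro mult_right_mono)
            show "0 \<le> 2 * (-Re z) / R\<^sup>2" using z0 by (intro divide_nonneg_nonneg) auto
          qed (use T_left[OF _ z0, of N] N in auto)
          also have "\<dots> = M * (real N powr (-Re z) * real N powr Re z) * (1 / (-Re z) + 1 / real N) * (2 * (-Re z) / R\<^sup>2)"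
            by (simp only: mult_ac)
          also have "real N powr (-Re z) * real N powr Re z = 1"
            using N by (simp flip: powr_add)
          also have "M * 1 * (1 / (-Re z) + 1 / real N) * (2 * (-Re z) / R\<^sup>2) = 2 * M / R\<^sup>2 + 2 * M * (-Re z) / (R\<^sup>2 * real N)"
            using z0 N R by (simp add: field_simps)
          also have "\<dots> \<le> 2 * M / R\<^sup>2 + 2 * M * R / (R\<^sup>2 * real N)"
            using abs_Re_le_cmod[of z] z M N R
            by (intro add_left_mono divide_right_mono mult_left_mono) auto
          also have "2 * M * R / (R\<^sup>2 * real N) = 2 * M / (R * real N)"
            using R by (simp add: power2_eq_square)
          finally show ?thesis .
        qed
      qed (use M R N in auto)
      moreover have "contour_integral ?A (\<lambda>z. f z / z) + contour_integral ?B (\<lambda>z. f z / z) = 2 * pi * \<i> * f 0"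
        by (rule contour_integral_two_semicircles[OF f_holo R])
      ultimately have "norm (2 * pi * \<i> * f 0) \<le> C / ln (real N) + (2 * M / R\<^sup>2) * R * \<bar>pi/2 - (-pi/2)\<bar>
         + (2 * M / R\<^sup>2 + 2 * M / (R * real N)) * R * \<bar>3*pi/2 - pi/2\<bar>"
        using HAL HL_le by (rule norm_le_of_parts)
      also have "\<dots> = C / ln (real N) + 2 * pi * (2 * M / R + M / real N)"
        using R N by (simp add: field_simps power2_eq_square)
      finally have "2 * pi * norm (T N 0) \<le> C / ln (real N) + 2 * pi * (2 * M / R + M / real N)"
        by (simp add: f_def k_def E_def norm_mult)
      then have "norm (T N 0) \<le> (C / ln (real N) + 2 * pi * (2 * M / R + M / real N)) / (2 * pi)"
        by (subst pos_le_divide_eq) (simp_all only: mult.commute pi_gt_zero mult_pos_pos zero_less_numeral)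
      then have "norm (T N 0) \<le> C / ln (real N) / (2 * pi) + (2 * M / R + M / real N)"
        by (simp add: add_divide_distrib)
      moreover have "C / ln (real N) / (2 * pi) \<le> C / ln (real N) / 1"
        using C N pi_gt3 by (intro divide_left_mono) auto
      ultimately show "norm (T N 0) \<le> C / ln (real N) + 2 * M / R + M / real N" by simp
    qed
  qed
  have "(\<lambda>N. T N 0) \<longlonglongrightarrow> 0"
  proof (rule tendstoI)
    fix e :: real assume e: "e > 0"
    define R where "R = 4 * M / e"
    have R: "R > 0" using e M by (simp add: R_def)
    obtain C where C: "\<And>N. N \<ge> 2 \<Longrightarrow> norm (T N 0) \<le> C / ln (real N) + 2 * M / R + M / real N"
      using key[OF R] by blast
    have "(\<lambda>N. C / ln (real N) + M / real N) \<longlonglongrightarrow> 0" by real_asymp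
    then have "\<forall>\<^sub>F N in sequentially. C / ln (real N) + M / real N < e / 2"
      using e by (intro order_tendstoD) auto
    then show "\<forall>\<^sub>F N in sequentially. dist (T N 0) 0 < e"
      using eventually_ge_at_top[of 2]
    proof eventually_elim
      case (elim N)
      have "2 * M / R = e / 2" using M e by (simp add: R_def)
      then have "norm (T N 0) < e" using C[OF elim(2)] elim(1) by linarith
      then show ?case by simp
    qed
  qed
  also have "(\<lambda>N. T N 0) = (\<lambda>N. \<Sum>n\<in>{1..N}. a n / of_nat n)"
    by (intro ext) (auto simp: T_def powr_minus divide_inverse intro!: sum.cong)
  finally show ?thesis .
qed

text \<open>Replacing \<open>a 1\<close> by \<open>a 1 - G 0\<close> lowers the Dirichlet series by
  the constant \<open>G 0\<close>, because \<open>1 powr w = 1\<close>. This reduces to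
  \<open>newman_vanishing\<close>, the coefficients staying bounded.\<close>

theorem newman_dirichlet:
  fixes a :: "nat \<Rightarrow> complex"
  assumes M: "\<And>n. norm (a n) \<le> M"
    and S: "open S" "{z. Re z \<ge> 0} \<subseteq> S" and G: "G holomorphic_on S"
    and sums: "\<And>z. Re z > 0 \<Longrightarrow> (\<lambda>n. a (Suc n) * of_nat (Suc n) powr (-1 - z)) sums G z"
  shows "(\<lambda>N. \<Sum>n\<in>{1..N}. a n / of_nat n) \<longlonglongrightarrow> G 0"
proof -
  define b where "b = (\<lambda>n. a n - (if n = 1 then G 0 else 0))"
  have "(\<lambda>N. \<Sum>n\<in>{1..N}. b n / of_nat n) \<longlonglongrightarrow> 0"
  proof (rule newman_vanishing[OF _ _ S])
    show "norm (b n) \<le> M + norm (G 0) + 1" for n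
      using M[of n] norm_triangle_ineq4[of "a n" "G 0"] norm_ge_zero[of "G 0"] unfolding b_def
      by (cases "n = 1"; simp; linarith)
    show "M + norm (G 0) + 1 > 0"
      using order_trans[OF norm_ge_zero M] by (simp add: add_nonneg_pos)
    show "(\<lambda>z. G z - G 0) holomorphic_on S" by (intro holomorphic_intros G)
    show "(\<lambda>n. b (Suc n) * of_nat (Suc n) powr (-1 - z)) sums (G z - G 0)" if "Re z > 0" for z
    proof -
      have "(\<lambda>n. a (Suc n) * of_nat (Suc n) powr (-1 - z) - (if n = 0 then G 0 else 0)) sums (G z - G 0)"
        by (intro sums_diff sums[OF that] sums_single)
      also have "(\<lambda>n. a (Suc n) * of_nat (Suc n) powr (-1 - z) - (if n = 0 then G 0 else 0)) =
          (\<lambda>n. b (Suc n) * of_nat (Suc n) powr (-1 - z))"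
        by (auto simp: b_def fun_eq_iff)
      finally show ?thesis .
    qed
  qed auto
  then have "(\<lambda>N. (\<Sum>n\<in>{1..N}. b n / of_nat n) + G 0) \<longlonglongrightarrow> 0 + G 0" by (intro tendsto_intros)
  moreover have "\<forall>\<^sub>F N in sequentially. (\<Sum>n\<in>{1..N}. b n / of_nat n) + G 0 = (\<Sum>n\<in>{1..N}. a n / of_nat n)"
    using eventually_ge_at_top[of 1]
  proof eventually_elim
    case (elim N)
    have "(\<Sum>n\<in>{1..N}. b n / of_nat n) = (\<Sum>n\<in>{1..N}. a n / of_nat n - (if n = 1 then G 0 else 0))"
      by (intro sum.cong) (auto simp: b_def diff_divide_distrib)
    then show ?case using elim by (simp add: sum_subtractf)
  qed
  ultimately show ?thesis by (simp add: tendsto_cong)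
qed

section \<open>Dirichlet series modulo 4\<close>

lemma of_real_powr_derivative_bound:
  assumes "0 < a" "a \<le> t" "Re w \<le> 0"
  shows "norm (of_real t powr w :: complex) \<le> a powr Re w"
  using assms by (simp add: norm_powr_real_powr powr_mono2')

lemma segment_real_cases:
  assumes "a \<le> b" "z \<in> closed_segment (of_real a) (of_real b :: complex)"
  obtains t where "z = of_real t" "a \<le> t" "t \<le> b"
  using assms unfolding closed_segment_of_real by (auto simp: closed_segment_eq_real_ivl)

text \<open>Mean value inequality on a real segment; \<open>Re \<xi> \<ge> -1\<close> bounds the
  derivative by its size at the left end.\<close>

lemma norm_powr_diff_le:
  fixes \<xi> :: complex
  assumes "0 < a" "a \<le> b" "Re \<xi> \<ge> -1"
  shows "norm (of_real b powr (-\<xi>) - of_real a powr (-\<xi>) :: complex) \<le> norm \<xi> * a powr (-Re \<xi> - 1) * (b - a)"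
proof -
  let ?S = "closed_segment (of_real a) (of_real b :: complex)"
  have "norm (of_real b powr (-\<xi>) - of_real a powr (-\<xi>)) \<le> (norm \<xi> * a powr (-Re \<xi> - 1)) * norm (of_real b - of_real a :: complex)"
  proof (rule field_differentiable_bound[of ?S _ "\<lambda>z. -\<xi> * z powr (-\<xi> - 1)"])
    fix z assume "z \<in> ?S"
    then obtain t where t: "z = of_real t" "a \<le> t" "t \<le> b" using segment_real_cases[OF assms(2)] by blast
    then have "z \<notin> \<real>\<^sub>\<le>\<^sub>0" using assms by auto
    then show "((\<lambda>z. z powr -\<xi>) has_field_derivative -\<xi> * z powr (-\<xi> - 1)) (at z within ?S)"
      by (rule has_field_derivative_at_within[OF has_field_derivative_powr])
    show "norm (-\<xi> * z powr (-\<xi> - 1)) \<le> norm \<xi> * a powr (-Re \<xi> - 1)"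
      using of_real_powr_derivative_bound[of a t "-\<xi> - 1"] assms t
      by (auto simp: norm_mult intro!: mult_left_mono)
  qed auto
  also have "norm (of_real b - of_real a :: complex) = b - a"
    using assms(2) by (simp flip: of_real_diff)
  finally show ?thesis .
qed

text \<open>The \<open>n\<close>-th term of \<open>\<zeta>(\<xi>) - 1 / (\<xi> - 1)\<close>, multiplied by \<open>\<xi> - 1\<close> so that it becomes entire.\<close>

definition zeta_term :: "nat \<Rightarrow> complex \<Rightarrow> complex" where
  "zeta_term n \<xi> = (\<xi> - 1) * of_nat n powr (-\<xi>) - of_nat n powr (1 - \<xi>) + of_nat (Suc n) powr (1 - \<xi>)"

text \<open>The mean value inequality applied twice: the derivative of the auxiliary
  \<open>f\<close> is itself a difference of powers, estimated by \<open>norm_powr_diff_le\<close>.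
  The gain of one power of \<open>n\<close> moves convergence from \<open>Re \<xi> > 1\<close> to
  \<open>Re \<xi> > 0\<close>.\<close>

lemma norm_zeta_term_le:
  assumes "n > 0" "Re \<xi> \<ge> -1"
  shows "norm (zeta_term n \<xi>) \<le> norm (\<xi> - 1) * norm \<xi> * real n powr (-Re \<xi> - 1)"
proof -
  let ?a = "real n" and ?b = "real n + 1"
  let ?S = "closed_segment (of_real ?a) (of_real ?b :: complex)"
  define f where "f = (\<lambda>z::complex. z powr (1 - \<xi>) - (1 - \<xi>) * of_real ?a powr (-\<xi>) * z)"
  have "norm (f (of_real ?b) - f (of_real ?a)) \<le> (norm (\<xi> - 1) * norm \<xi> * real n powr (-Re \<xi> - 1)) * norm (of_real ?b - of_real ?a :: complex)"
  proof (rule field_differentiable_bound[of ?S _ "\<lambda>z. (1 - \<xi>) * (z powr (-\<xi>) - of_real ?a powr (-\<xi>))"])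
    fix z assume "z \<in> ?S"
    moreover have "?a \<le> ?b" by simp
    ultimately obtain t where t: "z = of_real t" "?a \<le> t" "t \<le> ?b" using segment_real_cases by blast
    then have z: "z \<notin> \<real>\<^sub>\<le>\<^sub>0" using assms by auto
    have "(f has_field_derivative (1 - \<xi>) * z powr (1 - \<xi> - 1) - (1 - \<xi>) * of_real ?a powr (-\<xi>) * 1) (at z within ?S)"
      unfolding f_def using z
      by (intro DERIV_diff has_field_derivative_at_within[OF has_field_derivative_powr] DERIV_cmult DERIV_ident)
    then show "(f has_field_derivative (1 - \<xi>) * (z powr (-\<xi>) - of_real ?a powr (-\<xi>))) (at z within ?S)"
      by (simp add: algebra_simps)
    have "norm (z powr (-\<xi>) - of_real ?a powr (-\<xi>)) \<le> norm \<xi> * real n powr (-Re \<xi> - 1) * (t - ?a)"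
      unfolding t(1) using assms t by (intro norm_powr_diff_le) auto
    also have "\<dots> \<le> norm \<xi> * real n powr (-Re \<xi> - 1) * 1"
      using t by (intro mult_left_mono) auto
    finally show "norm ((1 - \<xi>) * (z powr (-\<xi>) - of_real ?a powr (-\<xi>))) \<le> norm (\<xi> - 1) * norm \<xi> * real n powr (-Re \<xi> - 1)"
      by (simp add: norm_mult norm_minus_commute mult_left_mono mult.assoc)
  qed auto
  also have "f (of_real ?b) - f (of_real ?a) = zeta_term n \<xi>"
  proof -
    have b: "(of_real ?b :: complex) = of_real ?a + 1" by simp
    have "f (of_real ?b) - f (of_real ?a) =
        of_real ?b powr (1 - \<xi>) - of_real ?a powr (1 - \<xi>) - (1 - \<xi>) * of_real ?a powr (-\<xi>) * (of_real ?b - of_real ?a)"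
      unfolding f_def by (simp only: right_diff_distrib) (simp only: diff_diff_eq2 diff_add_eq add_diff_eq diff_diff_eq add.commute add.left_commute)
    also have "\<dots> = zeta_term n \<xi>"
      unfolding zeta_term_def b by (simp add: algebra_simps)
    finally show ?thesis .
  qed
  also have "norm (of_real ?b - of_real ?a :: complex) = 1" by simp
  finally show ?thesis by (simp only: mult_1_right)
qed

section \<open>Holomorphic series on half planes\<close>

lemma summable_Suc_powr: "d > 0 \<Longrightarrow> summable (\<lambda>n. real (Suc n) powr (-d - 1))"
proof -
  assume "d > 0"
  then have "summable (\<lambda>n. real n powr (-d - 1))" by (subst summable_real_powr_iff) simp
  then show ?thesis by (subst summable_Suc_iff)
qed

lemma open_Re_gt: "open {\<xi>. Re \<xi> > c}"
  by (simp add: open_halfspace_Re_gt)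

text \<open>Weierstrass test. On a ball around \<open>\<xi>\<close> of radius half the distance to
  the boundary line, the exponent stays uniformly below -1. The factor \<open>P\<close> admits
  bounds that grow with \<open>norm \<xi>\<close>, as for \<open>zeta_term\<close>; the series of
  derivatives is included because the differential equation for \<open>Z\<close> in
  \<open>mangoldt_series_times\<close> is read off from it.\<close>

lemma holomorphic_series_on_half_plane:
  fixes f :: "nat \<Rightarrow> complex \<Rightarrow> complex" and P :: "real \<Rightarrow> real"
  assumes holo: "\<And>n. f n holomorphic_on {\<xi>. Re \<xi> > c}"
    and bound: "\<And>n \<xi>. Re \<xi> > c \<Longrightarrow> norm (f n \<xi>) \<le> P (norm \<xi>) * real (Suc n) powr (-(Re \<xi> - c) - 1)"
    and P: "mono P" "\<And>x. P x \<ge> 0"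
  shows "Re \<xi> > c \<Longrightarrow> (\<lambda>n. f n \<xi>) sums (\<Sum>n. f n \<xi>)"
    and "Re \<xi> > c \<Longrightarrow> (\<lambda>n. deriv (f n) \<xi>) sums deriv (\<lambda>\<xi>. \<Sum>n. f n \<xi>) \<xi>"
    and "(\<lambda>\<xi>. \<Sum>n. f n \<xi>) holomorphic_on {\<xi>. Re \<xi> > c}"
proof -
  let ?S = "{\<xi>. Re \<xi> > c}"
  have "\<exists>g g'. \<forall>x \<in> ?S. ((\<lambda>n. f n x) sums g x) \<and> ((\<lambda>n. deriv (f n) x) sums g' x) \<and> (g has_field_derivative g' x) (at x)"
  proof (rule series_and_derivative_comparison_local[OF open_Re_gt])
    show "(f n has_field_derivative deriv (f n) x) (at x)" if "x \<in> ?S" for n x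
      using holomorphic_derivI[OF holo open_Re_gt that] .
    fix x assume x: "x \<in> ?S"
    define d where "d = (Re x - c) / 2"
    have d: "d > 0" using x by (simp add: d_def)
    have *: "norm (f n y) \<le> P (norm x + d) * real (Suc n) powr (-d - 1)" if "y \<in> ball x d \<inter> ?S" for n y
    proof -
      have y: "norm (x - y) < d" "Re y > c" using that by (auto simp: dist_norm)
      have "Re x - Re y \<le> norm (x - y)" using complex_Re_le_cmod[of "x - y"] by simp
      with y have "Re x - Re y < (Re x - c) / 2" unfolding d_def by linarith
      then have "Re y - c \<ge> d" unfolding d_def by (simp add: field_simps)
      then have "real (Suc n) powr (-(Re y - c) - 1) \<le> real (Suc n) powr (-d - 1)"
        by (intro powr_mono) auto
      moreover have "norm y \<le> norm x + d" using y norm_triangle_ineq2[of y x] by (simp add: norm_minus_commute)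
      then have "P (norm y) \<le> P (norm x + d)" using P(1) by (simp add: mono_def)
      ultimately show ?thesis using bound[OF y(2), of n] P(2)
        by (meson mult_mono order_trans powr_ge_zero)
    qed
    show "\<exists>d h. 0 < d \<and> summable h \<and> (\<forall>\<^sub>F n in sequentially. \<forall>y\<in>ball x d \<inter> ?S. norm (f n y) \<le> h n)"
      using d * by (intro exI[of _ d] exI[of _ "\<lambda>n. P (norm x + d) * real (Suc n) powr (-d - 1)"])
        (auto intro!: summable_mult summable_Suc_powr simp del: of_nat_Suc)
  qed
  then obtain g g' where g: "\<And>x. x \<in> ?S \<Longrightarrow> (\<lambda>n. f n x) sums g x"
    "\<And>x. x \<in> ?S \<Longrightarrow> (\<lambda>n. deriv (f n) x) sums g' x" "\<And>x. x \<in> ?S \<Longrightarrow> (g has_field_derivative g' x) (at x)"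
    by blast
  have eq: "g x = (\<Sum>n. f n x)" if "x \<in> ?S" for x using g(1)[OF that] by (simp add: sums_iff)
  have der: "((\<lambda>\<xi>. \<Sum>n. f n \<xi>) has_field_derivative g' x) (at x)" if "x \<in> ?S" for x
    by (rule has_field_derivative_transform_within_open[OF g(3)[OF that] open_Re_gt that]) (rule eq)
  show "(\<lambda>n. f n \<xi>) sums (\<Sum>n. f n \<xi>)" if "Re \<xi> > c" using g(1)[of \<xi>] eq that by simp
  show "(\<lambda>n. deriv (f n) \<xi>) sums deriv (\<lambda>\<xi>. \<Sum>n. f n \<xi>) \<xi>" if "Re \<xi> > c"
    using g(2)[of \<xi>] der[of \<xi>] that by (simp add: DERIV_imp_deriv)
  show "(\<lambda>\<xi>. \<Sum>n. f n \<xi>) holomorphic_on ?S"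
    unfolding holomorphic_on_open[OF open_Re_gt] using der by auto
qed

text \<open>This is \<open>(\<xi> - 1) * \<zeta>(\<xi>)\<close>, so the pole is removed. For
  \<open>Re \<xi> > 1\<close> the leading 1 is the telescoping sum of
  \<open>n powr (1 - \<xi>) - (n + 1) powr (1 - \<xi>)\<close>.\<close>

definition zeta_reg :: "complex \<Rightarrow> complex" where
  "zeta_reg \<xi> = 1 + (\<Sum>n. zeta_term (Suc n) \<xi>)"

lemma zeta_term_holomorphic: "n > 0 \<Longrightarrow> zeta_term n holomorphic_on X"
  unfolding zeta_term_def by (intro holomorphic_intros) auto

lemma zeta_reg_series:
  shows "Re \<xi> > 0 \<Longrightarrow> (\<lambda>n. zeta_term (Suc n) \<xi>) sums (zeta_reg \<xi> - 1)"
    and zeta_reg_holomorphic: "zeta_reg holomorphic_on {\<xi>. Re \<xi> > 0}"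
proof -
  have b: "norm (zeta_term (Suc n) \<xi>) \<le> ((norm \<xi> + 1) * norm \<xi>) * real (Suc n) powr (-(Re \<xi> - 0) - 1)"
    if "Re \<xi> > 0" for n \<xi>
  proof -
    have "norm (zeta_term (Suc n) \<xi>) \<le> norm (\<xi> - 1) * norm \<xi> * real (Suc n) powr (-Re \<xi> - 1)"
      using that by (intro norm_zeta_term_le) auto
    also have "\<dots> \<le> (norm \<xi> + 1) * norm \<xi> * real (Suc n) powr (-Re \<xi> - 1)"
      using norm_triangle_ineq4[of \<xi> 1] by (intro mult_right_mono) auto
    finally show ?thesis by simp
  qed
  have b': "norm (zeta_term (Suc n) \<xi>) \<le> (\<lambda>x. (max 0 x + 1) * max 0 x) (norm \<xi>) * real (Suc n) powr (-(Re \<xi> - 0) - 1)"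
    if "Re \<xi> > 0" for n \<xi> using b[OF that, of n] by simp
  have m: "mono (\<lambda>x::real. (max 0 x + 1) * max 0 x)"
    by (intro monoI mult_mono) auto
  have nn: "(\<lambda>x::real. (max 0 x + 1) * max 0 x) x \<ge> 0" for x by auto
  note A = holomorphic_series_on_half_plane[of "\<lambda>n. zeta_term (Suc n)" 0, OF zeta_term_holomorphic b' m nn, simplified]
  show "Re \<xi> > 0 \<Longrightarrow> (\<lambda>n. zeta_term (Suc n) \<xi>) sums (zeta_reg \<xi> - 1)"
    using A(1) by (simp add: zeta_reg_def)
  have "(\<lambda>\<xi>. 1 + (\<Sum>n. zeta_term (Suc n) \<xi>)) holomorphic_on {\<xi>. Re \<xi> > 0}"
    using A(3) by (intro holomorphic_intros) auto
  then show "zeta_reg holomorphic_on {\<xi>. Re \<xi> > 0}"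
    unfolding zeta_reg_def[abs_def] .
qed

lemma zeta_reg_1: "zeta_reg 1 = 1"
  by (simp add: zeta_reg_def zeta_term_def del: of_nat_Suc)

lemma powr_neg_tendsto_0:
  assumes "Re \<xi> < 0"
  shows "(\<lambda>n. of_nat (Suc n) powr \<xi> :: complex) \<longlonglongrightarrow> 0"
proof (rule tendsto_norm_zero_cancel)
  have "(\<lambda>n. real (Suc n) powr Re \<xi>) \<longlonglongrightarrow> 0" using assms by real_asymp
  then show "(\<lambda>n. norm (of_nat (Suc n) powr \<xi> :: complex)) \<longlonglongrightarrow> 0"
    by (subst norm_of_nat_powr) auto
qed

lemma zeta_series:
  assumes "Re \<xi> > 1"
  shows "(\<lambda>n. of_nat (Suc n) powr (-\<xi>)) sums (zeta_reg \<xi> / (\<xi> - 1))"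
proof -
  have "(\<lambda>n. of_nat (Suc n) powr (1 - \<xi>) - of_nat (Suc (Suc n)) powr (1 - \<xi>) :: complex) sums (of_nat (Suc 0) powr (1 - \<xi>) - 0)"
    by (rule telescope_sums') (use assms powr_neg_tendsto_0 in auto)
  moreover have "(\<lambda>n. zeta_term (Suc n) \<xi>) sums (zeta_reg \<xi> - 1)"
    using assms by (intro zeta_reg_series) auto
  ultimately have "(\<lambda>n. zeta_term (Suc n) \<xi> + (of_nat (Suc n) powr (1 - \<xi>) - of_nat (Suc (Suc n)) powr (1 - \<xi>))) sums
     ((zeta_reg \<xi> - 1) + (of_nat (Suc 0) powr (1 - \<xi>) - 0))"
    by (intro sums_add)
  also have "(\<lambda>n. zeta_term (Suc n) \<xi> + (of_nat (Suc n) powr (1 - \<xi>) - of_nat (Suc (Suc n)) powr (1 - \<xi>))) =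
     (\<lambda>n. (\<xi> - 1) * of_nat (Suc n) powr (-\<xi>))"
    by (simp add: zeta_term_def fun_eq_iff)
  finally have "(\<lambda>n. (\<xi> - 1) * of_nat (Suc n) powr (-\<xi>) / (\<xi> - 1)) sums (zeta_reg \<xi> / (\<xi> - 1))"
    by (intro sums_divide) simp
  moreover have "\<xi> \<noteq> 1" using assms by auto
  ultimately show ?thesis by simp
qed

section \<open>The character modulo 4 and its L-function\<close>

definition chi4 :: "nat \<Rightarrow> real" where
  "chi4 n = (if n mod 4 = 1 then 1 else if n mod 4 = 3 then -1 else 0)"

lemma chi4_mult: "chi4 (m * n) = chi4 m * chi4 n"
proof -
  have "chi4 (m * n) = chi4 (((m mod 4) * (n mod 4)) mod 4)"
    by (simp add: chi4_def mod_mult_eq)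
  moreover have "m mod 4 = 0 \<or> m mod 4 = 1 \<or> m mod 4 = 2 \<or> m mod 4 = 3" by presburger
  moreover have "n mod 4 = 0 \<or> n mod 4 = 1 \<or> n mod 4 = 2 \<or> n mod 4 = 3" by presburger
  ultimately show ?thesis by (elim disjE) (simp_all add: chi4_def)
qed

lemma abs_chi4_le: "\<bar>chi4 n\<bar> \<le> 1" by (simp add: chi4_def)

text \<open>Pairing the terms at \<open>4 * k + 1\<close> and \<open>4 * k + 3\<close> gains one
  power of \<open>k\<close>, hence convergence for \<open>Re \<xi> > 0\<close>.\<close>

definition L_term :: "nat \<Rightarrow> complex \<Rightarrow> complex" where
  "L_term k \<xi> = of_nat (4 * k + 1) powr (-\<xi>) - of_nat (4 * k + 3) powr (-\<xi>)"

definition L_chi4 :: "complex \<Rightarrow> complex" where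
  "L_chi4 \<xi> = (\<Sum>k. L_term k \<xi>)"

lemma L_chi4_series:
  shows "Re \<xi> > 0 \<Longrightarrow> (\<lambda>k. L_term k \<xi>) sums L_chi4 \<xi>"
    and L_chi4_holomorphic: "L_chi4 holomorphic_on {\<xi>. Re \<xi> > 0}"
proof -
  have b: "norm (L_term k \<xi>) \<le> (2 * max 0 (norm \<xi>)) * real (Suc k) powr (-(Re \<xi> - 0) - 1)"
    if "Re \<xi> > 0" for k \<xi>
  proof -
    have "norm (of_real (real (4*k+3)) powr (-\<xi>) - of_real (real (4*k+1)) powr (-\<xi>) :: complex) \<le>
        norm \<xi> * real (4*k+1) powr (-Re \<xi> - 1) * (real (4*k+3) - real (4*k+1))"
      using that by (intro norm_powr_diff_le) auto
    also have "\<dots> = (2 * norm \<xi>) * real (4*k+1) powr (-Re \<xi> - 1)" by simp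
    also have "\<dots> \<le> (2 * norm \<xi>) * real (Suc k) powr (-Re \<xi> - 1)"
      using that by (intro mult_left_mono powr_mono2') auto
    finally show ?thesis by (simp add: L_term_def norm_minus_commute add.commute)
  qed
  have h: "L_term k holomorphic_on X" for k X
    unfolding L_term_def by (auto intro!: holomorphic_intros)
  have m: "mono (\<lambda>x::real. 2 * max 0 x)" by (auto intro!: monoI)
  note A = holomorphic_series_on_half_plane[of L_term 0, OF h b m, simplified]
  show "Re \<xi> > 0 \<Longrightarrow> (\<lambda>k. L_term k \<xi>) sums L_chi4 \<xi>"
    using A(1) by (simp add: L_chi4_def)
  show "L_chi4 holomorphic_on {\<xi>. Re \<xi> > 0}"
    using A(3) by (simp add: L_chi4_def[abs_def])
qed

text \<open>All paired terms are positive on the positive real axis. At \<open>x = 1\<close> this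
  settles the point that the 3-4-1 argument cannot reach.\<close>

lemma L_chi4_real_nonzero:
  assumes "x > 0"
  shows "L_chi4 (of_real x) \<noteq> 0"
proof -
  have re: "Re (L_term k (of_real x)) = real (4*k+1) powr (-x) - real (4*k+3) powr (-x)" for k
  proof -
    have "of_nat n powr - of_real x = (of_real (real n powr (-x)) :: complex)" for n
      using powr_of_real[of "real n" "-x"] by simp
    then show ?thesis unfolding L_term_def by (simp only: minus_complex.simps Re_complex_of_real)
  qed
  have "(\<lambda>k. Re (L_term k (of_real x))) sums Re (L_chi4 (of_real x))"
    using assms by (intro sums_Re L_chi4_series) auto
  then have \<xi>: "(\<lambda>k. real (4*k+1) powr (-x) - real (4*k+3) powr (-x)) sums Re (L_chi4 (of_real x))"
    unfolding re .
  have pos: "real (4*k+1) powr (-x) - real (4*k+3) powr (-x) > 0" for k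
    using assms powr_less_mono2_neg[of "-x" "real (4*k+1)" "real (4*k+3)"] by simp
  have "Re (L_chi4 (of_real x)) > 0"
    using suminf_pos[OF sums_summable[OF \<xi>] pos] \<xi> by (simp add: sums_iff)
  then show ?thesis by auto
qed

lemma chi4_series:
  assumes "Re \<xi> > 1"
  shows "(\<lambda>n. of_real (chi4 (Suc n)) * of_nat (Suc n) powr (-\<xi>)) sums L_chi4 \<xi>"
proof -
  define f where "f = (\<lambda>n. of_real (chi4 n) * of_nat n powr (-\<xi>) :: complex)"
  have "summable (\<lambda>n. real (Suc n) powr (-(Re \<xi> - 1) - 1))"
    using assms by (intro summable_Suc_powr) auto
  then have "summable (\<lambda>n. f (Suc n))"
  proof (rule summable_norm_cancel[OF summable_comparison_test', of _ 0])
    show "norm (norm (f (Suc n))) \<le> real (Suc n) powr (-(Re \<xi> - 1) - 1)" for n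
      using abs_chi4_le[of "Suc n"] unfolding f_def
      by (simp add: norm_mult norm_of_nat_powr mult_left_le_one_le del: of_nat_Suc)
  qed
  then have sf: "summable f" by (simp only: summable_Suc_iff)
  have "(\<lambda>n. sum f {n*4..<n*4+4}) sums (\<Sum>n. f n)"
    using sf by (intro sums_group summable_sums) auto
  also have "(\<lambda>n. sum f {n*4..<n*4+4}) = (\<lambda>k. L_term k \<xi>)"
  proof
    fix k :: nat
    have "{k*4..<k*4+4} = {4*k, 4*k+1, 4*k+2, 4*k+3}" by auto
    moreover have "4 * k mod 4 = 0" "(4 * k + 1) mod 4 = 1" "(4 * k + 2) mod 4 = 2" "(4 * k + 3) mod 4 = 3"
      by presburger+
    then have "chi4 (4*k) = 0" "chi4 (4*k+1) = 1" "chi4 (4*k+2) = 0" "chi4 (4*k+3) = -1"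
      by (simp_all only: chi4_def) simp_all
    ultimately show "sum f {k*4..<k*4+4} = L_term k \<xi>"
      by (simp add: f_def L_term_def)
  qed
  finally have "(\<Sum>n. f n) = L_chi4 \<xi>"
    using L_chi4_series(1)[of \<xi>] assms sums_unique2 by force
  then have "f sums L_chi4 \<xi>" using sf by (simp add: sums_iff)
  moreover have "f 0 = 0" by (simp add: f_def)
  ultimately show ?thesis unfolding f_def by (subst sums_Suc_iff) simp
qed

text \<open>Absolute convergence over all pairs \<open>(d, e)\<close> allows regrouping by the
  product \<open>d * e\<close>.\<close>

lemma dirichlet_product:
  fixes a b :: "nat \<Rightarrow> complex"
  assumes "summable (\<lambda>n. norm (a (Suc n)))" "summable (\<lambda>n. norm (b (Suc n)))"
  shows "(\<lambda>n. \<Sum>d | d dvd Suc n. a d * b (Suc n div d)) sums ((\<Sum>n. a (Suc n)) * (\<Sum>n. b (Suc n)))"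
proof -
  have sum1: "(\<lambda>n. norm (x n)) summable_on {1..} \<and> (x has_sum (\<Sum>n. x (Suc n))) {1..}"
    if "summable (\<lambda>n. norm (x (Suc n)))" for x :: "nat \<Rightarrow> complex"
  proof
    have "(\<lambda>n. norm (x (Suc n))) summable_on UNIV"
      using that by (intro summable_nonneg_imp_summable_on) auto
    then show "(\<lambda>n. norm (x n)) summable_on {1..}"
      by (subst (asm) summable_on_reindex_bij_witness[of _ "\<lambda>n. n - 1" Suc "{1..}" "\<lambda>n. norm (x n)"]) auto
    have "((\<lambda>n. x (Suc n)) has_sum (\<Sum>n. x (Suc n))) UNIV"
      using that by (intro norm_summable_imp_has_sum summable_sums summable_norm_cancel[OF that]) auto
    then show "(x has_sum (\<Sum>n. x (Suc n))) {1..}"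
      by (subst (asm) has_sum_reindex_bij_witness[of _ "\<lambda>n. n - 1" Suc "{1..}" x]) auto
  qed
  note A = sum1[OF assms(1)] and B = sum1[OF assms(2)]
  define f where "f = (\<lambda>(d, e). a d * b e)"
  have "(\<lambda>p. norm (f p)) summable_on ({1..} \<times> {1..})"
  proof (rule Infinite_Sum.abs_summable_on_Sigma_iff[where f = f and A = "{1..}" and B = "\<lambda>_. {1..}", THEN iffD2], intro conjI ballI)
    fix d :: nat
    show "(\<lambda>e. norm (f (d, e))) summable_on {1..}"
      using B by (auto simp: f_def norm_mult intro!: summable_on_cmult_right)
  next
    have "(\<lambda>d. norm (a d) * infsum (\<lambda>e. norm (b e)) {1..}) summable_on {1..}"
      using A by (intro summable_on_cmult_left) auto
    then have "(\<lambda>d. norm (norm (a d) * infsum (\<lambda>e. norm (b e)) {1..})) summable_on {1..}"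
      by (subst summable_on_iff_abs_summable_on_real[symmetric])
    then show "(\<lambda>d. norm (infsum (\<lambda>e. norm (f (d, e))) {1..})) summable_on {1..}"
      by (simp add: f_def norm_mult infsum_cmult_right')
  qed
  then have f_sum: "f summable_on ({1..} \<times> {1..})"
    by (rule Infinite_Sum.abs_summable_summable)
  have "(f has_sum ((\<Sum>n. a (Suc n)) * (\<Sum>n. b (Suc n)))) ({1..} \<times> {1..})"
  proof (rule has_sum_SigmaI[OF _ _ f_sum])
    show "((\<lambda>e. f (d, e)) has_sum (a d * (\<Sum>n. b (Suc n)))) {1..}" for d
      using B by (auto simp: f_def intro!: has_sum_cmult_right)
    show "((\<lambda>d. a d * (\<Sum>n. b (Suc n))) has_sum ((\<Sum>n. a (Suc n)) * (\<Sum>n. b (Suc n)))) {1..}"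
      using A by (auto intro!: has_sum_cmult_left)
  qed
  also have "?this \<longleftrightarrow> ((\<lambda>(n, d). a d * b (n div d)) has_sum ((\<Sum>n. a (Suc n)) * (\<Sum>n. b (Suc n))))
      (SIGMA n:{1..}. {d. d dvd n})"
    by (rule has_sum_reindex_bij_witness[of _ "\<lambda>(n, d). (d, n div d)" "\<lambda>(d, e). (d * e, d)"])
       (auto simp: f_def Suc_le_eq elim!: dvdE)
  finally have "((\<lambda>n. \<Sum>d | d dvd n. a d * b (n div d)) has_sum ((\<Sum>n. a (Suc n)) * (\<Sum>n. b (Suc n)))) {1..}"
    by (rule has_sum_SigmaD) (auto intro!: has_sum_finiteI)
  then have "((\<lambda>n. \<Sum>d | d dvd Suc n. a d * b (Suc n div d)) has_sum ((\<Sum>n. a (Suc n)) * (\<Sum>n. b (Suc n)))) UNIV"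
    by (subst has_sum_reindex_bij_witness[of _ "\<lambda>n. n - 1" Suc "{1..}" "\<lambda>n. \<Sum>d | d dvd n. a d * b (n div d)"]) auto
  then show ?thesis by (rule has_sum_imp_sums)
qed

section \<open>Non-vanishing on the line of real part 1\<close>

lemma of_nat_mult_powr: "of_nat (m * n) powr \<xi> = (of_nat m powr \<xi> * of_nat n powr \<xi> :: complex)"
  using powr_times_real[of "of_nat m" "of_nat n" \<xi>] by simp

text \<open>For completely multiplicative \<open>f\<close> this is minus the logarithmic derivative
  of the Dirichlet series of \<open>f\<close>.\<close>

definition mangoldt_series :: "(nat \<Rightarrow> real) \<Rightarrow> complex \<Rightarrow> complex" where
  "mangoldt_series f \<xi> = (\<Sum>n. of_real (mangoldt (Suc n) * f (Suc n)) * of_nat (Suc n) powr (-\<xi>))"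

lemma norm_mangoldt_term_le:
  fixes f :: "nat \<Rightarrow> real"
  assumes "\<And>n. \<bar>f n\<bar> \<le> 1" "c > 1"
  shows "norm (of_real (mangoldt (Suc n) * f (Suc n)) * of_nat (Suc n) powr (-\<xi>) :: complex) \<le>
    1 / (c - 1) * real (Suc n) powr (-(Re \<xi> - c) - 1)"
proof -
  let ?N = "real (Suc n)"
  have "norm (of_real (mangoldt (Suc n) * f (Suc n)) * of_nat (Suc n) powr (-\<xi>) :: complex) =
      mangoldt (Suc n) * \<bar>f (Suc n)\<bar> * ?N powr (-Re \<xi>)"
    by (simp add: norm_mult norm_of_nat_powr abs_mult del: of_nat_Suc)
  also have "\<dots> \<le> (?N powr (c - 1) / (c - 1)) * 1 * ?N powr (-Re \<xi>)"
  proof (intro mult_right_mono mult_mono assms(1))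
    have "mangoldt (Suc n) \<le> ln ?N" by (rule mangoldt_le) simp
    also have "\<dots> \<le> ?N powr (c - 1) / (c - 1)"
      using assms(2) by (intro ln_powr_bound) auto
    finally show "mangoldt (Suc n) \<le> ?N powr (c - 1) / (c - 1)" .
  qed (use assms(2) in auto)
  also have "\<dots> = 1 / (c - 1) * (?N powr (c - 1) * ?N powr (-Re \<xi>))" by simp
  also have "?N powr (c - 1) * ?N powr (-Re \<xi>) = ?N powr (-(Re \<xi> - c) - 1)"
    by (subst powr_add[symmetric]) (simp add: algebra_simps)
  finally show ?thesis .
qed

lemma mangoldt_series:
  fixes f :: "nat \<Rightarrow> real"
  assumes "\<And>n. \<bar>f n\<bar> \<le> 1"
  shows summable_norm_mangoldt_series: "Re \<xi> > 1 \<Longrightarrow>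
      summable (\<lambda>n. norm (of_real (mangoldt (Suc n) * f (Suc n)) * of_nat (Suc n) powr (-\<xi>) :: complex))"
    and mangoldt_series_holomorphic: "mangoldt_series f holomorphic_on {\<xi>. Re \<xi> > 1}"
proof -
  let ?t = "\<lambda>n \<xi>. of_real (mangoldt (Suc n) * f (Suc n)) * of_nat (Suc n) powr (-\<xi>) :: complex"
  show "summable (\<lambda>n. norm (?t n \<xi>))" if "Re \<xi> > 1"
  proof (rule summable_comparison_test'[of _ 0])
    define c where "c = (1 + Re \<xi>) / 2"
    have c: "c > 1" "Re \<xi> > c" using that by (auto simp: c_def)
    show "summable (\<lambda>n. 1 / (c - 1) * real (Suc n) powr (-(Re \<xi> - c) - 1))"
      using c by (intro summable_mult summable_Suc_powr) auto
    show "norm (norm (?t n \<xi>)) \<le> 1 / (c - 1) * real (Suc n) powr (-(Re \<xi> - c) - 1)" for n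
      using norm_mangoldt_term_le[of f c n \<xi>] assms c by (simp only: real_norm_def abs_norm_cancel)
  qed
  have "mangoldt_series f holomorphic_on {\<xi>. Re \<xi> > c}" if c: "c > 1" for c
  proof -
    have h: "?t n holomorphic_on X" for n X
      by (auto intro!: holomorphic_intros simp del: of_nat_Suc)
    have "norm (?t n \<xi>) \<le> 1 / (c - 1) * real (Suc n) powr (-(Re \<xi> - c) - 1)" for n \<xi>
      using assms c by (rule norm_mangoldt_term_le)
    moreover have "mono (\<lambda>_::real. 1 / (c - 1))" by (simp add: mono_def)
    moreover have "1 / (c - 1) \<ge> 0" using c by simp
    ultimately have "(\<lambda>\<xi>. \<Sum>n. ?t n \<xi>) holomorphic_on {\<xi>. Re \<xi> > c}"
      using holomorphic_series_on_half_plane(3)[where f = ?t and c = c and P = "\<lambda>_. 1 / (c - 1)", OF h] by blast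
    then show ?thesis by (simp add: mangoldt_series_def[abs_def])
  qed
  \<comment> \<open>The factor \<open>1 / (c - 1)\<close> in the bound blows up as \<open>c\<close>
    tends to 1, so the half plane is exhausted by smaller ones.\<close>
  then have "mangoldt_series f holomorphic_on (\<Union>c\<in>{1<..}. {\<xi>. Re \<xi> > c})"
    by (intro holomorphic_on_UN_open) (auto simp: open_Re_gt)
  also have "(\<Union>c\<in>{1<..}. {\<xi>. Re \<xi> > c}) = {\<xi>. Re \<xi> > 1}"
    by (auto dest: dense)
  finally show "mangoldt_series f holomorphic_on {\<xi>. Re \<xi> > 1}" .
qed

text \<open>Rests on the identity that \<open>mangoldt\<close> convolved with 1 is the logarithm,
  twisted by \<open>f\<close>. Stated as a linear differential equation rather than as a quotient,
  it does not presuppose that \<open>Z\<close> is nonzero; that is deduced from it.\<close>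

lemma mangoldt_series_times:
  fixes f :: "nat \<Rightarrow> real"
  assumes f: "\<And>n. \<bar>f n\<bar> \<le> 1" "\<And>m n. f (m * n) = f m * f n"
    and Z: "\<And>\<xi>. Re \<xi> > 1 \<Longrightarrow> (\<lambda>n. of_real (f (Suc n)) * of_nat (Suc n) powr (-\<xi>)) sums Z \<xi>"
    and \<xi>: "Re \<xi> > 1"
  shows "(Z has_field_derivative -(mangoldt_series f \<xi> * Z \<xi>)) (at \<xi>)"
proof -
  let ?t = "\<lambda>n \<xi>. of_real (f (Suc n)) * of_nat (Suc n) powr (-\<xi>) :: complex"
  define a where "a = (\<lambda>n. of_real (mangoldt n * f n) * of_nat n powr (-\<xi>) :: complex)"
  define b where "b = (\<lambda>n. of_real (f n) * of_nat n powr (-\<xi>) :: complex)"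
  have der: "(?t n has_field_derivative -(of_real (ln (real (Suc n))) * b (Suc n))) (at \<xi>)" for n
  proof -
    have "Ln (of_nat (Suc n)) = of_real (ln (real (Suc n)))"
      using Ln_of_real[of "real (Suc n)"] by (simp del: of_nat_Suc)
    moreover have "((\<lambda>\<xi>. of_nat (Suc n) powr (-\<xi>)) has_field_derivative
        Ln (of_nat (Suc n)) * of_nat (Suc n) powr (-\<xi>) * (-1)) (at \<xi>)"
      by (rule DERIV_chain2[OF has_field_derivative_powr_right]) (auto intro!: derivative_eq_intros simp del: of_nat_Suc)
    ultimately have "(?t n has_field_derivative
        of_real (f (Suc n)) * (of_real (ln (real (Suc n))) * of_nat (Suc n) powr (-\<xi>) * (-1))) (at \<xi>)"
      by (intro DERIV_cmult) simp
    then show ?thesis by (simp add: b_def mult_ac)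
  qed
  have h: "?t n holomorphic_on X" for n X
    by (auto intro!: holomorphic_intros simp del: of_nat_Suc)
  have bd: "norm (?t n \<xi>) \<le> 1 * real (Suc n) powr (-(Re \<xi> - 1) - 1)" for n \<xi>
    using f(1)[of "Suc n"] by (simp add: norm_mult norm_of_nat_powr mult_left_le_one_le del: of_nat_Suc)
  have mono1: "mono (\<lambda>_::real. 1::real)" by (simp add: mono_def)
  note A = holomorphic_series_on_half_plane[where f = ?t and c = 1 and P = "\<lambda>_. 1", OF h bd mono1 zero_le_one]
  have Zeq: "Z z = (\<Sum>n. ?t n z)" if "Re z > 1" for z
    using Z[OF that] by (simp add: sums_iff)
  have derZ: "((\<lambda>z. \<Sum>n. ?t n z) has_field_derivative deriv (\<lambda>z. \<Sum>n. ?t n z) \<xi>) (at \<xi>)"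
    using holomorphic_derivI[OF A(3) open_Re_gt] \<xi> by simp
  have "deriv (?t n) \<xi> = -(of_real (ln (real (Suc n))) * b (Suc n))" for n
    using der by (rule DERIV_imp_deriv)
  then have lnsums: "(\<lambda>n. -(of_real (ln (real (Suc n))) * b (Suc n))) sums deriv (\<lambda>z. \<Sum>n. ?t n z) \<xi>"
    using A(2)[OF \<xi>] by simp
  have suma: "summable (\<lambda>n. norm (a (Suc n)))"
    using summable_norm_mangoldt_series[of f \<xi>] f(1) \<xi> by (simp add: a_def)
  have sumb: "summable (\<lambda>n. norm (b (Suc n)))"
  proof (rule summable_comparison_test'[of _ 0])
    show "summable (\<lambda>n. real (Suc n) powr (-(Re \<xi> - 1) - 1))"
      using \<xi> by (intro summable_Suc_powr) auto
    show "norm (norm (b (Suc n))) \<le> real (Suc n) powr (-(Re \<xi> - 1) - 1)" for n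
      using bd[of n \<xi>] by (simp only: real_norm_def abs_norm_cancel b_def mult_1)
  qed
  have "(\<lambda>n. \<Sum>d | d dvd Suc n. a d * b (Suc n div d)) sums ((\<Sum>n. a (Suc n)) * (\<Sum>n. b (Suc n)))"
    using suma sumb by (rule dirichlet_product)
  also have "(\<lambda>n. \<Sum>d | d dvd Suc n. a d * b (Suc n div d)) = (\<lambda>n. of_real (ln (real (Suc n))) * b (Suc n))"
  proof
    fix n
    have "(\<Sum>d | d dvd Suc n. a d * b (Suc n div d)) = (\<Sum>d | d dvd Suc n. mangoldt d * b (Suc n))"
    proof (rule sum.cong[OF refl])
      fix d assume "d \<in> {d. d dvd Suc n}"
      then have d: "Suc n = d * (Suc n div d)" by simp
      have "b (Suc n) = of_real (f d * f (Suc n div d)) * (of_nat d powr (-\<xi>) * of_nat (Suc n div d) powr (-\<xi>))"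
        unfolding b_def using f(2)[of d "Suc n div d"] of_nat_mult_powr[of d "Suc n div d" "-\<xi>"] d by metis
      then show "a d * b (Suc n div d) = mangoldt d * b (Suc n)"
        by (simp add: a_def b_def mult_ac)
    qed
    also have "\<dots> = of_real (ln (real (Suc n))) * b (Suc n)"
      unfolding sum_distrib_right[symmetric] by (subst mangoldt_sum) auto
    finally show "(\<Sum>d | d dvd Suc n. a d * b (Suc n div d)) = of_real (ln (real (Suc n))) * b (Suc n)" .
  qed
  finally have "(\<lambda>n. -(of_real (ln (real (Suc n))) * b (Suc n))) sums -((\<Sum>n. a (Suc n)) * (\<Sum>n. b (Suc n)))"
    by (rule sums_minus)
  then have "deriv (\<lambda>z. \<Sum>n. ?t n z) \<xi> = -((\<Sum>n. a (Suc n)) * (\<Sum>n. b (Suc n)))"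
    using lnsums sums_unique2 by blast
  also have "\<dots> = -(mangoldt_series f \<xi> * Z \<xi>)"
    using Zeq[OF \<xi>] by (simp add: mangoldt_series_def a_def b_def)
  finally have "((\<lambda>z. \<Sum>n. ?t n z) has_field_derivative -(mangoldt_series f \<xi> * Z \<xi>)) (at \<xi>)"
    using derZ by simp
  then show ?thesis
    by (rule has_field_derivative_transform_within_open[OF _ open_Re_gt]) (use \<xi> Zeq in auto)
qed

text \<open>For a primitive \<open>h\<close> of \<open>D\<close> the product of \<open>Z\<close> and
  \<open>exp h\<close> has derivative 0, so one nonzero value of \<open>Z\<close> suffices. This
  takes the place of the Euler product.\<close>

lemma nonzero_of_log_derivative:
  assumes "convex S" "open S" "D holomorphic_on S"
    and der: "\<And>\<xi>. \<xi> \<in> S \<Longrightarrow> (Z has_field_derivative -(D \<xi> * Z \<xi>)) (at \<xi>)"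
    and "z \<in> S" "Z z \<noteq> 0" "w \<in> S"
  shows "Z w \<noteq> 0"
proof -
  obtain h where h: "\<And>x. x \<in> S \<Longrightarrow> (h has_field_derivative D x) (at x within S)"
    using holomorphic_convex_primitive'[OF assms(1-3)] by blast
  have "((\<lambda>\<xi>. Z \<xi> * exp (h \<xi>)) has_field_derivative 0) (at x within S)" if "x \<in> S" for x
  proof -
    have "(h has_field_derivative D x) (at x)"
      using h[OF that] at_within_open[OF that assms(2)] by simp
    from DERIV_mult[OF der[OF that] DERIV_fun_exp[OF this]]
    have "((\<lambda>\<xi>. Z \<xi> * exp (h \<xi>)) has_field_derivative 0) (at x)" by (simp add: mult_ac)
    then show ?thesis by (rule has_field_derivative_at_within)
  qed
  from has_field_derivative_zero_constant[OF assms(1) this]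
  obtain c where "\<forall>x\<in>S. Z x * exp (h x) = c" ..
  then have "Z w * exp (h w) = Z z * exp (h z)" using assms by simp
  then show ?thesis using assms(6) by auto
qed

lemma zeta_reg_log_derivative:
  assumes "Re \<xi> > 1"
  shows zeta_reg_nonzero_Re_gt_1: "zeta_reg \<xi> \<noteq> 0"
    and "mangoldt_series (\<lambda>_. 1) \<xi> = 1 / (\<xi> - 1) - deriv zeta_reg \<xi> / zeta_reg \<xi>"
proof -
  let ?Z = "\<lambda>\<xi>. zeta_reg \<xi> / (\<xi> - 1)"
  have Z: "(?Z has_field_derivative -(mangoldt_series (\<lambda>_. 1) \<xi> * ?Z \<xi>)) (at \<xi>)" if "Re \<xi> > 1" for \<xi>
    by (rule mangoldt_series_times) (use that zeta_series in auto)
  \<comment> \<open>The positive series at 2 supplies the nonzero value from which non-vanishing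
    spreads.\<close>
  have "(\<lambda>n. Re (of_nat (Suc n) powr (-2) :: complex)) sums Re (?Z 2)"
    using zeta_series[of 2] by (intro sums_Re) auto
  moreover have "(of_nat (Suc n) powr (-2) :: complex) = of_real (real (Suc n) powr (-2))" for n
    using powr_of_real[of "real (Suc n)" "-2"] by simp
  ultimately have "(\<lambda>n. real (Suc n) powr (-2)) sums Re (?Z 2)"
    by (simp only: Re_complex_of_real)
  then have "0 < Re (?Z 2)"
    using suminf_pos[of "\<lambda>n. real (Suc n) powr (-2)"] by (simp add: sums_iff)
  then have Z2: "?Z 2 \<noteq> 0" by (metis less_irrefl zero_complex.simps(1))
  have "?Z \<xi> \<noteq> 0"
  proof (rule nonzero_of_log_derivative[where S = "{\<xi>. Re \<xi> > 1}" and Z = ?Z and z = 2])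
    show "(?Z has_field_derivative -(mangoldt_series (\<lambda>_. 1) \<xi> * ?Z \<xi>)) (at \<xi>)" if "\<xi> \<in> {\<xi>. Re \<xi> > 1}" for \<xi>
      using that by (intro Z) simp
  qed (use Z2 assms in \<open>simp_all add: open_Re_gt convex_halfspace_Re_gt mangoldt_series_holomorphic\<close>)
  then show nz: "zeta_reg \<xi> \<noteq> 0" by auto
  have s1: "\<xi> - 1 \<noteq> 0" using assms by auto
  have "(zeta_reg has_field_derivative deriv zeta_reg \<xi>) (at \<xi>)"
    using holomorphic_derivI[OF zeta_reg_holomorphic open_Re_gt] assms by simp
  then have "(?Z has_field_derivative (deriv zeta_reg \<xi> * (\<xi> - 1) - zeta_reg \<xi> * 1) / ((\<xi> - 1) * (\<xi> - 1))) (at \<xi>)"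
    using s1 by (auto intro!: derivative_eq_intros)
  then have "-(mangoldt_series (\<lambda>_. 1) \<xi> * ?Z \<xi>) = (deriv zeta_reg \<xi> * (\<xi> - 1) - zeta_reg \<xi> * 1) / ((\<xi> - 1) * (\<xi> - 1))"
    using Z[OF assms] DERIV_unique by blast
  then have "mangoldt_series (\<lambda>_. 1) \<xi> = -((deriv zeta_reg \<xi> * (\<xi> - 1) - zeta_reg \<xi> * 1) / ((\<xi> - 1) * (\<xi> - 1))) / ?Z \<xi>"
  proof -
    have "a = - c / b" if "- (a * b) = c" "b \<noteq> 0" for a b c :: complex
      using that by auto
    from this[OF _ \<open>?Z \<xi> \<noteq> 0\<close>] show ?thesis
      using \<open>-(mangoldt_series (\<lambda>_. 1) \<xi> * ?Z \<xi>) = _\<close> by blast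
  qed
  also have "\<dots> = 1 / (\<xi> - 1) - deriv zeta_reg \<xi> / zeta_reg \<xi>"
  proof -
    have "-((d * a - z * 1) / (a * a)) / (z / a) = 1 / a - d / z" if "a \<noteq> 0" "z \<noteq> 0" for a d z :: complex
      using that by (simp add: field_simps)
    from this[OF s1 nz] show ?thesis .
  qed
  finally show "mangoldt_series (\<lambda>_. 1) \<xi> = 1 / (\<xi> - 1) - deriv zeta_reg \<xi> / zeta_reg \<xi>" .
qed

lemma L_chi4_log_derivative:
  assumes "Re \<xi> > 1"
  shows L_chi4_nonzero_Re_gt_1: "L_chi4 \<xi> \<noteq> 0"
    and "mangoldt_series chi4 \<xi> = - (deriv L_chi4 \<xi> / L_chi4 \<xi>)"
proof -
  have L: "(L_chi4 has_field_derivative -(mangoldt_series chi4 \<xi> * L_chi4 \<xi>)) (at \<xi>)" if "Re \<xi> > 1" for \<xi>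
    by (rule mangoldt_series_times) (use that chi4_series chi4_mult abs_chi4_le in auto)
  have L2: "L_chi4 2 \<noteq> 0" using L_chi4_real_nonzero[of 2] by simp
  show nz: "L_chi4 \<xi> \<noteq> 0"
  proof (rule nonzero_of_log_derivative[where S = "{\<xi>. Re \<xi> > 1}" and Z = L_chi4 and z = 2])
    show "(L_chi4 has_field_derivative -(mangoldt_series chi4 \<xi> * L_chi4 \<xi>)) (at \<xi>)" if "\<xi> \<in> {\<xi>. Re \<xi> > 1}" for \<xi>
      using that by (intro L) simp
    show "mangoldt_series chi4 holomorphic_on {\<xi>. Re \<xi> > 1}"
      by (rule mangoldt_series_holomorphic) (rule abs_chi4_le)
  qed (use L2 assms in \<open>simp_all add: open_Re_gt convex_halfspace_Re_gt\<close>)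
  have "deriv L_chi4 \<xi> = -(mangoldt_series chi4 \<xi> * L_chi4 \<xi>)"
    using L[OF assms] by (rule DERIV_imp_deriv)
  then show "mangoldt_series chi4 \<xi> = - (deriv L_chi4 \<xi> / L_chi4 \<xi>)" using nz by simp
qed

section \<open>Orders of zeros and the 3-4-1 inequality\<close>

lemma tendsto_at_right_shift:
  fixes F :: "complex \<Rightarrow> complex"
  assumes "isCont F z"
  shows "((\<lambda>x::real. F (z + of_real x)) \<longlongrightarrow> F z) (at_right 0)"
proof (rule isCont_tendsto_compose[where g = F and l = z and f = "\<lambda>x::real. z + of_real x"])
  have "((\<lambda>x::real. z + of_real x) \<longlongrightarrow> z + of_real 0) (at_right 0)"
    by (intro tendsto_intros)
  then show "((\<lambda>x::real. z + of_real x) \<longlongrightarrow> z) (at_right 0)" by simp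
qed (rule assms)

text \<open>Near a zero \<open>h w = (w - z) ^ n * g w\<close> with \<open>g\<close> nonzero, and
  \<open>n / (w - z)\<close> dominates the logarithmic derivative. The approach is from the right
  because \<open>mangoldt_series\<close> is only controlled for \<open>Re \<xi> > 1\<close>.\<close>

lemma log_derivative_order:
  fixes h :: "complex \<Rightarrow> complex"
  assumes h: "h holomorphic_on S" "open S" "connected S" and z: "z \<in> S" "w \<in> S" "h w \<noteq> 0"
  obtains m :: nat where "h z = 0 \<longrightarrow> m > 0" "h z \<noteq> 0 \<longrightarrow> m = 0"
    "((\<lambda>x::real. of_real x * (deriv h (z + of_real x) / h (z + of_real x))) \<longlongrightarrow> of_nat m) (at_right 0)"
proof (cases "h z = 0")
  case False
  have "isCont h z" "isCont (deriv h) z"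
    using holomorphic_on_imp_differentiable_at[OF _ h(2) z(1)] h(1) holomorphic_deriv[OF h(1,2)]
      field_differentiable_imp_continuous_at by blast+
  then have "isCont (\<lambda>x. deriv h x / h x) z" using False by (intro continuous_intros)
  from tendsto_at_right_shift[OF this]
  have "((\<lambda>x::real. of_real x * (deriv h (z + of_real x) / h (z + of_real x))) \<longlongrightarrow> of_real 0 * (deriv h z / h z)) (at_right 0)"
    by (intro tendsto_mult tendsto_of_real) (auto intro!: tendsto_eq_intros)
  then show ?thesis using that[of 0] False by simp
next
  case True
  have "\<not> h constant_on S" using True z unfolding constant_on_def by metis
  then obtain g r n where g: "0 < n" "0 < r" "ball z r \<subseteq> S" "g holomorphic_on ball z r"
    "\<And>w. w \<in> ball z r \<Longrightarrow> h w = (w - z) ^ n * g w" "\<And>w. w \<in> ball z r \<Longrightarrow> g w \<noteq> 0"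
    using holomorphic_factor_zero_nonconstant[OF h z(1) True] by metis
  have eq: "of_real x * (deriv h (z + of_real x) / h (z + of_real x)) =
      of_nat n + of_real x * (deriv g (z + of_real x) / g (z + of_real x))" if x: "0 < x" "x < r" for x :: real
  proof -
    let ?w = "z + of_real x"
    have w: "?w \<in> ball z r" using x by (simp add: dist_norm)
    have "(g has_field_derivative deriv g ?w) (at ?w)"
      using holomorphic_derivI[OF g(4) open_ball w] .
    then have "((\<lambda>w. (w - z) ^ n * g w) has_field_derivative
        (of_nat n * (?w - z) ^ (n - 1) * g ?w + (?w - z) ^ n * deriv g ?w)) (at ?w)"
      by (auto intro!: derivative_eq_intros)
    then have "(h has_field_derivative
        (of_nat n * (?w - z) ^ (n - 1) * g ?w + (?w - z) ^ n * deriv g ?w)) (at ?w)"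
      by (rule has_field_derivative_transform_within_open[OF _ open_ball w]) (simp add: g(5))
    then have d: "deriv h ?w = of_nat n * of_real x ^ (n - 1) * g ?w + of_real x ^ n * deriv g ?w"
      by (simp add: DERIV_imp_deriv)
    have xn: "of_real x ^ n = of_real x * (of_real x ^ (n - 1) :: complex)"
      using g(1) by (cases n) auto
    have "h ?w = of_real x ^ n * g ?w" using g(5)[OF w] by simp
    then show ?thesis unfolding d xn using x g(6)[OF w] by (simp add: field_simps)
  qed
  have zb: "z \<in> ball z r" using g by simp
  have "isCont g z" "isCont (deriv g) z"
    using holomorphic_on_imp_differentiable_at[OF _ open_ball zb] g(4) holomorphic_deriv[OF g(4) open_ball]
      field_differentiable_imp_continuous_at by blast+
  then have "isCont (\<lambda>x. deriv g x / g x) z" using g(6)[OF zb] by (intro continuous_intros)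
  from tendsto_at_right_shift[OF this]
  have "((\<lambda>x::real. of_nat n + of_real x * (deriv g (z + of_real x) / g (z + of_real x))) \<longlongrightarrow>
      of_nat n + of_real 0 * (deriv g z / g z)) (at_right 0)"
    by (intro tendsto_add tendsto_const tendsto_mult tendsto_of_real) (auto intro!: tendsto_eq_intros)
  moreover have "\<forall>\<^sub>F x in at_right 0. x > 0 \<and> x < r"
    using g(2) by (auto simp: eventually_at_right_field)
  then have "\<forall>\<^sub>F x in at_right 0. of_nat n + of_real x * (deriv g (z + of_real x) / g (z + of_real x)) =
     of_real x * (deriv h (z + of_real x) / h (z + of_real x))"
  proof eventually_elim
    case (elim x)
    then show ?case using eq[of x] by simp
  qed
  ultimately have "((\<lambda>x::real. of_real x * (deriv h (z + of_real x) / h (z + of_real x))) \<longlongrightarrow>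
      of_nat n + of_real 0 * (deriv g z / g z)) (at_right 0)"
    by (rule Lim_transform_eventually)
  then show ?thesis using that[of n] g(1) True by simp
qed

text \<open>Termwise, \<open>3 + 4 * f n * cos \<theta> + cos (2 * \<theta>)\<close> is a doubled
  square when \<open>f n\<close> is 1 or -1, and at least 2 when \<open>f n = 0\<close>. Hence the
  third series may carry the constant 1 in place of the square of \<open>f\<close>, and one
  inequality serves zeta and L alike.\<close>

lemma mangoldt_three_four_one:
  fixes f :: "nat \<Rightarrow> real"
  assumes f: "\<And>n. f n \<in> {-1, 0, 1}" and x: "x > 1"
  shows "3 * Re (mangoldt_series (\<lambda>_. 1) (of_real x)) + 4 * Re (mangoldt_series f (of_real x + of_real t * \<i>))
     + Re (mangoldt_series (\<lambda>_. 1) (of_real x + of_real (2 * t) * \<i>)) \<ge> 0"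
proof -
  have S: "(\<lambda>n. mangoldt (Suc n) * h (Suc n) * real (Suc n) powr (-x) * cos (u * ln (real (Suc n)))) sums
      Re (mangoldt_series h (of_real x + of_real u * \<i>))" if "\<And>n. \<bar>h n\<bar> \<le> 1" for h u
  proof -
    let ?\<xi> = "of_real x + of_real u * \<i>"
    have "summable (\<lambda>n. of_real (mangoldt (Suc n) * h (Suc n)) * of_nat (Suc n) powr (-?\<xi>) :: complex)"
      using summable_norm_mangoldt_series[of h ?\<xi>] that x by (intro summable_norm_cancel[OF summable_norm_mangoldt_series]) auto
    then have "(\<lambda>n. Re (of_real (mangoldt (Suc n) * h (Suc n)) * of_nat (Suc n) powr (-?\<xi>) :: complex)) sums
       Re (mangoldt_series h ?\<xi>)"
      unfolding mangoldt_series_def by (intro sums_Re summable_sums)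
    moreover have "Re (of_real (mangoldt (Suc n) * h (Suc n)) * of_nat (Suc n) powr (-?\<xi>) :: complex) =
        mangoldt (Suc n) * h (Suc n) * real (Suc n) powr (-x) * cos (u * ln (real (Suc n)))" for n
    proof -
      have l: "Ln (of_nat (Suc n)) = of_real (ln (real (Suc n)))"
        using Ln_of_real[of "real (Suc n)"] by (simp del: of_nat_Suc)
      have "of_nat (Suc n) powr (-?\<xi>) = exp (-?\<xi> * of_real (ln (real (Suc n))))"
        unfolding powr_def l by (simp del: of_nat_Suc)
      then have "Re (of_nat (Suc n) powr (-?\<xi>)) = real (Suc n) powr (-x) * cos (u * ln (real (Suc n)))"
        by (simp add: Re_exp powr_def del: of_nat_Suc)
      then show ?thesis by (simp only: Re_complex_of_real times_complex.sel Im_complex_of_real mult_zero_left diff_zero mult.assoc)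
    qed
    ultimately show ?thesis by (simp only:)
  qed
  have f1: "\<bar>f n\<bar> \<le> 1" for n using f[of n] by auto
  have A: "(\<lambda>n. 3 * (mangoldt (Suc n) * 1 * real (Suc n) powr (-x) * cos (0 * ln (real (Suc n))))
         + 4 * (mangoldt (Suc n) * f (Suc n) * real (Suc n) powr (-x) * cos (t * ln (real (Suc n))))
         + (mangoldt (Suc n) * 1 * real (Suc n) powr (-x) * cos (2 * t * ln (real (Suc n))))) sums
      (3 * Re (mangoldt_series (\<lambda>_. 1) (of_real x + of_real 0 * \<i>)) + 4 * Re (mangoldt_series f (of_real x + of_real t * \<i>))
     + Re (mangoldt_series (\<lambda>_. 1) (of_real x + of_real (2 * t) * \<i>)))"
    using sums_add[OF sums_add[OF sums_mult[OF S[of "\<lambda>_. 1" 0]] sums_mult[OF S[of f t]]] S[of "\<lambda>_. 1" "2 * t"]] f1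
    by simp
  have B: "3 * (mangoldt (Suc n) * 1 * real (Suc n) powr (-x) * cos (0 * ln (real (Suc n))))
         + 4 * (mangoldt (Suc n) * f (Suc n) * real (Suc n) powr (-x) * cos (t * ln (real (Suc n))))
         + (mangoldt (Suc n) * 1 * real (Suc n) powr (-x) * cos (2 * t * ln (real (Suc n)))) \<ge> 0" for n
  proof -
    define \<theta> where "\<theta> = t * ln (real (Suc n))"
    have "3 + 4 * f (Suc n) * cos \<theta> + cos (2 * \<theta>) \<ge> 0"
    proof -
      have c: "cos (2 * \<theta>) = 2 * (cos \<theta>)\<^sup>2 - 1" by (rule cos_double_cos)
      consider "f (Suc n) = -1" | "f (Suc n) = 0" | "f (Suc n) = 1" using f[of "Suc n"] by auto
      then show ?thesis
      proof cases
        case 1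
        have "3 + 4 * f (Suc n) * cos \<theta> + cos (2 * \<theta>) = 2 * (1 - cos \<theta>)\<^sup>2"
          unfolding c 1 by (simp add: power2_eq_square algebra_simps)
        then show ?thesis by simp
      next
        case 2
        show ?thesis unfolding 2 using cos_ge_minus_one[of "2 * \<theta>"] by linarith
      next
        case 3
        have "3 + 4 * f (Suc n) * cos \<theta> + cos (2 * \<theta>) = 2 * (1 + cos \<theta>)\<^sup>2"
          unfolding c 3 by (simp add: power2_eq_square algebra_simps)
        then show ?thesis by simp
      qed
    qed
    then have "0 \<le> mangoldt (Suc n) * real (Suc n) powr (-x) * (3 + 4 * f (Suc n) * cos \<theta> + cos (2 * \<theta>))"
      by (intro mult_nonneg_nonneg mangoldt_nonneg) auto
    also have "\<dots> = 3 * (mangoldt (Suc n) * 1 * real (Suc n) powr (-x) * cos (0 * ln (real (Suc n))))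
         + 4 * (mangoldt (Suc n) * f (Suc n) * real (Suc n) powr (-x) * cos (t * ln (real (Suc n))))
         + (mangoldt (Suc n) * 1 * real (Suc n) powr (-x) * cos (2 * t * ln (real (Suc n))))"
      unfolding \<theta>_def by (simp add: algebra_simps del: of_nat_Suc)
    finally show ?thesis .
  qed
  have "0 \<le> 3 * Re (mangoldt_series (\<lambda>_. 1) (of_real x + of_real 0 * \<i>)) + 4 * Re (mangoldt_series f (of_real x + of_real t * \<i>))
     + Re (mangoldt_series (\<lambda>_. 1) (of_real x + of_real (2 * t) * \<i>))"
    by (rule sums_le[OF B sums_zero A])
  then show ?thesis by simp
qed

text \<open>The pole of zeta contributes the 1 at \<open>t = 0\<close>. The order \<open>m\<close>
  is a natural number because \<open>zeta_reg\<close> is holomorphic across the line.\<close>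

lemma mangoldt_series_one_limit:
  obtains m :: nat where
    "zeta_reg (1 + of_real t * \<i>) = 0 \<longrightarrow> m > 0" "t = 0 \<longrightarrow> m = 0"
    "((\<lambda>x::real. of_real x * mangoldt_series (\<lambda>_. 1) (1 + of_real t * \<i> + of_real x)) \<longlongrightarrow>
       (if t = 0 then 1 else 0) - of_nat m) (at_right 0)"
proof -
  let ?z = "1 + of_real t * \<i>"
  have "connected {\<xi>. Re \<xi> > 0}" by (intro convex_connected convex_halfspace_Re_gt)
  then obtain m :: nat where m: "zeta_reg ?z = 0 \<longrightarrow> m > 0" "zeta_reg ?z \<noteq> 0 \<longrightarrow> m = 0"
    "((\<lambda>x::real. of_real x * (deriv zeta_reg (?z + of_real x) / zeta_reg (?z + of_real x))) \<longlongrightarrow> of_nat m) (at_right 0)"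
    by (rule log_derivative_order[OF zeta_reg_holomorphic open_Re_gt, of ?z 1]) (auto simp: zeta_reg_1)
  have lim: "((\<lambda>x::real. of_real x / (of_real x + of_real t * \<i>)) \<longlongrightarrow> (if t = 0 then 1 else 0 :: complex)) (at_right 0)"
  proof (cases "t = 0")
    case True
    have "\<forall>\<^sub>F x::real in at_right 0. of_real x / (of_real x + of_real t * \<i>) = 1"
      using eventually_at_right_less[of 0] by eventually_elim (use True in auto)
    then show ?thesis unfolding if_P[OF True] by (rule tendsto_eventually)
  next
    case False
    then have "((\<lambda>x::real. of_real x / (of_real x + of_real t * \<i>)) \<longlongrightarrow> of_real 0 / (of_real 0 + of_real t * \<i>)) (at_right 0)"
      by (intro tendsto_intros) auto
    then show ?thesis using False by simp
  qed
  have "((\<lambda>x::real. of_real x / (of_real x + of_real t * \<i>) -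
      of_real x * (deriv zeta_reg (?z + of_real x) / zeta_reg (?z + of_real x))) \<longlongrightarrow>
      (if t = 0 then 1 else 0) - of_nat m) (at_right 0)"
    by (intro tendsto_diff lim m(3))
  moreover have "\<forall>\<^sub>F x::real in at_right 0. of_real x / (of_real x + of_real t * \<i>) -
      of_real x * (deriv zeta_reg (?z + of_real x) / zeta_reg (?z + of_real x)) =
      of_real x * mangoldt_series (\<lambda>_. 1) (?z + of_real x)"
    using eventually_at_right_less[of 0]
    by eventually_elim (subst zeta_reg_log_derivative, auto simp: algebra_simps)
  ultimately have lim': "((\<lambda>x::real. of_real x * mangoldt_series (\<lambda>_. 1) (?z + of_real x)) \<longlongrightarrow>
       (if t = 0 then 1 else 0) - of_nat m) (at_right 0)"
    by (rule Lim_transform_eventually)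
  have "t = 0 \<longrightarrow> m = 0" using m(2) by (simp add: zeta_reg_1)
  from that[OF m(1) this lim'] show ?thesis .
qed

lemma mangoldt_series_one_at_one:
  "((\<lambda>x::real. of_real x * mangoldt_series (\<lambda>_. 1) (1 + of_real x)) \<longlongrightarrow> 1) (at_right 0)"
proof -
  obtain m :: nat where m: "zeta_reg (1 + of_real 0 * \<i>) = 0 \<longrightarrow> m > 0" "(0::real) = 0 \<longrightarrow> m = 0"
    "((\<lambda>x::real. of_real x * mangoldt_series (\<lambda>_. 1) (1 + of_real 0 * \<i> + of_real x)) \<longlongrightarrow>
       (if (0::real) = 0 then 1 else 0) - of_nat m) (at_right 0)"
    by (rule mangoldt_series_one_limit[of 0])
  then show ?thesis by simp
qed

lemma mangoldt_series_one_off_one: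
  assumes "t \<noteq> 0"
  obtains m :: nat where "zeta_reg (1 + of_real t * \<i>) = 0 \<longrightarrow> m > 0"
    "((\<lambda>x::real. of_real x * mangoldt_series (\<lambda>_. 1) (1 + of_real t * \<i> + of_real x)) \<longlongrightarrow> - of_nat m) (at_right 0)"
proof -
  obtain m :: nat where m: "zeta_reg (1 + of_real t * \<i>) = 0 \<longrightarrow> m > 0" "t = 0 \<longrightarrow> m = 0"
    "((\<lambda>x::real. of_real x * mangoldt_series (\<lambda>_. 1) (1 + of_real t * \<i> + of_real x)) \<longlongrightarrow>
       (if t = 0 then 1 else 0) - of_nat m) (at_right 0)"
    by (rule mangoldt_series_one_limit[of t])
  from m(3) assms have "((\<lambda>x::real. of_real x * mangoldt_series (\<lambda>_. 1) (1 + of_real t * \<i> + of_real x)) \<longlongrightarrow> - of_nat m) (at_right 0)"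
    by simp
  from that[OF m(1) this] show ?thesis .
qed

text \<open>Multiplying the 3-4-1 inequality by \<open>x\<close> and letting \<open>x\<close> tend
  to 0 gives \<open>3 - 4 * m - m2 \<ge> 0\<close>. As \<open>t \<noteq> 0\<close>, the point
  \<open>1 + 2 * t * \<i>\<close> avoids the pole of zeta, so the third term cannot be
  positive.\<close>

lemma order_zero_of_three_four_one:
  fixes f :: "nat \<Rightarrow> real" and m :: nat
  assumes f: "\<And>n. f n \<in> {-1, 0, 1}" and t: "t \<noteq> 0"
    and lim: "((\<lambda>x::real. of_real x * mangoldt_series f (1 + of_real t * \<i> + of_real x)) \<longlongrightarrow> - of_nat m) (at_right 0)"
  shows "m = 0"
proof -
  have "2 * t \<noteq> 0" using t by simp
  then obtain m2 :: nat where m2: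
    "((\<lambda>x::real. of_real x * mangoldt_series (\<lambda>_. 1) (1 + of_real (2 * t) * \<i> + of_real x)) \<longlongrightarrow> - of_nat m2) (at_right 0)"
    by (rule mangoldt_series_one_off_one)
  have "((\<lambda>x::real. 3 * Re (of_real x * mangoldt_series (\<lambda>_. 1) (1 + of_real x)) +
      4 * Re (of_real x * mangoldt_series f (1 + of_real t * \<i> + of_real x)) +
      Re (of_real x * mangoldt_series (\<lambda>_. 1) (1 + of_real (2 * t) * \<i> + of_real x))) \<longlongrightarrow>
      3 * Re 1 + 4 * Re (- of_nat m) + Re (- of_nat m2)) (at_right 0)"
    by (intro tendsto_add tendsto_mult tendsto_const tendsto_Re mangoldt_series_one_at_one m2 lim)
  moreover have "\<forall>\<^sub>F x::real in at_right 0. 0 \<le> 3 * Re (of_real x * mangoldt_series (\<lambda>_. 1) (1 + of_real x)) +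
      4 * Re (of_real x * mangoldt_series f (1 + of_real t * \<i> + of_real x)) +
      Re (of_real x * mangoldt_series (\<lambda>_. 1) (1 + of_real (2 * t) * \<i> + of_real x))"
    using eventually_at_right_less[of 0]
  proof eventually_elim
    case (elim x)
    have "0 \<le> x * (3 * Re (mangoldt_series (\<lambda>_. 1) (of_real (1 + x))) + 4 * Re (mangoldt_series f (of_real (1 + x) + of_real t * \<i>))
     + Re (mangoldt_series (\<lambda>_. 1) (of_real (1 + x) + of_real (2 * t) * \<i>)))"
      using elim mangoldt_three_four_one[where f = f and x = "1 + x" and t = t] f by (intro mult_nonneg_nonneg) auto
    then show ?case by (simp add: algebra_simps)
  qed
  ultimately have "0 \<le> 3 * Re 1 + 4 * Re (- of_nat m) + Re (- of_nat m2)"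
    by (intro tendsto_lowerbound[where F = "at_right (0::real)"]) auto
  then have "4 * real m + real m2 \<le> 3" by simp
  then have "4 * m + m2 \<le> 3" by linarith
  then show "m = 0" by simp
qed

lemma Re_eq_1_decompose: "Re \<xi> = 1 \<Longrightarrow> \<xi> = 1 + of_real (Im \<xi>) * \<i>"
  by (simp add: complex_eq_iff)

lemma zeta_reg_nonzero:
  assumes "Re \<xi> \<ge> 1"
  shows "zeta_reg \<xi> \<noteq> 0"
proof (cases "Re \<xi> = 1")
  case True
  show ?thesis
  proof (cases "Im \<xi> = 0")
    case True
    with \<open>Re \<xi> = 1\<close> have "\<xi> = 1" by (simp add: complex_eq_iff)
    then show ?thesis by (simp add: zeta_reg_1)
  next
    case False
    obtain m :: nat where m: "zeta_reg (1 + of_real (Im \<xi>) * \<i>) = 0 \<longrightarrow> m > 0"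
      "((\<lambda>x::real. of_real x * mangoldt_series (\<lambda>_. 1) (1 + of_real (Im \<xi>) * \<i> + of_real x)) \<longlongrightarrow> - of_nat m) (at_right 0)"
      by (rule mangoldt_series_one_off_one[OF False])
    have "m = 0" by (rule order_zero_of_three_four_one[OF _ False m(2)]) auto
    then show ?thesis using m(1) Re_eq_1_decompose[OF True] by auto
  qed
qed (use assms zeta_reg_nonzero_Re_gt_1 in auto)

text \<open>At \<open>\<xi> = 1\<close> the third series of the 3-4-1 inequality would meet the pole
  of zeta, and \<open>3 - 4 * m + 1 \<ge> 0\<close> permits \<open>m = 1\<close>; that point is
  covered by positivity on the real axis.\<close>

lemma L_chi4_nonzero:
  assumes "Re \<xi> \<ge> 1"
  shows "L_chi4 \<xi> \<noteq> 0"
proof (cases "Re \<xi> = 1")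
  case True
  show ?thesis
  proof (cases "Im \<xi> = 0")
    case True
    with \<open>Re \<xi> = 1\<close> have "\<xi> = of_real 1" by (simp add: complex_eq_iff)
    then show ?thesis using L_chi4_real_nonzero[of 1] by simp
  next
    case False
    let ?z = "1 + of_real (Im \<xi>) * \<i>"
    have "connected {\<xi>. Re \<xi> > 0}" by (intro convex_connected convex_halfspace_Re_gt)
    moreover have "L_chi4 1 \<noteq> 0" using L_chi4_real_nonzero[of 1] by simp
    ultimately obtain m :: nat where m: "L_chi4 ?z = 0 \<longrightarrow> m > 0"
      "((\<lambda>x::real. of_real x * (deriv L_chi4 (?z + of_real x) / L_chi4 (?z + of_real x))) \<longlongrightarrow> of_nat m) (at_right 0)"
      using log_derivative_order[OF L_chi4_holomorphic open_Re_gt, of ?z 1] by auto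
    have "((\<lambda>x::real. - (of_real x * (deriv L_chi4 (?z + of_real x) / L_chi4 (?z + of_real x)))) \<longlongrightarrow> - of_nat m) (at_right 0)"
      by (intro tendsto_minus m)
    moreover have "\<forall>\<^sub>F x::real in at_right 0. - (of_real x * (deriv L_chi4 (?z + of_real x) / L_chi4 (?z + of_real x))) =
        of_real x * mangoldt_series chi4 (?z + of_real x)"
      using eventually_at_right_less[of 0]
      by eventually_elim (subst L_chi4_log_derivative, auto)
    ultimately have "((\<lambda>x::real. of_real x * mangoldt_series chi4 (?z + of_real x)) \<longlongrightarrow> - of_nat m) (at_right 0)"
      by (rule Lim_transform_eventually)
    then have "m = 0" by (rule order_zero_of_three_four_one[OF _ False, rotated]) (auto simp: chi4_def)
    then show ?thesis using m(1) Re_eq_1_decompose[OF True] by auto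
  qed
qed (use assms L_chi4_nonzero_Re_gt_1 in auto)

section \<open>Primes congruent to 3 modulo 4\<close>

text \<open>Legendre's formula. The upper limit \<open>N\<close> may exceed \<open>n\<close> so that
  \<open>fact m\<close> and \<open>fact (2 * m)\<close> can be expanded over the same range.\<close>

lemma ln_fact_eq_sum_mangoldt:
  assumes "n \<le> N"
  shows "ln (fact n) = (\<Sum>d\<in>{1..N}. mangoldt d * real (n div d))"
proof -
  have "ln (fact n :: real) = (\<Sum>k\<in>{1..n}. ln (real k))"
    by (simp only: fact_prod of_nat_prod, subst ln_prod) auto
  also have "\<dots> = (\<Sum>k\<in>{1..n}. \<Sum>d\<in>{d\<in>{1..N}. d dvd k}. mangoldt d)"
  proof (rule sum.cong[OF refl])
    fix k assume k: "k \<in> {1..n}"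
    have "1 \<le> d \<and> d \<le> N" if "d dvd k" for d
      using dvd_imp_le[OF that] dvd_pos_nat[OF _ that] k assms by auto
    then have "{d. d dvd k} = {d\<in>{1..N}. d dvd k}" by auto
    then show "ln (real k) = (\<Sum>d\<in>{d\<in>{1..N}. d dvd k}. mangoldt d)"
      using mangoldt_sum[of k, where ?'a = real] k by simp
  qed
  also have "\<dots> = (\<Sum>d\<in>{1..N}. \<Sum>k\<in>{k\<in>{1..n}. d dvd k}. mangoldt d)"
    by (rule sum.swap_restrict) auto
  also have "\<dots> = (\<Sum>d\<in>{1..N}. mangoldt d * real (n div d))"
  proof (rule sum.cong[OF refl])
    fix d :: nat assume d: "d \<in> {1..N}"
    have "bij_betw (\<lambda>i. d * i) {1..n div d} {k\<in>{1..n}. d dvd k}"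
      using d by (intro bij_betwI[of _ _ _ "\<lambda>k. k div d"]) (auto simp: less_eq_div_iff_mult_less_eq mult.commute div_le_mono Suc_le_eq elim!: dvdE)
    then have "card {k\<in>{1..n}. d dvd k} = n div d"
      by (metis bij_betw_same_card card_atLeastAtMost diff_Suc_1)
    then show "(\<Sum>k\<in>{k\<in>{1..n}. d dvd k}. mangoldt d) = mangoldt d * real (n div d)" by simp
  qed
  finally show ?thesis .
qed

definition psi :: "nat \<Rightarrow> real" where
  "psi n = (\<Sum>m\<in>{1..n}. mangoldt m)"

text \<open>Chebyshev's argument with the central binomial coefficient: the weight
  \<open>2 * m div d - 2 * (m div d)\<close> is never negative and equals 1 for
  \<open>m < d \<le> 2 * m\<close>.\<close>

lemma psi_double_le: "psi (2 * m) \<le> psi m + 2 * real m * ln 2"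
proof -
  have fact2: "ln (fact (2 * m) :: real) = ln (real ((2 * m) choose m)) + 2 * ln (fact m)"
  proof -
    have "(fact (2 * m) :: real) = fact m * fact m * real ((2 * m) choose m)"
      using binomial_fact_lemma[of m "2 * m"] by (metis (mono_tags) diff_add_inverse2 le_add2 mult_2 of_nat_fact of_nat_mult)
    then show ?thesis by (simp add: ln_mult)
  qed
  have "psi (2 * m) - psi m = (\<Sum>d\<in>{m<..2*m}. mangoldt d)"
  proof -
    have "{1..2*m} = {1..m} \<union> {m<..2*m}" by auto
    then have "psi (2 * m) = (\<Sum>d\<in>{1..m} \<union> {m<..2*m}. mangoldt d)" by (simp add: psi_def)
    also have "\<dots> = psi m + (\<Sum>d\<in>{m<..2*m}. mangoldt d)"
      unfolding psi_def by (intro sum.union_disjoint) auto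
    finally show ?thesis by simp
  qed
  also have "\<dots> \<le> (\<Sum>d\<in>{1..2*m}. mangoldt d * (real (2 * m div d) - 2 * real (m div d)))"
  proof -
    have "(\<Sum>d\<in>{m<..2*m}. mangoldt d) = (\<Sum>d\<in>{m<..2*m}. mangoldt d * (real (2 * m div d) - 2 * real (m div d)))"
    proof (rule sum.cong[OF refl])
      fix d assume d: "d \<in> {m<..2*m}"
      then have "2 * m div d = 1" by (intro div_nat_eqI) auto
      moreover have "m div d = 0" using d by simp
      ultimately show "mangoldt d = mangoldt d * (real (2 * m div d) - 2 * real (m div d))" by simp
    qed
    also have "\<dots> \<le> (\<Sum>d\<in>{1..2*m}. mangoldt d * (real (2 * m div d) - 2 * real (m div d)))"
    proof (rule sum_mono2)
      fix d
      have "2 * (m div d) \<le> 2 * m div d"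
        by (metis div_mult1_eq le_add1)
      then have "2 * real (m div d) \<le> real (2 * m div d)" by linarith
      then show "0 \<le> mangoldt d * (real (2 * m div d) - 2 * real (m div d))"
        by (intro mult_nonneg_nonneg mangoldt_nonneg) simp
    qed auto
    finally show ?thesis .
  qed
  also have "\<dots> = ln (fact (2 * m)) - 2 * ln (fact m)"
    unfolding ln_fact_eq_sum_mangoldt[of "2 * m" "2 * m", OF order_refl] ln_fact_eq_sum_mangoldt[of m "2 * m", OF le_add2[of m m, folded mult_2]]
    by (simp add: sum_subtractf right_diff_distrib sum_distrib_left mult_ac)
  also have "\<dots> = ln (real ((2 * m) choose m))" using fact2 by simp
  also have "\<dots> \<le> ln (2 ^ (2 * m))"
  proof -
    have "real ((2 * m) choose m) \<le> 2 ^ (2 * m)"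
      using binomial_le_pow2[of "2 * m" m] by (metis of_nat_le_iff of_nat_numeral of_nat_power)
    then show ?thesis by (simp add: zero_less_binomial_iff)
  qed
  also have "\<dots> = 2 * real m * ln 2" by (simp add: ln_realpow)
  finally show ?thesis by simp
qed

text \<open>Halving with \<open>psi_double_le\<close>; an odd \<open>n\<close> costs one further
  logarithm. This linear bound makes the coefficients in Newman's theorem bounded.\<close>

lemma psi_le: "psi n \<le> 4 * real n"
proof (induction n rule: less_induct)
  case (less n)
  show ?case
  proof (cases "n \<le> 1")
    case True
    then have "n = 0 \<or> n = 1" by auto
    then show ?thesis by (auto simp: psi_def)
  next
    case False
    define m where "m = n div 2"
    have m: "m < n" "m > 0" "n = 2 * m \<or> n = Suc (2 * m)" using False unfolding m_def by presburger+
    have ln2: "ln 2 \<le> (1::real)" using ln_le_minus_one[of 2] by simp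
    have "psi (2 * m) \<le> 4 * real m + 2 * real m * 1"
      using psi_double_le[of m] less.IH[OF m(1)] mult_left_mono[OF ln2, of "2 * real m"] by simp
    moreover have "psi (Suc (2 * m)) \<le> psi (2 * m) + 2 * real m"
      using mangoldt_le[of "Suc (2*m)"] ln_le_minus_one[of "real (Suc (2 * m))"] by (simp add: psi_def)
    ultimately show ?thesis using m(3) by auto
  qed
qed

text \<open>The weight \<open>(1 - chi4 n) / 2\<close> is 1 on 3 modulo 4 and 0 on 1 modulo 4.
  Powers of 2 above 1 keep weight 1/2, which is harmless for an upper bound on the sum over
  primes.\<close>

definition mangoldt_3mod4 :: "nat \<Rightarrow> real" where
  "mangoldt_3mod4 n = mangoldt n * (1 - chi4 n) / 2"

definition psi_3mod4 :: "nat \<Rightarrow> real" where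
  "psi_3mod4 n = (\<Sum>m\<in>{1..n}. mangoldt_3mod4 m)"

lemma mangoldt_3mod4_nonneg: "mangoldt_3mod4 n \<ge> 0"
  using abs_chi4_le[of n] mangoldt_nonneg[of n] by (auto simp: mangoldt_3mod4_def intro!: mult_nonneg_nonneg)

lemma psi_3mod4_nonneg: "psi_3mod4 n \<ge> 0"
  unfolding psi_3mod4_def by (intro sum_nonneg mangoldt_3mod4_nonneg)

lemma psi_3mod4_le: "psi_3mod4 n \<le> 4 * real n"
proof -
  have "psi_3mod4 n \<le> psi n"
    unfolding psi_3mod4_def psi_def
  proof (rule sum_mono)
    fix m
    have "mangoldt m * (1 - chi4 m) \<le> mangoldt m * 2"
      using abs_chi4_le[of m] by (intro mult_left_mono mangoldt_nonneg) auto
    then show "mangoldt_3mod4 m \<le> mangoldt m" by (simp add: mangoldt_3mod4_def)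
  qed
  then show ?thesis using psi_le[of n] by simp
qed

lemma psi_3mod4_mono: "m \<le> n \<Longrightarrow> psi_3mod4 m \<le> psi_3mod4 n"
  unfolding psi_3mod4_def by (intro sum_mono2) (auto simp: mangoldt_3mod4_nonneg)

section \<open>The Dirichlet series of \<open>psi_3mod4\<close>\<close>

lemma summation_by_parts_powr:
  fixes \<xi> :: complex
  shows
  "(\<Sum>n<N. of_real (mangoldt_3mod4 (Suc n)) * of_nat (Suc n) powr (-\<xi>)) =
    of_real (psi_3mod4 N) * of_nat (Suc N) powr (-\<xi>) +
    (\<Sum>n<N. of_real (psi_3mod4 (Suc n)) * (of_nat (Suc n) powr (-\<xi>) - of_nat (Suc (Suc n)) powr (-\<xi>)))"
proof (induction N)
  case 0
  then show ?case by (simp add: psi_3mod4_def)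
next
  case (Suc N)
  have "psi_3mod4 (Suc N) = psi_3mod4 N + mangoldt_3mod4 (Suc N)" by (simp add: psi_3mod4_def)
  then have eq: "of_real (mangoldt_3mod4 (Suc N)) = (of_real (psi_3mod4 (Suc N)) - of_real (psi_3mod4 N) :: complex)"
    by simp
  then show ?case unfolding sum.lessThan_Suc Suc.IH eq by (simp add: algebra_simps del: of_nat_Suc)
qed

lemma mangoldt_3mod4_series:
  assumes "Re \<xi> > 1"
  shows "(\<lambda>n. of_real (mangoldt_3mod4 (Suc n)) * of_nat (Suc n) powr (-\<xi>)) sums
    ((mangoldt_series (\<lambda>_. 1) \<xi> - mangoldt_series chi4 \<xi>) / 2)"
proof -
  have S: "(\<lambda>n. of_real (mangoldt (Suc n) * h (Suc n)) * of_nat (Suc n) powr (-\<xi>) :: complex) sums mangoldt_series h \<xi>"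
    if "\<And>n. \<bar>h n\<bar> \<le> 1" for h
    unfolding mangoldt_series_def
    by (intro summable_sums summable_norm_cancel[OF summable_norm_mangoldt_series]) (use that assms in auto)
  have one: "\<bar>(\<lambda>_. 1) n\<bar> \<le> (1::real)" for n :: nat by simp
  have "(\<lambda>n. (of_real (mangoldt (Suc n) * 1) * of_nat (Suc n) powr (-\<xi>) -
      of_real (mangoldt (Suc n) * chi4 (Suc n)) * of_nat (Suc n) powr (-\<xi>) :: complex) / 2) sums
    ((mangoldt_series (\<lambda>_. 1) \<xi> - mangoldt_series chi4 \<xi>) / 2)"
    by (intro sums_divide sums_diff S[OF abs_chi4_le] S[of "\<lambda>_. 1", OF one])
  also have "(\<lambda>n. (of_real (mangoldt (Suc n) * 1) * of_nat (Suc n) powr (-\<xi>) -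
      of_real (mangoldt (Suc n) * chi4 (Suc n)) * of_nat (Suc n) powr (-\<xi>) :: complex) / 2) =
      (\<lambda>n. of_real (mangoldt_3mod4 (Suc n)) * of_nat (Suc n) powr (-\<xi>))"
    by (simp add: mangoldt_3mod4_def fun_eq_iff algebra_simps diff_divide_distrib del: of_nat_Suc)
  finally show ?thesis .
qed

text \<open>The error made when \<open>n powr (-\<xi>) - (n + 1) powr (-\<xi>)\<close>, produced by
  summation by parts, is replaced by \<open>\<xi> * n powr (-\<xi> - 1)\<close>: the difference is
  exactly \<open>zeta_term n (\<xi> + 1)\<close>. Being holomorphic for \<open>Re \<xi> > 0\<close>,
  it adds no singularity on the line of real part 1.\<close>

definition psi_correction :: "complex \<Rightarrow> complex" where
  "psi_correction \<xi> = (\<Sum>n. of_real (psi_3mod4 (Suc n)) * zeta_term (Suc n) (\<xi> + 1))"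

lemma psi_correction_series:
  shows "Re \<xi> > 0 \<Longrightarrow> (\<lambda>n. of_real (psi_3mod4 (Suc n)) * zeta_term (Suc n) (\<xi> + 1)) sums psi_correction \<xi>"
    and psi_correction_holomorphic: "psi_correction holomorphic_on {\<xi>. Re \<xi> > 0}"
proof -
  define f where "f = (\<lambda>n \<xi>. of_real (psi_3mod4 (Suc n)) * zeta_term (Suc n) (\<xi> + 1))"
  define P where "P = (\<lambda>x::real. 4 * (max 0 x * (max 0 x + 1)))"
  have b: "norm (f n \<xi>) \<le> P (norm \<xi>) * real (Suc n) powr (-(Re \<xi> - 0) - 1)" if "Re \<xi> > 0" for n \<xi>
  proof -
    let ?N = "real (Suc n)"
    have "norm (f n \<xi>) \<le> (4 * ?N) * (norm (\<xi> + 1 - 1) * norm (\<xi> + 1) * ?N powr (-Re (\<xi> + 1) - 1))"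
      unfolding f_def norm_mult using that psi_3mod4_le[of "Suc n"] psi_3mod4_nonneg[of "Suc n"]
      by (intro mult_mono norm_zeta_term_le) auto
    also have "\<dots> \<le> (4 * ?N) * (norm \<xi> * (norm \<xi> + 1) * ?N powr (-Re (\<xi> + 1) - 1))"
      using norm_triangle_ineq[of \<xi> 1] by (intro mult_left_mono mult_right_mono) (auto intro: mult_left_mono)
    also have "\<dots> = P (norm \<xi>) * (?N powr 1 * ?N powr (-Re \<xi> - 2))"
    proof -
      have e: "-Re (\<xi> + 1) - 1 = -Re \<xi> - 2" "max 0 (norm \<xi>) = norm \<xi>" "?N powr 1 = ?N" by simp_all
      show ?thesis unfolding P_def e by (simp only: mult_ac)
    qed
    also have "?N powr 1 * ?N powr (-Re \<xi> - 2) = ?N powr (-(Re \<xi> - 0) - 1)"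
      by (subst powr_add[symmetric], rule arg_cong[where f = "\<lambda>x. ?N powr x"]) simp
    finally show ?thesis .
  qed
  have h: "f n holomorphic_on {\<xi>. Re \<xi> > 0}" for n
    unfolding f_def
    by (intro holomorphic_intros holomorphic_on_compose_gen[of "\<lambda>\<xi>. \<xi> + 1" _ "zeta_term (Suc n)" UNIV, unfolded o_def]
        zeta_term_holomorphic) auto
  have m: "mono P" unfolding P_def by (intro monoI mult_left_mono mult_mono) auto
  have nn: "P x \<ge> 0" for x unfolding P_def by auto
  note A = holomorphic_series_on_half_plane[where f = f and c = 0 and P = P, OF h b m nn]
  have eq: "psi_correction = (\<lambda>\<xi>. \<Sum>n. f n \<xi>)" by (simp add: psi_correction_def f_def fun_eq_iff)
  show "Re \<xi> > 0 \<Longrightarrow> (\<lambda>n. of_real (psi_3mod4 (Suc n)) * zeta_term (Suc n) (\<xi> + 1)) sums psi_correction \<xi>"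
    using A(1)[of \<xi>] unfolding eq by (simp add: f_def)
  show "psi_correction holomorphic_on {\<xi>. Re \<xi> > 0}"
    unfolding eq by (rule A(3))
qed

lemma psi_3mod4_series:
  assumes \<xi>: "Re \<xi> > 1"
  shows "(\<lambda>n. of_real (psi_3mod4 (Suc n)) * of_nat (Suc n) powr (-\<xi> - 1)) sums
    (((mangoldt_series (\<lambda>_. 1) \<xi> - mangoldt_series chi4 \<xi>) / 2 + psi_correction \<xi>) / \<xi>)"
proof -
  let ?D = "(mangoldt_series (\<lambda>_. 1) \<xi> - mangoldt_series chi4 \<xi>) / 2"
  have s0: "\<xi> \<noteq> 0" using \<xi> by auto
  have "(\<lambda>N. \<Sum>n<N. of_real (mangoldt_3mod4 (Suc n)) * of_nat (Suc n) powr (-\<xi>)) \<longlonglongrightarrow> ?D"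
    using mangoldt_3mod4_series[OF \<xi>] by (simp add: sums_def)
  moreover have "(\<lambda>N. of_real (psi_3mod4 N) * of_nat (Suc N) powr (-\<xi>) :: complex) \<longlonglongrightarrow> 0"
  proof (rule Lim_null_comparison)
    show "\<forall>\<^sub>F N in sequentially. norm (of_real (psi_3mod4 N) * of_nat (Suc N) powr (-\<xi>) :: complex) \<le> 4 * real (Suc N) powr (1 - Re \<xi>)"
    proof (intro always_eventually allI)
      fix N
      have "norm (of_real (psi_3mod4 N) * of_nat (Suc N) powr (-\<xi>) :: complex) = psi_3mod4 N * real (Suc N) powr (-Re \<xi>)"
        using psi_3mod4_nonneg[of N] by (simp add: norm_mult norm_of_nat_powr del: of_nat_Suc)
      also have "\<dots> \<le> (4 * real (Suc N)) * real (Suc N) powr (-Re \<xi>)"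
        using psi_3mod4_le[of N] by (intro mult_right_mono) auto
      also have "\<dots> = 4 * (real (Suc N) powr 1 * real (Suc N) powr (-Re \<xi>))" by (simp del: of_nat_Suc)
      also have "real (Suc N) powr 1 * real (Suc N) powr (-Re \<xi>) = real (Suc N) powr (1 - Re \<xi>)"
        by (subst powr_add[symmetric]) simp
      finally show "norm (of_real (psi_3mod4 N) * of_nat (Suc N) powr (-\<xi>) :: complex) \<le> 4 * real (Suc N) powr (1 - Re \<xi>)" .
    qed
    show "(\<lambda>N. 4 * real (Suc N) powr (1 - Re \<xi>)) \<longlonglongrightarrow> 0" using \<xi> by real_asymp
  qed
  ultimately have "(\<lambda>N. (\<Sum>n<N. of_real (mangoldt_3mod4 (Suc n)) * of_nat (Suc n) powr (-\<xi>)) -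
      of_real (psi_3mod4 N) * of_nat (Suc N) powr (-\<xi>)) \<longlonglongrightarrow> ?D - 0"
    by (rule tendsto_diff)
  then have "(\<lambda>n. of_real (psi_3mod4 (Suc n)) * (of_nat (Suc n) powr (-\<xi>) - of_nat (Suc (Suc n)) powr (-\<xi>))) sums ?D"
    unfolding summation_by_parts_powr sums_def by simp
  then have "(\<lambda>n. (of_real (psi_3mod4 (Suc n)) * (of_nat (Suc n) powr (-\<xi>) - of_nat (Suc (Suc n)) powr (-\<xi>)) +
      of_real (psi_3mod4 (Suc n)) * zeta_term (Suc n) (\<xi> + 1)) / \<xi>) sums ((?D + psi_correction \<xi>) / \<xi>)"
    using \<xi> by (intro sums_divide sums_add psi_correction_series) auto
  moreover have "(of_real (psi_3mod4 (Suc n)) * (of_nat (Suc n) powr (-\<xi>) - of_nat (Suc (Suc n)) powr (-\<xi>)) +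
      of_real (psi_3mod4 (Suc n)) * zeta_term (Suc n) (\<xi> + 1)) / \<xi> = of_real (psi_3mod4 (Suc n)) * of_nat (Suc n) powr (-\<xi> - 1)" for n
  proof -
    have e: "1 - (\<xi> + 1) = -\<xi>" "-(\<xi> + 1) = -\<xi> - 1" "\<xi> + 1 - 1 = \<xi>" by simp_all
    have "of_real (psi_3mod4 (Suc n)) * (of_nat (Suc n) powr (-\<xi>) - of_nat (Suc (Suc n)) powr (-\<xi>)) +
        of_real (psi_3mod4 (Suc n)) * zeta_term (Suc n) (\<xi> + 1) =
        \<xi> * (of_real (psi_3mod4 (Suc n)) * of_nat (Suc n) powr (-\<xi> - 1))"
      unfolding zeta_term_def e by (simp add: algebra_simps del: of_nat_Suc)
    then show ?thesis using s0 by simp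
  qed
  ultimately show ?thesis by simp
qed

text \<open>The poles of \<open>\<Sum> \<psi>(n) n\<^sup>-\<^sup>\<xi>\<^sup>-\<^sup>1\<close> and of \<open>\<zeta>(\<xi>)/2\<close> at \<open>\<xi> = 1\<close> cancel.\<close>

lemma psi_3mod4_normalized_series:
  obtains S G where "open S" "{z. Re z \<ge> 0} \<subseteq> S" "G holomorphic_on S"
    "\<And>z. Re z > 0 \<Longrightarrow> (\<lambda>n. of_real ((psi_3mod4 (Suc n) - real (Suc n) / 2) / real (Suc n)) *
        of_nat (Suc n) powr (-1 - z)) sums G z"
proof -
  let ?H = "{\<xi>. Re \<xi> > 0}"
  \<comment> \<open>The singular parts are \<open>1 / (2 * \<xi> * (\<xi> - 1))\<close>, from the
    logarithmic derivative of zeta, and \<open>zeta_reg \<xi> / (2 * (\<xi> - 1))\<close>, which is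
    subtracted. Their difference is \<open>- q \<xi> / (2 * \<xi>)\<close>.\<close>
  have "(\<lambda>\<xi>. \<xi> * zeta_reg \<xi> - 1) holomorphic_on ?H"
    by (intro holomorphic_intros zeta_reg_holomorphic)
  then obtain q where q: "q holomorphic_on ?H" "\<And>\<xi>. \<xi> * zeta_reg \<xi> - 1 = (\<xi> - 1) * q \<xi>"
    by (rule removable_quotient[OF _ open_Re_gt, where a = 1]) (auto simp: zeta_reg_1)
  define U where "U = {\<xi> \<in> ?H. zeta_reg \<xi> \<noteq> 0 \<and> L_chi4 \<xi> \<noteq> 0}"
  have "U = (?H \<inter> zeta_reg -` (- {0})) \<inter> (?H \<inter> L_chi4 -` (- {0}))"
    by (auto simp: U_def)
  moreover have "open (?H \<inter> zeta_reg -` (- {0}))" "open (?H \<inter> L_chi4 -` (- {0}))"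
    using zeta_reg_holomorphic L_chi4_holomorphic
    by (auto intro!: continuous_open_preimage holomorphic_on_imp_continuous_on open_Re_gt)
  ultimately have U: "open U" by auto
  have UH: "U \<subseteq> ?H" by (auto simp: U_def)
  define F where "F = (\<lambda>\<xi>. ((deriv L_chi4 \<xi> / L_chi4 \<xi> - deriv zeta_reg \<xi> / zeta_reg \<xi> - q \<xi>) / 2 + psi_correction \<xi>) / \<xi>)"
  have F: "F holomorphic_on U"
  proof -
    have "deriv zeta_reg holomorphic_on U" "deriv L_chi4 holomorphic_on U"
      using zeta_reg_holomorphic L_chi4_holomorphic UH by (auto intro!: holomorphic_on_subset[OF holomorphic_deriv] open_Re_gt)
    moreover have "zeta_reg holomorphic_on U" "L_chi4 holomorphic_on U" "q holomorphic_on U" "psi_correction holomorphic_on U"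
      using zeta_reg_holomorphic L_chi4_holomorphic q(1) psi_correction_holomorphic UH by (blast intro: holomorphic_on_subset)+
    ultimately show ?thesis unfolding F_def
      by (intro holomorphic_intros U) (auto simp: U_def)
  qed
  show ?thesis
  proof (rule that)
    show "open ((\<lambda>z. z + 1) -` U)"
      using U by (intro open_vimage continuous_intros)
    show "{z. Re z \<ge> 0} \<subseteq> (\<lambda>z. z + 1) -` U"
      by (auto simp: U_def intro!: zeta_reg_nonzero L_chi4_nonzero)
    show "(\<lambda>z. F (z + 1)) holomorphic_on (\<lambda>z. z + 1) -` U"
    proof -
      have "(\<lambda>z. z + 1) holomorphic_on (\<lambda>z. z + 1) -` U" by (intro holomorphic_intros)
      from holomorphic_on_compose_gen[OF this F] show ?thesis by (auto simp: o_def)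
    qed
    fix z :: complex assume z: "Re z > 0"
    define \<xi> where "\<xi> = z + 1"
    have \<xi>: "Re \<xi> > 1" using z by (simp add: \<xi>_def)
    have s1: "\<xi> - 1 \<noteq> 0" and s0: "\<xi> \<noteq> 0" using \<xi> by auto
    have "(\<lambda>n. of_real (psi_3mod4 (Suc n)) * of_nat (Suc n) powr (-\<xi> - 1) - of_nat (Suc n) powr (-\<xi>) / 2) sums
        (((mangoldt_series (\<lambda>_. 1) \<xi> - mangoldt_series chi4 \<xi>) / 2 + psi_correction \<xi>) / \<xi> - zeta_reg \<xi> / (\<xi> - 1) / 2)"
      by (intro sums_diff sums_divide psi_3mod4_series zeta_series \<xi>)
    also have "(\<lambda>n. of_real (psi_3mod4 (Suc n)) * of_nat (Suc n) powr (-\<xi> - 1) - of_nat (Suc n) powr (-\<xi>) / 2) =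
        (\<lambda>n. of_real ((psi_3mod4 (Suc n) - real (Suc n) / 2) / real (Suc n)) * of_nat (Suc n) powr (-1 - z))"
    proof
      fix n
      let ?N = "of_nat (Suc n) :: complex"
      have "?N powr (-\<xi> - 1) = ?N powr (-\<xi>) / ?N"
        by (simp add: powr_diff del: of_nat_Suc)
      moreover have "?N \<noteq> 0" by (simp del: of_nat_Suc)
      moreover have "of_real (real (Suc n)) = ?N" by simp
      moreover have "-1 - z = -\<xi>" by (simp add: \<xi>_def)
      ultimately show "of_real (psi_3mod4 (Suc n)) * of_nat (Suc n) powr (-\<xi> - 1) - of_nat (Suc n) powr (-\<xi>) / 2 =
          of_real ((psi_3mod4 (Suc n) - real (Suc n) / 2) / real (Suc n)) * of_nat (Suc n) powr (-1 - z)"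
        by (simp add: field_simps del: of_nat_Suc)
    qed
    also have "((mangoldt_series (\<lambda>_. 1) \<xi> - mangoldt_series chi4 \<xi>) / 2 + psi_correction \<xi>) / \<xi> - zeta_reg \<xi> / (\<xi> - 1) / 2 = F \<xi>"
    proof -
      define a where "a = deriv zeta_reg \<xi> / zeta_reg \<xi>"
      define b where "b = deriv L_chi4 \<xi> / L_chi4 \<xi>"
      have "mangoldt_series (\<lambda>_. 1) \<xi> = 1 / (\<xi> - 1) - a" "mangoldt_series chi4 \<xi> = -b"
        using zeta_reg_log_derivative(2)[OF \<xi>] L_chi4_log_derivative(2)[OF \<xi>] by (simp_all add: a_def b_def)
      moreover have "zeta_reg \<xi> = (1 + (\<xi> - 1) * q \<xi>) / \<xi>"
        using q(2)[of \<xi>] s0 by (simp add: field_simps)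
      moreover have "((1 / w - a - (-b)) / 2 + p) / u - (1 + w * v) / u / w / 2 = ((b - a - v) / 2 + p) / u"
        if "u \<noteq> 0" "w \<noteq> 0" for u v w p :: complex
        using that by (simp add: field_simps)
      ultimately show ?thesis
        using s0 s1 unfolding F_def a_def[symmetric] b_def[symmetric] by simp
    qed
    finally show "(\<lambda>n. of_real ((psi_3mod4 (Suc n) - real (Suc n) / 2) / real (Suc n)) * of_nat (Suc n) powr (-1 - z)) sums F (z + 1)"
      by (simp add: \<xi>_def)
  qed
qed

lemma psi_3mod4_normalized_convergent:
  "convergent (\<lambda>N. \<Sum>n\<in>{1..N}. (psi_3mod4 n - real n / 2) / (real n)\<^sup>2)"
proof -
  obtain S G where G: "open S" "{z. Re z \<ge> 0} \<subseteq> S" "G holomorphic_on S"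
    "\<And>z. Re z > 0 \<Longrightarrow> (\<lambda>n. of_real ((psi_3mod4 (Suc n) - real (Suc n) / 2) / real (Suc n)) *
        of_nat (Suc n) powr (-1 - z)) sums G z"
    using psi_3mod4_normalized_series by blast
  have "norm (of_real ((psi_3mod4 n - real n / 2) / real n) :: complex) \<le> 4" for n
    unfolding norm_of_real
    using psi_3mod4_le[of n] psi_3mod4_nonneg[of n] by (cases "n = 0") (auto simp: abs_le_iff field_simps)
  from newman_dirichlet[of "\<lambda>n. of_real ((psi_3mod4 n - real n / 2) / real n)", OF this G]
  have "(\<lambda>N. Re (\<Sum>n\<in>{1..N}. of_real ((psi_3mod4 n - real n / 2) / real n) / of_nat n)) \<longlonglongrightarrow> Re (G 0)"
    by (intro tendsto_Re)
  moreover have "Re (\<Sum>n\<in>{1..N}. of_real ((psi_3mod4 n - real n / 2) / real n) / of_nat n) =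
      (\<Sum>n\<in>{1..N}. (psi_3mod4 n - real n / 2) / (real n)\<^sup>2)" for N
  proof -
    have "of_real ((psi_3mod4 n - real n / 2) / real n) / of_nat n =
        (of_real ((psi_3mod4 n - real n / 2) / (real n)\<^sup>2) :: complex)" for n
      by (simp add: power2_eq_square)
    then show ?thesis by (simp only: Re_sum Re_complex_of_real)
  qed
  ultimately show ?thesis by (auto simp: convergent_def)
qed

text \<open>If \<open>\<psi>(N)\<close> exceeded \<open>(1/2 + \<epsilon>) N\<close>, then by monotonicity the block \<open>N < n \<le> (1 + \<epsilon>) N\<close> would contribute
  a fixed positive amount to the convergent series.\<close>

lemma psi_3mod4_asymp_le:
  assumes e: "0 < e"
  shows "\<forall>\<^sub>F N in sequentially. psi_3mod4 N \<le> (1 / 2 + e) * real N"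
proof -
  define P where "P = (\<lambda>N. \<Sum>n\<in>{1..N}. (psi_3mod4 n - real n / 2) / (real n)\<^sup>2)"
  \<comment> \<open>At least \<open>e * N / 2\<close> summands, each at least
    \<open>(e * N / 2) / ((1 + e) * N)\<^sup>2\<close>.\<close>
  define d where "d = e\<^sup>2 / (4 * (1 + e)\<^sup>2)"
  have d: "d > 0" using e by (simp add: d_def)
  have "Cauchy P" using psi_3mod4_normalized_convergent by (simp add: P_def convergent_Cauchy)
  then obtain M where M: "\<And>m n. m \<ge> M \<Longrightarrow> n \<ge> M \<Longrightarrow> dist (P m) (P n) < d"
    using d unfolding Cauchy_def by blast
  \<comment> \<open>Ensures that rounding \<open>e * N\<close> down loses at most half of
    it.\<close>
  have "\<forall>\<^sub>F N in sequentially. real N \<ge> 2 / e" by real_asymp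
  then show ?thesis using eventually_ge_at_top[of M]
  proof eventually_elim
    case (elim N)
    show ?case
    proof (rule ccontr)
      assume "\<not> psi_3mod4 N \<le> (1 / 2 + e) * real N"
      then have big: "psi_3mod4 N > (1 / 2 + e) * real N" by simp
      have N0: "real N > 0" using elim e by (smt (verit) divide_pos_pos)
      define k where "k = nat \<lfloor>e * real N\<rfloor>"
      have k: "real k \<le> e * real N" "real k \<ge> e * real N / 2"
      proof -
        have e2: "e * real N \<ge> 2" using elim(1) e by (simp add: field_simps)
        have "real k = of_int \<lfloor>e * real N\<rfloor>" using e2 by (simp add: k_def)
        then show "real k \<le> e * real N" "real k \<ge> e * real N / 2"
          using e2 by linarith+
      qed
      have lb: "(psi_3mod4 n - real n / 2) / (real n)\<^sup>2 \<ge> (e * real N / 2) / ((1 + e) * real N)\<^sup>2"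
        if n: "n \<in> {N<..N + k}" for n
      proof (rule frac_le)
        have n': "real n \<le> (1 + e) * real N" using n k(1) by (auto simp: algebra_simps)
        have "psi_3mod4 n \<ge> psi_3mod4 N" using n by (intro psi_3mod4_mono) auto
        then show "e * real N / 2 \<le> psi_3mod4 n - real n / 2" using big n' by (simp add: algebra_simps)
        then show "0 \<le> psi_3mod4 n - real n / 2" using e N0 by (smt (verit) divide_nonneg_nonneg mult_nonneg_nonneg)
        show "0 < (real n)\<^sup>2" using n by auto
        show "(real n)\<^sup>2 \<le> ((1 + e) * real N)\<^sup>2" using n' by (intro power_mono) auto
      qed
      have "P (N + k) - P N = (\<Sum>n\<in>{N<..N + k}. (psi_3mod4 n - real n / 2) / (real n)\<^sup>2)"
      proof -
        have "{1..N + k} = {1..N} \<union> {N<..N + k}" using N0 by auto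
        then have "P (N + k) = (\<Sum>n\<in>{1..N} \<union> {N<..N + k}. (psi_3mod4 n - real n / 2) / (real n)\<^sup>2)"
          by (simp add: P_def)
        also have "\<dots> = P N + (\<Sum>n\<in>{N<..N + k}. (psi_3mod4 n - real n / 2) / (real n)\<^sup>2)"
          unfolding P_def by (intro sum.union_disjoint) auto
        finally show ?thesis by simp
      qed
      also have "\<dots> \<ge> (\<Sum>n\<in>{N<..N + k}. (e * real N / 2) / ((1 + e) * real N)\<^sup>2)"
        by (rule sum_mono) (rule lb)
      also have "(\<Sum>n\<in>{N<..N + k}. (e * real N / 2) / ((1 + e) * real N)\<^sup>2) = real k * ((e * real N / 2) / ((1 + e) * real N)\<^sup>2)"
        by simp
      also have "\<dots> \<ge> (e * real N / 2) * ((e * real N / 2) / ((1 + e) * real N)\<^sup>2)"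
        using k(2) e by (intro mult_right_mono) auto
      also have "(e * real N / 2) * ((e * real N / 2) / ((1 + e) * real N)\<^sup>2) = d"
      proof -
        have "(e * real N / 2) * ((e * real N / 2) / (w * real N)\<^sup>2) = e\<^sup>2 / (4 * w\<^sup>2)" if "w \<noteq> 0" for w
          using N0 that by (simp add: power2_eq_square field_simps)
        then show ?thesis unfolding d_def using e by simp
      qed
      finally have "P (N + k) - P N \<ge> d" .
      moreover have "dist (P (N + k)) (P N) < d" using elim by (intro M) auto
      ultimately show False by (simp add: dist_real_def)
    qed
  qed
qed

lemma sum_ln_primes_3mod4_le:
  assumes "0 < e"
  shows "\<forall>\<^sub>F N in sequentially. (\<Sum>p | prime p \<and> p \<le> N \<and> p mod 4 = 3. ln (real p)) \<le> (1 / 2 + e) * real N"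
  using psi_3mod4_asymp_le[OF assms]
proof eventually_elim
  case (elim N)
  have "(\<Sum>p | prime p \<and> p \<le> N \<and> p mod 4 = 3. ln (real p)) = (\<Sum>p | prime p \<and> p \<le> N \<and> p mod 4 = 3. mangoldt_3mod4 p)"
    by (rule sum.cong) (auto simp: mangoldt_3mod4_def chi4_def)
  also have "\<dots> \<le> psi_3mod4 N"
    unfolding psi_3mod4_def
    by (intro sum_mono2) (auto simp: mangoldt_3mod4_nonneg intro: Suc_leI prime_gt_0_nat)
  finally show ?case using elim by simp
qed

section \<open>Obstructions to being a sum of two squares\<close>

text \<open>Otherwise raising \<open>a\<^sup>2 = - b\<^sup>2\<close> modulo \<open>p\<close> to the
  odd power \<open>(p - 1) div 2\<close> and applying Fermat's theorem to both sides would give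
  \<open>1 = -1\<close> modulo \<open>p\<close>.\<close>

lemma prime_3mod4_dvd_sum_two_squares:
  fixes a b :: int
  assumes p: "prime p" "p mod 4 = 3" and dvd: "int p dvd a\<^sup>2 + b\<^sup>2"
  shows "int p dvd a"
proof (rule ccontr)
  assume a: "\<not> int p dvd a"
  have pi: "prime (int p)" using p by simp
  have b: "\<not> int p dvd b"
  proof
    assume "int p dvd b"
    then have "int p dvd a\<^sup>2" using dvd by (simp add: power2_eq_square dvd_add_left_iff)
    then show False using a pi prime_dvd_power by blast
  qed
  define h where "h = (p - 1) div 2"
  have h: "2 * h = p - 1" "odd h" using p(2) unfolding h_def by presburger+
  have "[a\<^sup>2 = - (b\<^sup>2)] (mod int p)" using dvd by (simp add: cong_iff_dvd_diff)
  then have "[(a\<^sup>2) ^ h = (- (b\<^sup>2)) ^ h] (mod int p)" by (rule cong_pow)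
  also have "(a\<^sup>2) ^ h = a ^ (p - 1)" by (simp add: h flip: power_mult)
  also have "(- (b\<^sup>2)) ^ h = - (b ^ (p - 1))" using h by (simp flip: power_mult)
  finally have ab: "[a ^ (p - 1) = - (b ^ (p - 1))] (mod int p)" .
  have fl: "[x ^ (p - 1) = 1] (mod int p)" if "\<not> int p dvd x" for x
  proof -
    define y where "y = nat (x mod int p)"
    have y: "int y = x mod int p" using p(2) by (auto simp: y_def intro!: pos_mod_sign)
    then have "[x = int y] (mod int p)" by (simp add: cong_def)
    then have "[x ^ (p - 1) = int y ^ (p - 1)] (mod int p)" by (rule cong_pow)
    moreover have "\<not> p dvd y"
    proof
      assume "p dvd y"
      then have "int p dvd x mod int p" by (metis y int_dvd_int_iff)
      then show False using that by (simp add: dvd_mod_iff)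
    qed
    then have "[y ^ (p - 1) = 1] (mod p)" by (intro fermat_theorem p)
    then have "[int (y ^ (p - 1)) = int 1] (mod int p)" by (simp only: cong_int_iff)
    then have "[int y ^ (p - 1) = 1] (mod int p)" by simp
    ultimately show ?thesis by (rule cong_trans)
  qed
  have "[1 = - 1] (mod int p)"
    using ab fl[OF a] fl[OF b] by (metis cong_minus_minus_iff cong_sym cong_trans)
  then have "int p dvd 2" by (simp add: cong_iff_dvd_diff)
  then have "p dvd 2" by (metis int_dvd_int_iff of_nat_numeral)
  then have "p \<le> 2" by (rule dvd_imp_le) simp
  then show False using p(2) by (auto simp: le_Suc_eq numeral_2_eq_2)
qed

text \<open>Descent: \<open>p\<close> divides both roots, so \<open>p ^ 2\<close> can be divided
  out, leaving a smaller sum of two squares whose multiplicity at \<open>p\<close> has the same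
  parity.\<close>

lemma odd_multiplicity_not_sum_two_squares:
  assumes p: "prime p" "p mod 4 = 3" and m: "odd (multiplicity p n)"
  shows "n \<notin> sums_of_two_squares"
  using m
proof (induction n rule: less_induct)
  case (less n)
  show ?case
  proof
    assume "n \<in> sums_of_two_squares"
    then obtain a b :: int where ab: "n > 0" "int n = a\<^sup>2 + b\<^sup>2"
      unfolding sums_of_two_squares_def by auto
    have "p dvd n" using less.prems by (metis even_zero not_dvd_imp_multiplicity_0)
    then have "int p dvd a\<^sup>2 + b\<^sup>2" by (metis ab(2) int_dvd_int_iff)
    then have "int p dvd a" "int p dvd b"
      using prime_3mod4_dvd_sum_two_squares[OF p, of a b] prime_3mod4_dvd_sum_two_squares[OF p, of b a]
      by (simp_all add: add.commute)
    then obtain a' b' where ab': "a = int p * a'" "b = int p * b'" by (auto elim!: dvdE)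
    have "int n = int (p ^ 2) * (a'\<^sup>2 + b'\<^sup>2)"
      unfolding ab(2) ab' by (simp add: power_mult_distrib algebra_simps)
    moreover define n' where "n' = nat (a'\<^sup>2 + b'\<^sup>2)"
    ultimately have n: "n = p ^ 2 * n'" "int n' = a'\<^sup>2 + b'\<^sup>2"
      by (simp_all flip: of_nat_eq_iff[where 'a = int])
    have n'0: "n' > 0" using n ab(1) by (auto intro: Nat.gr0I)
    have p1: "p > 1" using p prime_gt_1_nat by auto
    have "n' < n" using n(1) n'0 one_less_power[OF p1, of 2] by simp
    moreover have "multiplicity p n = 2 + multiplicity p n'"
      using n(1) n'0 p by (simp add: prime_elem_multiplicity_mult_distrib prime_elem_multiplicity_power_distrib multiplicity_same_power)
    then have "odd (multiplicity p n')" using less.prems by simp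
    moreover have "n' \<in> sums_of_two_squares"
      unfolding sums_of_two_squares_def using n'0 n(2) by blast
    ultimately show False using less.IH by blast
  qed
qed

text \<open>Descent by 2: if \<open>2 * m = x\<^sup>2 + y\<^sup>2\<close>, then half the sum and
  half the difference of \<open>x\<close> and \<open>y\<close> represent \<open>m\<close>. The base
  case is reduction modulo 4.\<close>

lemma power2_times_3mod4_not_sum_two_squares:
  assumes "n mod 2 ^ (a + 2) = 3 * 2 ^ a"
  shows "n \<notin> sums_of_two_squares"
  using assms
proof (induction a arbitrary: n)
  case 0
  show ?case
  proof
    assume "n \<in> sums_of_two_squares"
    then obtain a b :: int where ab: "int n = a\<^sup>2 + b\<^sup>2"
      unfolding sums_of_two_squares_def by auto
    have sq: "x\<^sup>2 mod 4 = 0 \<or> x\<^sup>2 mod 4 = 1" for x :: int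
    proof -
      have "x mod 4 = 0 \<or> x mod 4 = 1 \<or> x mod 4 = 2 \<or> x mod 4 = 3" by presburger
      moreover have "x\<^sup>2 mod 4 = ((x mod 4)\<^sup>2) mod 4" by (simp add: power_mod)
      ultimately show ?thesis by auto
    qed
    have "int n mod 4 = int (n mod 4)" by (simp add: zmod_int)
    then have "int n mod 4 = 3" using 0 by simp
    moreover have "int n mod 4 = (a\<^sup>2 mod 4 + b\<^sup>2 mod 4) mod 4" unfolding ab by (simp add: mod_add_eq)
    ultimately show False using sq[of a] sq[of b] by auto
  qed
next
  case (Suc a)
  define m where "m = n div 2"
  have ev: "even n"
  proof -
    have "n mod 2 = (n mod 2 ^ (Suc a + 2)) mod 2" by (subst mod_mod_cancel) auto
    also have "\<dots> = 0" unfolding Suc.prems by simp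
    finally show ?thesis by presburger
  qed
  have n: "n = 2 * m" using ev by (simp add: m_def)
  have "2 * (m mod 2 ^ (a + 2)) = 2 * (3 * 2 ^ a)"
    using Suc.prems unfolding n by (simp add: mult_mod_right)
  then have IH: "m \<notin> sums_of_two_squares" by (intro Suc.IH) simp
  show ?case
  proof
    assume "n \<in> sums_of_two_squares"
    then obtain x y :: int where xy: "n > 0" "int n = x\<^sup>2 + y\<^sup>2"
      unfolding sums_of_two_squares_def by auto
    have "even (x\<^sup>2 + y\<^sup>2)" using ev xy(2) by (metis even_of_nat)
    then have "even (x + y)" "even (x - y)" by auto
    then obtain u v where uv: "x + y = 2 * u" "x - y = 2 * v" unfolding dvd_def by blast
    have xe: "x = u + v" and ye: "y = u - v" using uv by simp_all
    have "int n = 2 * (u\<^sup>2 + v\<^sup>2)" unfolding xy(2) xe ye by (simp add: power2_eq_square algebra_simps)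
    then have "int m = u\<^sup>2 + v\<^sup>2" unfolding n by simp
    moreover have "m > 0" using xy(1) n by simp
    ultimately show False using IH unfolding sums_of_two_squares_def by blast
  qed
qed

text \<open>An even power of an odd prime is 1 modulo 4, so dividing it out keeps the residue 3; a
  number without prime factors that are 3 modulo 4 could not have that residue.\<close>

lemma exists_odd_multiplicity_3mod4:
  fixes n :: nat
  assumes "n mod 4 = 3"
  shows "\<exists>q. prime q \<and> q mod 4 = 3 \<and> odd (multiplicity q n)"
  using assms
proof (induction n rule: less_induct)
  case (less n)
  have one: "m mod 4 = 1" if "odd m" "\<And>q. prime q \<Longrightarrow> q dvd m \<Longrightarrow> q mod 4 \<noteq> 3" for m :: nat
    using that
  proof (induction m rule: less_induct)
    case (less m)
    show ?case
    proof (cases "m = 1")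
      case False
      then obtain q where q: "prime q" "q dvd m" using prime_factor_nat by blast
      then obtain r where r: "m = q * r" by (auto elim: dvdE)
      have odds: "odd q" "odd r" using less.prems(1) r by auto
      have "r < m" using r q(1) prime_gt_1_nat[OF q(1)] odds(2) by (cases "r = 0") auto
      then have "r mod 4 = 1" using less.IH odds(2) less.prems(2) r by auto
      moreover have "q mod 4 = 1" using odds(1) less.prems(2)[OF q] by presburger
      ultimately have "(q * r) mod 4 = 1" by (metis mod_mult_eq mult_1 one_mod_numeral num.distinct(1) mod_mod_trivial mod_mult_left_eq)
      then show ?thesis using r by simp
    qed simp
  qed
  have "odd n" using less.prems by presburger
  then obtain q where q: "prime q" "q dvd n" "q mod 4 = 3" using one[of n] less.prems by auto
  show ?case
  proof (cases "odd (multiplicity q n)")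
    case False
    define e where "e = multiplicity q n"
    have n0: "n \<noteq> 0" using less.prems by auto
    obtain m where m: "n = q ^ e * m" "\<not> q dvd m"
      using multiplicity_decompose'[of n q] n0 q(1) unfolding e_def by (metis not_prime_unit)
    have e0: "e > 0" using q n0 unfolding e_def by (simp add: prime_multiplicity_gt_zero_iff)
    have "q ^ e mod 4 = 1"
    proof -
      from False obtain i where i: "e = 2 * i" unfolding e_def by (auto elim!: evenE)
      have "q ^ 2 mod 4 = ((q mod 4) ^ 2) mod 4" by (simp add: power_mod)
      then have "q ^ 2 mod 4 = 1" using q(3) by simp
      moreover have "(q ^ 2) ^ i mod 4 = ((q ^ 2 mod 4) ^ i) mod 4" by (simp only: power_mod)
      ultimately have "(q ^ 2) ^ i mod 4 = 1" by simp
      then show ?thesis by (simp add: i power_mult)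
    qed
    then have m3: "m mod 4 = 3" using less.prems unfolding m(1) by (metis mod_mult_left_eq mult_1)
    have "q ^ e > 1" using e0 prime_gt_1_nat[OF q(1)] one_less_power by blast
    then have "m < n" using m(1) m3 by (cases "m = 0") auto
    then obtain r where r: "prime r" "r mod 4 = 3" "odd (multiplicity r m)" using less.IH m3 by blast
    have "r dvd m" using r(3) by (metis even_zero not_dvd_imp_multiplicity_0)
    then have "r \<noteq> q" using m(2) by auto
    then have "multiplicity r (q ^ e) = 0"
      using r(1) q(1) by (metis not_dvd_imp_multiplicity_0 prime_dvd_power primes_dvd_imp_eq)
    then have "multiplicity r n = multiplicity r m"
      using m(1) n0 r(1) by (simp add: prime_elem_multiplicity_mult_distrib)
    then show ?thesis using r by auto
  qed (use q in auto)
qed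

section \<open>Counting residues modulo a power of two\<close>

text \<open>Says that the residue of \<open>J\<close> modulo \<open>2 ^ A\<close> already shows that the odd part of \<open>J\<close> is 3 modulo 4.\<close>

definition dyadic3 :: "nat \<Rightarrow> nat \<Rightarrow> bool" where
  "dyadic3 A J \<longleftrightarrow> (\<exists>a. a + 2 \<le> A \<and> J mod 2 ^ (a + 2) = 3 * 2 ^ a)"

lemma dyadic3_not_sum_two_squares: "dyadic3 A n \<Longrightarrow> n \<notin> sums_of_two_squares"
  using power2_times_3mod4_not_sum_two_squares unfolding dyadic3_def by blast

lemma dyadic3_cong:
  assumes "[m = n] (mod 2 ^ A)"
  shows "dyadic3 A m \<longleftrightarrow> dyadic3 A n"
proof -
  have "m mod 2 ^ (a + 2) = n mod 2 ^ (a + 2)" if "a + 2 \<le> A" for a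
    using assms cong_dvd_modulus_nat[of m n "2 ^ A" "2 ^ (a + 2)"] le_imp_power_dvd[OF that, of 2]
    by (auto simp: cong_def)
  then show ?thesis unfolding dyadic3_def by metis
qed

lemma dyadic3_times_2: "dyadic3 (Suc A) (2 * J) \<longleftrightarrow> dyadic3 A J"
proof
  assume "dyadic3 A J"
  then obtain a where "a + 2 \<le> A" "J mod 2 ^ (a + 2) = 3 * 2 ^ a" unfolding dyadic3_def by blast
  moreover have "(2 * J) mod (2 * 2 ^ (a + 2)) = 2 * (J mod 2 ^ (a + 2))" by (rule mult_mod_right[symmetric])
  ultimately show "dyadic3 (Suc A) (2 * J)" unfolding dyadic3_def
    by (intro exI[of _ "Suc a"]) simp
next
  assume "dyadic3 (Suc A) (2 * J)"
  then obtain a where a: "a + 2 \<le> Suc A" "(2 * J) mod 2 ^ (a + 2) = 3 * 2 ^ a" unfolding dyadic3_def by blast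
  then obtain b where b: "a = Suc b"
  proof (cases a)
    case 0
    then have "(2 * J) mod 4 = 3" using a(2) by simp
    moreover have "even ((2 * J) mod 4)" by (simp add: dvd_mod)
    ultimately have False by simp
    then show ?thesis ..
  qed auto
  have "2 * (J mod 2 ^ (b + 2)) = 2 * (3 * 2 ^ b)"
    using a(2) unfolding b by (simp add: mult_mod_right)
  then show "dyadic3 A J" unfolding dyadic3_def using a(1) b by (intro exI[of _ b]) simp
qed

lemma dyadic3_times_power2: "dyadic3 (A + t) (2 ^ t * J) \<longleftrightarrow> dyadic3 A J"
  by (induction t) (simp_all add: mult.assoc dyadic3_times_2)

lemma dyadic3_3mod4: "A \<ge> 2 \<Longrightarrow> J mod 4 = 3 \<Longrightarrow> dyadic3 A J"
  unfolding dyadic3_def by (intro exI[of _ 0]) simp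

lemma dyadic3_6mod8: "A \<ge> 3 \<Longrightarrow> J mod 8 = 6 \<Longrightarrow> dyadic3 A J"
  unfolding dyadic3_def by (intro exI[of _ 1]) simp

text \<open>Modulo \<open>2 ^ Suc A\<close> there are \<open>2 ^ (A - 1)\<close> residues that are 3
  modulo 4, and the even ones arise by doubling. The deficit 1 reflects the residues 0 and
  \<open>2 ^ (A - 1)\<close> modulo \<open>2 ^ A\<close>, which do not determine the odd part modulo
  4.\<close>

lemma card_dyadic3_ge: "card {J. J < 2 ^ A \<and> dyadic3 A J} + 1 \<ge> 2 ^ (A - 1)"
proof (induction A)
  case (Suc A)
  show ?case
  proof (cases "A = 0")
    case False
    let ?F = "{J. J < 2 ^ A \<and> dyadic3 A J}"
    let ?G = "{J. J < 2 ^ Suc A \<and> dyadic3 (Suc A) J}"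
    let ?O = "(\<lambda>b::nat. 4 * b + 3) ` {..<2 ^ (A - 1)}"
    have pw: "(2::nat) ^ Suc A = 4 * 2 ^ (A - 1)" "(2::nat) ^ A = 2 ^ (A - 1) + 2 ^ (A - 1)"
      using False by (cases A; simp)+
    have "?O \<subseteq> ?G"
      using False pw by (auto intro!: dyadic3_3mod4)
    moreover have "(\<lambda>J. 2 * J) ` ?F \<subseteq> ?G" by (auto simp: dyadic3_times_2)
    ultimately have "card (?O \<union> (\<lambda>J. 2 * J) ` ?F) \<le> card ?G" by (intro card_mono) auto
    moreover have "?O \<inter> (\<lambda>J. 2 * J) ` ?F = {}" by (auto; presburger)
    then have "card (?O \<union> (\<lambda>J. 2 * J) ` ?F) = card ?O + card ((\<lambda>J. 2 * J) ` ?F)"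
      by (intro card_Un_disjoint) auto
    moreover have "card ?O = 2 ^ (A - 1)" by (subst card_image) (auto intro: inj_onI)
    moreover have "card ((\<lambda>J. 2 * J) ` ?F) = card ?F" by (intro card_image inj_onI) simp
    ultimately show ?thesis using Suc.IH pw(2) by simp
  qed simp
qed simp

lemma card_dvd_dyadic3_ge:
  assumes "t \<le> A"
  shows "card {J. J < 2 ^ A \<and> 2 ^ t dvd J \<and> dyadic3 A J} + 1 \<ge> 2 ^ (A - t - 1)"
proof -
  obtain B where B: "A = B + t" using assms le_Suc_ex add.commute by metis
  have "(\<lambda>J. 2 ^ t * J) ` {J. J < 2 ^ B \<and> dyadic3 B J} \<subseteq> {J. J < 2 ^ A \<and> 2 ^ t dvd J \<and> dyadic3 A J}"
    unfolding B by (auto simp: dyadic3_times_power2 power_add)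
  then have "card ((\<lambda>J. 2 ^ t * J) ` {J. J < 2 ^ B \<and> dyadic3 B J}) \<le> card {J. J < 2 ^ A \<and> 2 ^ t dvd J \<and> dyadic3 A J}"
    by (intro card_mono) auto
  moreover have "card ((\<lambda>J. 2 ^ t * J) ` {J. J < 2 ^ B \<and> dyadic3 B J}) = card {J. J < 2 ^ B \<and> dyadic3 B J}"
    by (intro card_image inj_onI) simp
  ultimately show ?thesis using card_dyadic3_ge[of B] B by simp
qed

lemma card_shift_mod:
  fixes M :: nat
  assumes "M > 0"
  shows "card {c. c < M \<and> P ((j + c) mod M)} = card {J. J < M \<and> P J}"
proof -
  let ?f = "\<lambda>c. (j + c) mod M"
  have inj: "inj_on ?f {..<M}"
  proof (rule inj_onI)
    fix x y assume "x \<in> {..<M}" "y \<in> {..<M}" "?f x = ?f y"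
    then have "[j + x = j + y] (mod M)" by (simp add: cong_def)
    then have "[x = y] (mod M)" by (simp add: cong_add_lcancel_nat)
    then show "x = y" using \<open>x \<in> _\<close> \<open>y \<in> _\<close> by (simp add: cong_def)
  qed
  have "?f ` {..<M} = {..<M}"
    using inj assms by (intro endo_inj_surj) auto
  then have "{J. J < M \<and> P J} = ?f ` {c. c < M \<and> P (?f c)}" by auto
  moreover have "inj_on ?f {c. c < M \<and> P (?f c)}" using inj by (rule inj_on_subset) auto
  ultimately show ?thesis by (simp add: card_image)
qed

lemma card_shift_not_le:
  assumes "M > 0" "\<And>c. c < M \<Longrightarrow> P ((j + c) mod M) \<Longrightarrow> \<not> R c" "card {J. J < M \<and> P J} + 1 \<ge> b"
  shows "card {c. c < M \<and> R c} + b \<le> M + 1"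
proof -
  have "card {c. c < M \<and> R c} + card {c. c < M \<and> P ((j + c) mod M)} = card ({c. c < M \<and> R c} \<union> {c. c < M \<and> P ((j + c) mod M)})"
    using assms(2) by (intro card_Un_disjoint[symmetric]) auto
  also have "\<dots> \<le> card {..<M}" by (intro card_mono) auto
  finally show ?thesis using assms(1,3) card_shift_mod[of M P j] by simp
qed

lemma card_mod_8_eq:
  fixes r A :: nat
  assumes "r < 8" "A \<ge> 3"
  shows "card {J. J < 2 ^ A \<and> J mod 8 = r} = (2::nat) ^ (A - 3)"
proof -
  have pw: "(2::nat) ^ A = 8 * 2 ^ (A - 3)" using assms(2) power_add[of "2::nat" 3 "A - 3"] by simp
  have "{J. J < 2 ^ A \<and> J mod 8 = r} = (\<lambda>i. 8 * i + r) ` {..<2 ^ (A - 3)}"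
  proof (intro equalityI subsetI)
    fix J assume J: "J \<in> {J. J < 2 ^ A \<and> J mod 8 = r}"
    then have "J = 8 * (J div 8) + r" "J div 8 < 2 ^ (A - 3)" unfolding pw by (auto simp: less_mult_imp_div_less mult.commute)
    then show "J \<in> (\<lambda>i. 8 * i + r) ` {..<2 ^ (A - 3)}" by blast
  qed (use assms(1) in \<open>auto simp: pw\<close>)
  moreover have "inj_on (\<lambda>i. 8 * i + r) {..<2 ^ (A - 3)}" by (auto intro: inj_onI)
  ultimately show ?thesis by (simp add: card_image)
qed

text \<open>\<open>j + c\<close> stands for \<open>y + j\<close> modulo \<open>2 ^ A\<close>, where
  \<open>y\<close> will be \<open>c\<close>.\<close>

definition needed :: "nat \<Rightarrow> nat \<Rightarrow> nat \<Rightarrow> nat \<Rightarrow> bool" where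
  "needed A k c p \<longleftrightarrow> (\<exists>j\<in>{1..k}. p dvd 4 * j - 1 \<and> \<not> dyadic3 A (j + c))"

text \<open>With \<open>4 * j - 1 = p * m\<close> and \<open>p\<close> equal to 3 modulo 4,
  \<open>m\<close> is 1 modulo 4. Solving for \<open>j\<close> gives \<open>(p + 1) div 4\<close>,
  the solution for \<open>m = 1\<close>, plus \<open>m div 4\<close> steps of length
  \<open>p\<close>.\<close>

lemma needed_cofactor:
  assumes "p mod 4 = 3" "needed A k c p"
  obtains m where "m mod 4 = 1" "p * m < 4 * k" "\<not> dyadic3 A ((p + 1) div 4 + (m div 4) * p + c)"
proof -
  obtain j where "j \<in> {1..k}" "p dvd 4 * j - 1" "\<not> dyadic3 A (j + c)"
    using assms(2) unfolding needed_def by blast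
  moreover then obtain m where "4 * j - 1 = p * m" by (elim dvdE)
  ultimately have j: "j \<ge> 1" "j \<le> k" "4 * j - 1 = p * m" "\<not> dyadic3 A (j + c)" by simp_all
  obtain i where "j = Suc i" using j(1) by (cases j) auto
  then have "p * m = 4 * i + 3" using j(3) by simp
  moreover have "(4 * i + 3) mod 4 = 3" by presburger
  ultimately have "(p * m) mod 4 = 3" by simp
  moreover have "(p * m) mod 4 = (3 * (m mod 4)) mod 4" using assms(1) by (metis mod_mult_eq mod_mod_trivial)
  ultimately have "(3 * (m mod 4)) mod 4 = 3" by simp
  moreover have "m mod 4 = 0 \<or> m mod 4 = 1 \<or> m mod 4 = 2 \<or> m mod 4 = 3" by presburger
  ultimately have m: "m mod 4 = 1" by auto
  have pq: "p = 4 * (p div 4) + 3" using assms(1) mult_div_mod_eq[of 4 p] by simp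
  have mq: "m = 4 * (m div 4) + 1" using m mult_div_mod_eq[of 4 m] by simp
  have "4 * j = p * m + 1" using j(1,3) by simp
  also have "\<dots> = p * (4 * (m div 4) + 1) + 1" using mq by simp
  also have "\<dots> = 4 * (m div 4 * p) + (p + 1)" by (simp add: algebra_simps)
  also have "p + 1 = 4 * ((p + 1) div 4)"
  proof -
    have "p + 1 = 4 * (p div 4 + 1)" using pq by simp
    then show ?thesis by (metis nonzero_mult_div_cancel_left zero_neq_numeral)
  qed
  finally have "j = (p + 1) div 4 + m div 4 * p" by simp
  moreover have "p * m < 4 * k" using j by linarith
  ultimately show ?thesis using that[of m] m j(4) by simp
qed

text \<open>Everything follows from \<open>2 * p\<close> being 6 modulo 8, whether \<open>p\<close>
  is 3 or 7 modulo 8. The residues 3 modulo 4 and 6 modulo 8 are the simplest ones that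
  \<open>dyadic3\<close> accepts.\<close>

lemma mod_8_arith:
  fixes J p :: nat
  assumes "p mod 4 = 3"
  shows "4 dvd J \<Longrightarrow> (J + p) mod 4 = 3" "8 dvd J \<Longrightarrow> (J + 2 * p) mod 8 = 6"
    "J mod 8 = p mod 8 \<Longrightarrow> J mod 4 = 3" "J mod 8 = p mod 8 \<Longrightarrow> (J + p) mod 8 = 6"
proof -
  show "(J + p) mod 4 = 3" if "4 dvd J" using that assms by (metis mod_add_left_eq mod_eq_0_iff_dvd add_0 mod_mod_trivial)
  have p: "p = 4 * (p div 4) + 3" using assms mult_div_mod_eq[of 4 p] by simp
  have p8: "p mod 8 = 3 \<or> p mod 8 = 7"
  proof -
    have "p mod 8 < 8" by simp
    then have "p mod 8 \<in> {0,1,2,3,4,5,6,7}" by auto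
    moreover have "(p mod 8) mod 4 = 3" using assms by (simp add: mod_mod_cancel)
    ultimately show ?thesis by auto
  qed
  have "(2 * p) mod 8 = (2 * (p mod 8)) mod 8" by (simp add: mod_mult_right_eq)
  then have "(2 * p) mod 8 = 6" using p8 by auto
  then show "(J + 2 * p) mod 8 = 6" if "8 dvd J" using that by (metis mod_add_left_eq mod_eq_0_iff_dvd add_0 mod_mod_trivial)
  have c: "(J mod 8) mod 4 = J mod 4" by (simp add: mod_mod_cancel)
  show "J mod 4 = 3" if "J mod 8 = p mod 8" using p8 c that by auto
  have "(J + p) mod 8 = (J mod 8 + p mod 8) mod 8" by (simp add: mod_add_eq)
  then show "(J + p) mod 8 = 6" if "J mod 8 = p mod 8" using p8 that by auto
qed

lemma real_le_times_power2:
  assumes "n \<le> a * 2 ^ b + 1"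
  shows "real n \<le> real a * 2 ^ b + 1"
proof -
  have "real n \<le> real (a * 2 ^ b + 1)" using assms by (rule of_nat_mono)
  then show ?thesis by simp
qed

text \<open>Let \<open>J\<close> be \<open>(p + 1) div 4 + c\<close>. The prime is spared whenever
  \<open>J\<close>, \<open>J + p\<close>, ... all satisfy \<open>dyadic3\<close>, with one term for
  each cofactor 1, 5, 9, ... below \<open>4 * k / p\<close>. For one, two and three terms, sets of
  residues of \<open>J\<close> of density 1/2, 1/4 and 1/16 do this; the final 1 is the deficit in
  \<open>card_dyadic3_ge\<close>.\<close>

lemma card_needed_le:
  fixes p k A :: nat
  assumes p: "p mod 4 = 3" and A: "A \<ge> 4"
  shows "real (card {c. c < 2 ^ A \<and> needed A k c p}) \<le> 2 ^ A * (1 / 2 + (if 5 * p \<le> 4 * k then 1 / 4 else 0) +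
    (if 9 * p \<le> 4 * k then 3 / 16 else 0) + (if 13 * p \<le> 4 * k then 1 / 16 else 0)) + 1"
proof -
  let ?M = "2 ^ A :: nat"
  let ?j = "(p + 1) div 4"
  obtain B where B: "A = B + 4" using A le_Suc_ex add.commute by metis
  then have "A - 4 = B" "A - 3 = B + 1" "A - 1 = B + 3" by simp_all
  then have pw: "(2::real) ^ A = 16 * 2 ^ (A - 4)" "(2::nat) ^ A = 16 * 2 ^ (A - 4)" "(2::nat) ^ (A - 3) = 2 * 2 ^ (A - 4)"
      "(2::nat) ^ (A - 1) = 8 * 2 ^ (A - 4)" "(2::nat) ^ (A - 2 - 1) = 2 * 2 ^ (A - 4)"
    by (simp_all add: B power_add)
  have cofactor: "\<exists>i. 4 * i + 1 < r \<and> \<not> dyadic3 A (?j + i * p + c)" if nd: "needed A k c p" "r * p > 4 * k" for c r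
  proof -
    obtain m where m: "m mod 4 = 1" "p * m < 4 * k" "\<not> dyadic3 A (?j + (m div 4) * p + c)"
      by (rule needed_cofactor[OF p nd(1)])
    have "p * m < p * r" using m(2) nd(2) by (metis mult.commute less_trans)
    then have "m < r" by simp
    moreover have "m = 4 * (m div 4) + 1" using m(1) mult_div_mod_eq[of 4 m] by simp
    ultimately show ?thesis using m(3) by metis
  qed
  have dmod: "dyadic3 A ((x + c) mod ?M) \<longleftrightarrow> dyadic3 A (x + c)" "dyadic3 A ((x + c) mod ?M + y) \<longleftrightarrow> dyadic3 A (x + y + c)" for x y c
    by (intro dyadic3_cong, simp add: cong_def mod_simps add_ac)+
  consider "5 * p > 4 * k" | "5 * p \<le> 4 * k" "9 * p > 4 * k" | "9 * p \<le> 4 * k" "13 * p > 4 * k" | "13 * p \<le> 4 * k"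
    by linarith
  then show ?thesis
  proof cases
    case 1
    have "card {c. c < ?M \<and> needed A k c p} + 2 ^ (A - 1) \<le> ?M + 1"
    proof (rule card_shift_not_le[where j = ?j and P = "dyadic3 A"])
      show "2 ^ (A - 1) \<le> card {J. J < ?M \<and> dyadic3 A J} + 1" by (rule card_dyadic3_ge)
      show "\<not> needed A k c p" if "dyadic3 A ((?j + c) mod ?M)" for c
      proof
        assume "needed A k c p"
        then obtain i where i: "4 * i + 1 < 5" "\<not> dyadic3 A (?j + i * p + c)" using cofactor[of c 5] 1 by auto
        then have "i = 0" by simp
        then show False using i(2) that dmod by simp
      qed
    qed simp
    then have "card {c. c < ?M \<and> needed A k c p} \<le> 8 * 2 ^ (A - 4) + 1" unfolding pw by simp
    then have "real (card {c. c < ?M \<and> needed A k c p}) \<le> 8 * 2 ^ (A - 4) + 1" using real_le_times_power2[of _ "8"] by simp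
    then show ?thesis using 1 unfolding pw by simp
  next
    case 2
    \<comment> \<open>Two disjoint ways of density 1/8 each: if \<open>4 dvd J\<close>, then
      \<open>J + p\<close> is 3 modulo 4 and only \<open>J\<close> has to be tested; if
      \<open>J\<close> is \<open>p\<close> modulo 8, then \<open>J\<close> is 3 modulo 4 and
      \<open>J + p\<close> is 6 modulo 8.\<close>
    define P where "P = (\<lambda>J. (4 dvd J \<and> dyadic3 A J) \<or> J mod 8 = p mod 8)"
    have "card {c. c < ?M \<and> needed A k c p} + 4 * 2 ^ (A - 4) \<le> ?M + 1"
    proof (rule card_shift_not_le[where j = ?j and P = P])
      have "card {J. J < ?M \<and> P J} = card ({J. J < ?M \<and> 2 ^ 2 dvd J \<and> dyadic3 A J} \<union> {J. J < ?M \<and> J mod 8 = p mod 8})"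
        by (rule arg_cong[where f = card]) (auto simp: P_def)
      also have "\<dots> = card {J. J < ?M \<and> 2 ^ 2 dvd J \<and> dyadic3 A J} + card {J. J < ?M \<and> J mod 8 = p mod 8}"
      proof (rule card_Un_disjoint)
        have False if "4 dvd J" "J mod 8 = p mod 8" for J
          using that mod_8_arith(3)[OF p that(2)] by (simp add: dvd_eq_mod_eq_0)
        then show "{J. J < ?M \<and> 2 ^ 2 dvd J \<and> dyadic3 A J} \<inter> {J. J < ?M \<and> J mod 8 = p mod 8} = {}" by auto
      qed auto
      also have "\<dots> + 1 \<ge> 4 * 2 ^ (A - 4)"
        using card_dvd_dyadic3_ge[of 2 A] card_mod_8_eq[of "p mod 8" A] A unfolding pw(3,5) by simp
      finally show "4 * 2 ^ (A - 4) \<le> card {J. J < ?M \<and> P J} + 1" .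
      show "\<not> needed A k c p" if "P ((?j + c) mod ?M)" for c
      proof
        assume "needed A k c p"
        then obtain i where i: "4 * i + 1 < 9" "\<not> dyadic3 A (?j + i * p + c)" using cofactor[of c 9] 2 by auto
        define J where "J = (?j + c) mod ?M"
        have "dyadic3 A J \<and> dyadic3 A (J + p)"
          using that unfolding P_def J_def[symmetric]
        proof
          assume "4 dvd J \<and> dyadic3 A J"
          moreover then have "(J + p) mod 4 = 3" using mod_8_arith(1)[OF p] by blast
          ultimately show ?thesis using A by (auto intro: dyadic3_3mod4)
        next
          assume "J mod 8 = p mod 8"
          then have "J mod 4 = 3" "(J + p) mod 8 = 6" using mod_8_arith(3,4)[OF p] by blast+
          then show ?thesis using A by (auto intro: dyadic3_3mod4 dyadic3_6mod8)
        qed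
        then have "dyadic3 A (?j + c)" "dyadic3 A (?j + p + c)" unfolding J_def dmod by auto
        moreover have "i = 0 \<or> i = 1" using i(1) by auto
        ultimately show False using i(2) by auto
      qed
    qed simp
    then have "card {c. c < ?M \<and> needed A k c p} \<le> 12 * 2 ^ (A - 4) + 1" unfolding pw by simp
    then have "real (card {c. c < ?M \<and> needed A k c p}) \<le> 12 * 2 ^ (A - 4) + 1" using real_le_times_power2[of _ "12"] by simp
    then show ?thesis using 2 unfolding pw by simp
  next
    case 3
    \<comment> \<open>For multiples of 8 both \<open>J + p\<close> and \<open>J + 2 * p\<close> pass
      automatically, so half of them survive: density 1/16.\<close>
    define P where "P = (\<lambda>J. 2 ^ 3 dvd J \<and> dyadic3 A J)"
    have "card {c. c < ?M \<and> needed A k c p} + 2 ^ (A - 4) \<le> ?M + 1"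
    proof (rule card_shift_not_le[where j = ?j and P = P])
      show "2 ^ (A - 4) \<le> card {J. J < ?M \<and> P J} + 1"
        using card_dvd_dyadic3_ge[of 3 A] A unfolding P_def by simp
      show "\<not> needed A k c p" if "P ((?j + c) mod ?M)" for c
      proof
        assume "needed A k c p"
        then obtain i where i: "4 * i + 1 < 13" "\<not> dyadic3 A (?j + i * p + c)" using cofactor[of c 13] 3 by auto
        define J where "J = (?j + c) mod ?M"
        have J: "8 dvd J" "dyadic3 A J" using that unfolding P_def J_def by auto
        have "4 dvd J" using J(1) dvd_trans[of 4 8 J] by simp
        then have "(J + p) mod 4 = 3" "(J + 2 * p) mod 8 = 6" using J(1) mod_8_arith(1,2)[OF p] by blast+
        then have "dyadic3 A (J + p)" "dyadic3 A (J + 2 * p)"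
          using A by (auto intro: dyadic3_3mod4 dyadic3_6mod8)
        then have "dyadic3 A (?j + c)" "dyadic3 A (?j + p + c)" "dyadic3 A (?j + 2 * p + c)"
          using J(2) unfolding J_def dmod by auto
        moreover have "i = 0 \<or> i = 1 \<or> i = 2" using i(1) by auto
        ultimately show False using i(2) by auto
      qed
    qed simp
    then have "card {c. c < ?M \<and> needed A k c p} \<le> 15 * 2 ^ (A - 4) + 1" unfolding pw by simp
    then have "real (card {c. c < ?M \<and> needed A k c p}) \<le> 15 * 2 ^ (A - 4) + 1" using real_le_times_power2[of _ "15"] by simp
    then show ?thesis using 3 unfolding pw by simp
  next
    case 4
    have "card {c. c < ?M \<and> needed A k c p} \<le> card {..<?M}" by (intro card_mono) auto
    then have "real (card {c. c < ?M \<and> needed A k c p}) \<le> real ?M" by simp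
    then have le: "real (card {c. c < ?M \<and> needed A k c p}) \<le> 2 ^ A" by simp
    have "1 / 2 + (if 5 * p \<le> 4 * k then 1 / 4 else 0) + (if 9 * p \<le> 4 * k then 3 / 16 else 0) +
      (if 13 * p \<le> 4 * k then 1 / 16 else 0) = (1 :: real)"
      using 4 by simp
    then show ?thesis using le by (simp only: mult_1_right)
  qed
qed

section \<open>Construction of the gap\<close>

definition primes_3mod4 :: "nat \<Rightarrow> nat set" where
  "primes_3mod4 n = {p. prime p \<and> p \<le> n \<and> p mod 4 = 3}"

definition theta_3mod4 :: "nat \<Rightarrow> real" where
  "theta_3mod4 n = (\<Sum>p\<in>primes_3mod4 n. ln (real p))"

lemma finite_primes_3mod4 [simp]: "finite (primes_3mod4 n)"
  by (rule finite_subset[of _ "{..n}"]) (auto simp: primes_3mod4_def)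

lemma theta_3mod4_le: "e > 0 \<Longrightarrow> \<forall>\<^sub>F n in sequentially. theta_3mod4 n \<le> (1 / 2 + e) * real n"
  using sum_ln_primes_3mod4_le[of e] by (simp add: theta_3mod4_def primes_3mod4_def)

text \<open>Each prime above \<open>sqrt n\<close> contributes at least \<open>ln n / 2\<close> to
  \<open>theta_3mod4 n\<close>, which is at most \<open>n\<close>; the primes below are too few to
  matter.\<close>

lemma card_primes_3mod4_le:
  "\<forall>\<^sub>F n in sequentially. real (card (primes_3mod4 n)) \<le> 4 * real n / ln (real n)"
proof -
  have "\<forall>\<^sub>F n in sequentially. theta_3mod4 n \<le> (1 / 2 + 1 / 2) * real n"
    by (rule theta_3mod4_le) simp
  moreover have "\<forall>\<^sub>F n::nat in sequentially. sqrt (real n) + 1 \<le> 2 * real n / ln (real n)" by real_asymp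
  ultimately show ?thesis using eventually_ge_at_top[of 2]
  proof eventually_elim
    case (elim n)
    have ln0: "ln (real n) > 0" using elim(3) by simp
    define r where "r = nat \<lfloor>sqrt (real n)\<rfloor>"
    define B where "B = {p \<in> primes_3mod4 n. r < p}"
    have "primes_3mod4 n \<subseteq> {1..r} \<union> B"
      by (auto simp: B_def primes_3mod4_def Suc_le_eq prime_gt_0_nat)
    then have "card (primes_3mod4 n) \<le> card ({1..r} \<union> B)"
      by (intro card_mono) (auto simp: B_def)
    also have "\<dots> \<le> card {1..r} + card B" by (rule card_Un_le)
    finally have 1: "real (card (primes_3mod4 n)) \<le> real r + real (card B)" by simp
    have r: "real r \<le> sqrt (real n)" by (simp add: r_def of_nat_floor)
    have "real (card B) * (ln (real n) / 2) = (\<Sum>p\<in>B. ln (real n) / 2)" by simp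
    also have "\<dots> \<le> (\<Sum>p\<in>B. ln (real p))"
    proof (rule sum_mono)
      fix p assume "p \<in> B"
      then have "r < p" by (simp add: B_def)
      then have "sqrt (real n) \<le> real p" unfolding r_def by linarith
      then have "ln (sqrt (real n)) \<le> ln (real p)" using elim(3) \<open>r < p\<close> by (subst ln_le_cancel_iff) auto
      then show "ln (real n) / 2 \<le> ln (real p)" using elim(3) by (simp add: ln_sqrt)
    qed
    also have "\<dots> \<le> theta_3mod4 n"
      unfolding theta_3mod4_def
      by (rule sum_mono2) (auto simp: B_def primes_3mod4_def Suc_le_eq prime_gt_0_nat)
    also have "\<dots> \<le> real n" using elim(1) by simp
    finally have "real (card B) \<le> 2 * real n / ln (real n)" using ln0 by (simp add: field_simps)
    then show ?case using 1 r elim(2) by simp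
  qed
qed

text \<open>Averaging over the shift \<open>c\<close> replaces the distribution of primes modulo powers of 2: only their distribution
  modulo 4 enters.\<close>

lemma exists_good_shift:
  assumes A: "A \<ge> 4"
  obtains c where "(\<Sum>p | p \<in> primes_3mod4 (4 * k) \<and> needed A k c p. ln (real p)) \<le>
    (1 / 2 + 1 / 2 ^ A) * theta_3mod4 (4 * k) + 1 / 4 * theta_3mod4 (4 * k div 5) +
    3 / 16 * theta_3mod4 (4 * k div 9) + 1 / 16 * theta_3mod4 (4 * k div 13)"
proof -
  let ?P = "primes_3mod4 (4 * k)"
  define S where "S = (\<lambda>c. \<Sum>p | p \<in> ?P \<and> needed A k c p. ln (real p))"
  define T where "T = (1 / 2 + 1 / 2 ^ A) * theta_3mod4 (4 * k) + 1 / 4 * theta_3mod4 (4 * k div 5) +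
    3 / 16 * theta_3mod4 (4 * k div 9) + 1 / 16 * theta_3mod4 (4 * k div 13)"
  have restrict: "(\<Sum>p\<in>?P. if b * p \<le> 4 * k then ln (real p) else 0) = theta_3mod4 (4 * k div b)" if "b > 0" for b
  proof -
    have "(\<Sum>p\<in>?P. if b * p \<le> 4 * k then ln (real p) else 0) = (\<Sum>p\<in>{p \<in> ?P. b * p \<le> 4 * k}. ln (real p))"
      by (rule sum.inter_filter[symmetric]) simp
    moreover have "{p \<in> ?P. b * p \<le> 4 * k} = primes_3mod4 (4 * k div b)"
    proof -
      have "p \<le> 4 * k" if "b * p \<le> 4 * k" for p
      proof -
        have "1 * p \<le> b * p" using \<open>b > 0\<close> by (intro mult_le_mono1) simp
        then show ?thesis using that by linarith
      qed
      then show ?thesis using that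
        by (auto simp: primes_3mod4_def less_eq_div_iff_mult_less_eq mult.commute)
    qed
    ultimately show ?thesis by (simp add: theta_3mod4_def)
  qed
  have "(\<Sum>c<2 ^ A. S c) = (\<Sum>c<2 ^ A. \<Sum>p\<in>?P. if needed A k c p then ln (real p) else 0)"
    unfolding S_def by (intro sum.cong[OF refl] sum.inter_filter) simp
  also have "\<dots> = (\<Sum>p\<in>?P. \<Sum>c<2 ^ A. if needed A k c p then ln (real p) else 0)"
    by (rule sum.swap)
  also have "\<dots> = (\<Sum>p\<in>?P. real (card {c. c < 2 ^ A \<and> needed A k c p}) * ln (real p))"
  proof (rule sum.cong[OF refl])
    fix p
    have "(\<Sum>c<2 ^ A. if needed A k c p then ln (real p) else 0) = (\<Sum>c\<in>{c \<in> {..<2 ^ A}. needed A k c p}. ln (real p))"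
      by (rule sum.inter_filter[symmetric]) simp
    then show "(\<Sum>c<2 ^ A. if needed A k c p then ln (real p) else 0) = real (card {c. c < 2 ^ A \<and> needed A k c p}) * ln (real p)"
      by simp
  qed
  \<comment> \<open>The additive 1 of \<open>card_needed_le\<close> turns into the coefficient
    \<open>1 / 2 ^ A\<close>, made small later by the choice of \<open>A\<close>.\<close>
  also have "\<dots> \<le> (\<Sum>p\<in>?P. 2 ^ A * ((1 / 2 + 1 / 2 ^ A) * ln (real p) +
      1 / 4 * (if 5 * p \<le> 4 * k then ln (real p) else 0) +
      3 / 16 * (if 9 * p \<le> 4 * k then ln (real p) else 0) + 1 / 16 * (if 13 * p \<le> 4 * k then ln (real p) else 0)))"
  proof (rule sum_mono)
    fix p assume p: "p \<in> ?P"
    then have p4: "p mod 4 = 3" and l: "ln (real p) \<ge> 0" by (auto simp: primes_3mod4_def Suc_le_eq prime_gt_0_nat)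
    have "real (card {c. c < 2 ^ A \<and> needed A k c p}) * ln (real p) \<le>
      (2 ^ A * (1 / 2 + (if 5 * p \<le> 4 * k then 1 / 4 else 0) +
      (if 9 * p \<le> 4 * k then 3 / 16 else 0) + (if 13 * p \<le> 4 * k then 1 / 16 else 0)) + 1) * ln (real p)"
      by (rule mult_right_mono[OF card_needed_le[OF p4 A] l])
    also have "\<dots> = 2 ^ A * ((1 / 2 + 1 / 2 ^ A) * ln (real p) +
      1 / 4 * (if 5 * p \<le> 4 * k then ln (real p) else 0) +
      3 / 16 * (if 9 * p \<le> 4 * k then ln (real p) else 0) + 1 / 16 * (if 13 * p \<le> 4 * k then ln (real p) else 0))"
      by (cases "5 * p \<le> 4 * k"; cases "9 * p \<le> 4 * k"; cases "13 * p \<le> 4 * k") (simp_all add: field_simps)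
    finally show "real (card {c. c < 2 ^ A \<and> needed A k c p}) * ln (real p) \<le> 2 ^ A * ((1 / 2 + 1 / 2 ^ A) * ln (real p) +
      1 / 4 * (if 5 * p \<le> 4 * k then ln (real p) else 0) +
      3 / 16 * (if 9 * p \<le> 4 * k then ln (real p) else 0) + 1 / 16 * (if 13 * p \<le> 4 * k then ln (real p) else 0))" .
  qed
  also have "\<dots> = 2 ^ A * T"
    unfolding sum_distrib_left[symmetric] sum.distrib restrict[OF zero_less_numeral] T_def theta_3mod4_def[of "4 * k"] ..
  finally have sum_le: "(\<Sum>c<2 ^ A. S c) \<le> 2 ^ A * T" .
  have "\<exists>c. S c \<le> T"
  proof (rule ccontr)
    assume "\<nexists>c. S c \<le> T"
    then have "(\<Sum>c<(2::nat) ^ A. T) < (\<Sum>c<2 ^ A. S c)"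
      by (intro sum_strict_mono) (auto simp: not_le lessThan_empty_iff)
    then show False using sum_le by simp
  qed
  then show ?thesis using that unfolding S_def T_def by blast
qed

section \<open>Avoiding squares of large primes\<close>

lemma card_cong_class_le:
  fixes X :: "nat set"
  assumes "X \<subseteq> {..<n}" "p > 0" "\<And>x y. x \<in> X \<Longrightarrow> y \<in> X \<Longrightarrow> [x = y] (mod p)"
  shows "card X \<le> n div p + 1"
proof -
  have "inj_on (\<lambda>x. x div p) X"
  proof (rule inj_onI)
    fix x y assume "x \<in> X" "y \<in> X" "x div p = y div p"
    then show "x = y" using assms(3)[of x y] unfolding cong_def by (metis mult_div_mod_eq)
  qed
  moreover have "x div p \<le> n div p" if "x \<in> X" for x
    using assms(1) that by (intro div_le_mono less_imp_le) auto
  then have "(\<lambda>x. x div p) ` X \<subseteq> {..n div p}" by auto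
  ultimately have "card X \<le> card {..n div p}" by (intro card_inj_on_le) auto
  then show ?thesis by simp
qed

lemma coprime_four: "odd n \<Longrightarrow> coprime n (4::nat)"
proof -
  assume "odd n"
  then have "coprime n 2" by (simp add: coprime_right_2_iff_odd)
  then have "coprime n (2 * 2)" by (simp only: coprime_mult_right_iff simp_thms)
  then show ?thesis by simp
qed

text \<open>Union bound over the translates \<open>t < T\<close>. In the assumed sum the first
  factor bounds the number of \<open>j\<close> with \<open>p dvd 4 * j - 1\<close>, the second the
  number of \<open>t\<close> for which \<open>p ^ 2\<close> divides \<open>y + j\<close>: as
  \<open>p\<close> divides the modulus exactly once, these \<open>t\<close> lie in a single class
  modulo \<open>p\<close>. Hence some \<open>t\<close> is bad for no \<open>p\<close> in
  \<open>N\<close>.\<close>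

lemma exists_gap:
  fixes A k c z T :: nat and e :: "nat \<Rightarrow> nat"
  defines "N \<equiv> {p \<in> primes_3mod4 (4 * k). needed A k c p \<and> z < p}"
  defines "Q \<equiv> (\<Prod>p\<in>primes_3mod4 z. p ^ e p) * \<Prod>N"
  assumes k: "k \<ge> 1"
    and e: "\<And>p. p \<in> primes_3mod4 z \<Longrightarrow> 4 * k < p ^ e p"
    and T: "(\<Sum>p\<in>N. ((k + 1) div p + 1) * (T div p + 1)) < T"
  obtains y where "y \<ge> 1" "y \<le> (T + 2) * (2 ^ A * Q)" "\<And>j. j \<in> {1..k} \<Longrightarrow> y + j \<notin> sums_of_two_squares"
proof -
  define M where "M = 2 ^ A * Q"
  have odd_prime: "odd p" if "p mod 4 = 3" for p :: nat using that by presburger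
  have oddQ: "odd Q"
    unfolding Q_def N_def
    by (auto simp: primes_3mod4_def prime_gt_0_nat even_prod_iff odd_prime)
  have finN: "finite N" by (simp add: N_def)
  have N: "prime p" "p mod 4 = 3" "p > 0" if "p \<in> N" for p
    using that by (auto simp: N_def primes_3mod4_def prime_gt_0_nat)
  have Q0: "Q > 0" using oddQ by (cases Q) auto
  have M0: "M > 0" using Q0 by (simp add: M_def)
  \<comment> \<open>An inverse of -4 modulo \<open>Q\<close>; since \<open>Q\<close> is odd,
    \<open>Q\<^sup>2\<close> is 1 modulo 4 and \<open>(Q\<^sup>2 - 1) / 4\<close> serves.\<close>
  obtain u where u: "Q dvd 4 * u + 1"
  proof
    have "Q\<^sup>2 mod 4 = 1"
    proof -
      obtain i where "Q = 2 * i + 1" using oddQ by (elim oddE)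
      then have "Q\<^sup>2 = 4 * (i\<^sup>2 + i) + 1" by (simp add: power2_eq_square algebra_simps)
      then show ?thesis by presburger
    qed
    then have "4 * (Q\<^sup>2 div 4) + 1 = Q\<^sup>2" using mult_div_mod_eq[of 4 "Q\<^sup>2"] by simp
    then show "Q dvd 4 * (Q\<^sup>2 div 4) + 1" by (simp add: power2_eq_square)
  qed
  have "coprime (2 ^ A) Q" using oddQ by (simp add: coprime_left_2_iff_odd)
  then obtain x where x: "[x = c] (mod 2 ^ A)" "[x = u] (mod Q)"
    using binary_chinese_remainder_nat[of "2 ^ A" Q c u] by blast
  \<comment> \<open>Adding \<open>M\<close> keeps \<open>y\<close> positive; together with
    \<open>t < T\<close> it accounts for the factor \<open>T + 2\<close>.\<close>
  define y0 where "y0 = x mod M + M"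
  have y0: "[y0 = c] (mod 2 ^ A)" "[y0 = u] (mod Q)" "M \<le> y0" "y0 < 2 * M"
  proof -
    have "[y0 = x] (mod M)" unfolding y0_def by (simp add: cong_def)
    then show "[y0 = c] (mod 2 ^ A)" "[y0 = u] (mod Q)"
      using x cong_dvd_modulus_nat[of y0 x M "2 ^ A"] cong_dvd_modulus_nat[of y0 x M Q]
      unfolding M_def by (blast intro: cong_trans dvd_triv_left dvd_triv_right)+
    show "M \<le> y0" "y0 < 2 * M" using M0 by (auto simp: y0_def)
  qed
  define y where "y = (\<lambda>t. y0 + t * M)"
  have yc: "[y t = c] (mod 2 ^ A)" for t
  proof -
    have "[y0 + t * M = c + 0] (mod 2 ^ A)"
      by (intro cong_add y0) (simp add: M_def cong_0_iff)
    then show ?thesis by (simp add: y_def)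
  qed
  have yQ: "Q dvd 4 * y t + 1" for t
  proof -
    have "[y0 + t * M = u + 0] (mod Q)"
      by (intro cong_add y0) (simp add: M_def cong_0_iff)
    then have "[4 * y t + 1 = 4 * u + 1] (mod Q)"
      unfolding y_def by (intro cong_add cong_mult cong_refl) simp
    then show ?thesis using u cong_dvd_iff by blast
  qed
  have shift: "d dvd 4 * (y t + j) \<longleftrightarrow> d dvd 4 * j - 1" if "d dvd 4 * y t + 1" "j \<ge> 1" for d t j
  proof -
    have "4 * (y t + j) = (4 * y t + 1) + (4 * j - 1)" using that(2) by simp
    then show ?thesis using that(1) by (simp only: dvd_add_right_iff)
  qed
  have cancel4: "p ^ i dvd 4 * w \<longleftrightarrow> p ^ i dvd w" if "p mod 4 = 3" for p i w :: nat
  proof -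
    have "coprime (p ^ i) 4" using coprime_four[OF odd_prime[OF that]] by simp
    then show ?thesis by (simp only: coprime_dvd_mult_right_iff)
  qed
  have pQ: "p dvd Q" if "p \<in> N" for p
    unfolding Q_def using dvd_prodI[OF finN that, of "\<lambda>x. x"] by simp
  \<comment> \<open>Because of this, changing \<open>t\<close> moves \<open>y t + j\<close> through
    all multiples of \<open>p\<close> modulo \<open>p ^ 2\<close>, and so a vanishing residue fixes
    \<open>t\<close> modulo \<open>p\<close>.\<close>
  have p2Q: "\<not> p ^ 2 dvd M" if p: "p \<in> N" for p
  proof
    assume "p ^ 2 dvd M"
    have pp: "prime p" using N[OF p] by simp
    have "M = p * (2 ^ A * ((\<Prod>p\<in>primes_3mod4 z. p ^ e p) * \<Prod>(N - {p})))"
      unfolding M_def Q_def using prod.remove[OF finN p, of "\<lambda>x. x"] by simp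
    with \<open>p ^ 2 dvd M\<close> have "p dvd 2 ^ A * ((\<Prod>p\<in>primes_3mod4 z. p ^ e p) * \<Prod>(N - {p}))"
      using pp by (simp add: power2_eq_square prime_gt_0_nat)
    then consider "p dvd 2 ^ A" | "p dvd (\<Prod>q\<in>primes_3mod4 z. q ^ e q)" | "p dvd \<Prod>(N - {p})"
      using pp by (auto simp: prime_dvd_mult_iff)
    then show False
    proof cases
      case 1
      then have "p dvd 2" using pp prime_dvd_power by blast
      then have "p = 2" using pp primes_dvd_imp_eq two_is_prime_nat by blast
      then show False using N(2)[OF p] by simp
    next
      case 2
      then obtain q where q: "q \<in> primes_3mod4 z" "p dvd q ^ e q"
        using prime_dvd_prod_iff[OF finite_primes_3mod4[of z] pp, of "\<lambda>q. q ^ e q"] by blast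
      then have "p = q" using pp prime_dvd_power primes_dvd_imp_eq unfolding primes_3mod4_def by blast
      then show False using q(1) p by (auto simp: N_def primes_3mod4_def)
    next
      case 3
      then obtain q where "q \<in> N - {p}" "p dvd q"
        using prime_dvd_prod_iff[of "N - {p}" p "\<lambda>x. x"] finN pp by auto
      then show False using pp N primes_dvd_imp_eq by blast
    qed
  qed
  define bad where "bad = (\<lambda>p j. {t. t < T \<and> p ^ 2 dvd y t + j})"
  define J where "J = (\<lambda>p. {j \<in> {1..k}. p dvd 4 * j - 1})"
  have card_bad: "card (bad p j) \<le> T div p + 1" if p: "p \<in> N" for p j
  proof (rule card_cong_class_le)
    show "bad p j \<subseteq> {..<T}" by (auto simp: bad_def)
    show "p > 0" using N[OF p] by simp
    fix t t' assume "t \<in> bad p j" "t' \<in> bad p j"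
    then have "int (p ^ 2) dvd int (y t + j) - int (y t' + j)"
      by (intro dvd_diff) (auto simp only: bad_def mem_Collect_eq int_dvd_int_iff)
    then have d: "int (p ^ 2) dvd (int t - int t') * int M" by (simp add: y_def algebra_simps)
    obtain M' where M': "M = p * M'" using pQ[OF p] unfolding M_def by (metis dvd_mult dvdE)
    have "\<not> p dvd M'" using p2Q[OF p] M' by (simp add: power2_eq_square)
    moreover have "int p * int p dvd int p * ((int t - int t') * int M')"
      using d unfolding M' by (simp add: power2_eq_square mult_ac)
    then have "int p dvd (int t - int t') * int M'" using N(3)[OF p] by simp
    ultimately have "int p dvd int t - int t'"
      using N(1)[OF p] by (simp add: prime_dvd_mult_iff)
    then have "[int t = int t'] (mod int p)" by (simp add: cong_iff_dvd_diff)
    then show "[t = t'] (mod p)" by (simp add: cong_int_iff)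
  qed
  have card_J: "card (J p) \<le> (k + 1) div p + 1" if p: "p \<in> N" for p
  proof (rule card_cong_class_le)
    show "J p \<subseteq> {..<k + 1}" by (auto simp: J_def)
    show "p > 0" using N[OF p] by simp
    fix i j assume ij: "i \<in> J p" "j \<in> J p"
    then have "int p dvd int (4 * i - 1) - int (4 * j - 1)"
      by (intro dvd_diff) (auto simp only: J_def mem_Collect_eq int_dvd_int_iff)
    moreover have "int (4 * i - 1) - int (4 * j - 1) = 4 * (int i - int j)" using ij by (auto simp: J_def of_nat_diff)
    ultimately have d: "int p dvd 4 * (int i - int j)" by simp
    have "coprime (int p) (int 4)" using coprime_four[OF odd_prime[OF N(2)[OF p]]] by (simp only: coprime_int_iff)
    then have "coprime (int p) 4" by simp
    then have "int p dvd int i - int j" using d by (simp only: coprime_dvd_mult_right_iff)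
    then have "[int i = int j] (mod int p)" by (simp add: cong_iff_dvd_diff)
    then show "[i = j] (mod p)" by (simp add: cong_int_iff)
  qed
  have "card (\<Union>p\<in>N. \<Union>j\<in>J p. bad p j) \<le> (\<Sum>p\<in>N. card (\<Union>j\<in>J p. bad p j))"
    using finN by (rule card_UN_le)
  also have "\<dots> \<le> (\<Sum>p\<in>N. ((k + 1) div p + 1) * (T div p + 1))"
  proof (rule sum_mono)
    fix p assume p: "p \<in> N"
    have "card (\<Union>j\<in>J p. bad p j) \<le> (\<Sum>j\<in>J p. card (bad p j))"
      by (rule card_UN_le) (simp add: J_def)
    also have "\<dots> \<le> (\<Sum>j\<in>J p. T div p + 1)" by (intro sum_mono card_bad p)
    also have "\<dots> = card (J p) * (T div p + 1)" by simp
    also have "\<dots> \<le> ((k + 1) div p + 1) * (T div p + 1)" using card_J[OF p] by (rule mult_le_mono1)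
    finally show "card (\<Union>j\<in>J p. bad p j) \<le> ((k + 1) div p + 1) * (T div p + 1)" .
  qed
  also have "\<dots> < card {..<T}" using T by simp
  finally have "card (\<Union>p\<in>N. \<Union>j\<in>J p. bad p j) < card {..<T}" .
  then have "\<not> {..<T} \<subseteq> (\<Union>p\<in>N. \<Union>j\<in>J p. bad p j)"
    using finN by (auto simp: not_less bad_def J_def dest!: card_mono[rotated])
  then obtain t where tT: "t \<in> {..<T}" "t \<notin> (\<Union>p\<in>N. \<Union>j\<in>J p. bad p j)" by blast
  have t1: "t < T" using tT(1) by simp
  have t2: "\<not> p ^ 2 dvd y t + j" if "p \<in> N" "j \<in> {1..k}" "p dvd 4 * j - 1" for p j
    using tT that unfolding bad_def J_def by auto
  show ?thesis
  proof (rule that)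
    show "y t \<ge> 1" using y0(3) M0 by (simp add: y_def)
    have "y t \<le> 2 * M + T * M" using y0(4) t1 unfolding y_def
      by (intro add_mono mult_le_mono1) auto
    then show "y t \<le> (T + 2) * (2 ^ A * Q)" unfolding M_def by (simp add: algebra_simps)
    fix j assume j: "j \<in> {1..k}"
    show "y t + j \<notin> sums_of_two_squares"
    proof (cases "dyadic3 A (j + c)")
      case True
      have "[y t + j = c + j] (mod 2 ^ A)" by (intro cong_add yc cong_refl)
      then have "dyadic3 A (y t + j)" using True dyadic3_cong[of "y t + j" "c + j" A] by (simp add: add.commute)
      then show ?thesis by (rule dyadic3_not_sum_two_squares)
    next
      case False
      have "(4 * j - 1) mod 4 = 3"
      proof -
        obtain i where "j = Suc i" using j by (cases j) auto
        then have "4 * j - 1 = 4 * i + 3" by simp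
        moreover have "(4 * i + 3) mod 4 = 3" by presburger
        ultimately show ?thesis by simp
      qed
      then obtain q where q: "prime q" "q mod 4 = 3" "odd (multiplicity q (4 * j - 1))"
        using exists_odd_multiplicity_3mod4 by blast
      define m where "m = multiplicity q (4 * j - 1)"
      have m1: "m \<ge> 1" using q(3) unfolding m_def by (cases "multiplicity q (4 * j - 1)") auto
      have pos: "4 * j - 1 > 0" and j1: "j \<ge> 1" using j by auto
      have iff: "q ^ i dvd 4 * j - 1 \<longleftrightarrow> i \<le> m" for i
        unfolding m_def using pos q(1) by (intro power_dvd_iff_le_multiplicity) (auto dest: not_prime_unit)
      have qm: "q ^ m dvd 4 * j - 1" "\<not> q ^ Suc m dvd 4 * j - 1" by (subst iff, simp)+
      have "q ^ 1 dvd q ^ m" using m1 by (rule le_imp_power_dvd)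
      then have qd: "q dvd 4 * j - 1" using qm(1) by (metis dvd_trans power_one_right)
      have q4k: "q \<le> 4 * k" using dvd_imp_le[OF qd pos] j by auto
      have "\<exists>l. multiplicity q (y t + j) = l \<and> odd l"
      proof (cases "q \<le> z")
        case True
        \<comment> \<open>The exponent satisfies \<open>4 * k < q ^ e q\<close>, so \<open>Q\<close>
          contains one power more of \<open>q\<close> than \<open>4 * j - 1\<close>, and the odd
          multiplicity is transferred to \<open>y t + j\<close> unchanged.\<close>
        then have qz: "q \<in> primes_3mod4 z" using q by (simp add: primes_3mod4_def)
        have "q ^ m \<le> 4 * j - 1" using dvd_imp_le[OF qm(1) pos] .
        then have "q ^ m < q ^ e q" using e[OF qz] j by auto
        then have "Suc m \<le> e q" using q(1) prime_gt_1_nat power_less_imp_less_exp Suc_leI by metis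
        then have "q ^ Suc m dvd q ^ e q" by (rule le_imp_power_dvd)
        moreover have "q ^ e q dvd Q"
          unfolding Q_def using dvd_prodI[OF finite_primes_3mod4 qz, of "\<lambda>p. p ^ e p"] by simp
        ultimately have "q ^ Suc m dvd Q" by (rule dvd_trans)
        then have S: "q ^ Suc m dvd 4 * y t + 1" using yQ by (rule dvd_trans)
        then have "q ^ m dvd 4 * y t + 1" by (rule power_le_dvd) simp
        from iffD2[OF shift[OF this j1] qm(1)] have "q ^ m dvd y t + j" by (simp only: cancel4[OF q(2)])
        moreover from qm(2) have "\<not> q ^ Suc m dvd y t + j"
          by (simp only: shift[OF S j1, symmetric] cancel4[OF q(2)] simp_thms)
        ultimately have "multiplicity q (y t + j) = m" by (rule multiplicity_eqI)
        then show ?thesis using q(3) m_def by blast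
      next
        case notz: False
        \<comment> \<open>Only the divisibility of \<open>4 * j - 1\<close> by \<open>q\<close> is
          transferred here; the choice of \<open>t\<close> makes the multiplicity in
          \<open>y t + j\<close> exactly 1.\<close>
        then have qN: "q \<in> N"
          using q q4k False qd j by (auto simp: N_def primes_3mod4_def needed_def)
        have S1: "q ^ 1 dvd 4 * y t + 1" using dvd_trans[OF pQ[OF qN] yQ] by (simp only: power_one_right)
        have "q ^ 1 dvd 4 * j - 1" using qd by (simp only: power_one_right)
        from iffD2[OF shift[OF S1 j1] this] have "q ^ 1 dvd y t + j" by (simp only: cancel4[OF q(2)])
        moreover have "\<not> q ^ Suc 1 dvd y t + j" using t2[OF qN j qd] by (simp add: numeral_2_eq_2)
        ultimately have "multiplicity q (y t + j) = 1" by (rule multiplicity_eqI)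
        then show ?thesis by auto
      qed
      then show ?thesis using odd_multiplicity_not_sum_two_squares[OF q(1,2)] by blast
    qed
  qed
qed

section \<open>From a run of excluded integers to a bound for \<open>g\<close>\<close>

lemma power_of_two_sum_two_squares: "2 ^ r \<in> sums_of_two_squares"
proof (cases "even r")
  case True
  then obtain i where "r = 2 * i" by (elim evenE)
  then have "int (2 ^ r) = (2 ^ i)\<^sup>2 + 0\<^sup>2" by (simp add: power_mult power2_eq_square power_mult_distrib flip: power_add mult_2)
  then have "\<exists>a b :: int. int (2 ^ r) = a\<^sup>2 + b\<^sup>2" by blast
  then show ?thesis unfolding sums_of_two_squares_def by simp
next
  case False
  then obtain i where "r = 2 * i + 1" by (elim oddE)
  then have "int (2 ^ r) = (2 ^ i)\<^sup>2 + (2 ^ i)\<^sup>2" by (simp add: power2_eq_square flip: power_add mult_2)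
  then have "\<exists>a b :: int. int (2 ^ r) = a\<^sup>2 + b\<^sup>2" by blast
  then show ?thesis unfolding sums_of_two_squares_def by simp
qed

lemma exists_power_of_two_between:
  assumes "w \<ge> 1"
  shows "\<exists>r. w < 2 ^ r \<and> 2 ^ r \<le> 2 * (w::nat)"
  using assms
proof (induction w rule: nat_induct_at_least)
  case base
  show ?case by (intro exI[of _ 1]) simp
next
  case (Suc w)
  then obtain r where r: "w < 2 ^ r" "2 ^ r \<le> 2 * w" by blast
  show ?case
  proof (cases "Suc w < 2 ^ r")
    case True
    then show ?thesis using r by (intro exI[of _ r]) simp
  next
    case False
    then have "2 ^ r = Suc w" using r by simp
    then show ?thesis by (intro exI[of _ "Suc r"]) simp
  qed
qed

text \<open>Some power of 2 lies in the interval from \<open>y + k + 1\<close> to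
  \<open>2 * (y + k)\<close> and is a sum of two squares, so the gap closes below \<open>X\<close>;
  hence the factor 2. Its end points are at most \<open>y\<close> and at least
  \<open>y + k + 1\<close>, which gives \<open>k + 1\<close>.\<close>

lemma g_ge_of_gap:
  assumes y: "y \<ge> 1" and gap: "\<And>j. j \<in> {1..k} \<Longrightarrow> y + j \<notin> sums_of_two_squares"
    and X: "2 * real (y + k) \<le> X"
  shows "g X \<ge> k + 1"
proof -
  have "2 ^ 0 \<in> range s" using power_of_two_sum_two_squares range_s by blast
  then obtain i0 where i0: "s i0 = 1" by auto
  have ge: "i \<le> s i" for i using strict_mono_s by (rule strict_mono_imp_increasing)
  define I where "I = {i. s i \<le> y}"
  have "finite I" by (rule finite_subset[of _ "{..y}"]) (auto simp: I_def intro: order_trans[OF ge])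
  moreover have "i0 \<in> I" using i0 y by (simp add: I_def)
  ultimately have n: "Max I \<in> I" "\<And>i. i \<in> I \<Longrightarrow> i \<le> Max I" by (auto intro: Max_in)
  define n where "n = Max I"
  have sn: "s n \<le> y" using n(1) by (simp add: I_def n_def)
  have "Suc n \<notin> I" using n(2)[of "Suc n"] by (auto simp: n_def)
  then have sn1: "s (Suc n) > y" by (simp add: I_def)
  have "s (Suc n) \<in> sums_of_two_squares" using range_s by blast
  moreover have "y + (s (Suc n) - y) = s (Suc n)" using sn1 by simp
  ultimately have "s (Suc n) - y \<notin> {1..k}" using gap[of "s (Suc n) - y"] by auto
  then have big: "s (Suc n) > y + k" using sn1 by auto
  obtain r where r: "y + k < 2 ^ r" "2 ^ r \<le> 2 * (y + k)"
    using exists_power_of_two_between[of "y + k"] y by auto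
  obtain m where m: "s m = 2 ^ r" using power_of_two_sum_two_squares[of r] range_s by (metis imageE)
  have "m \<notin> I" using m r by (simp add: I_def)
  have "n < m"
  proof (rule ccontr)
    assume "\<not> n < m"
    then have "s m \<le> s n" using strict_mono_less_eq[OF strict_mono_s] by simp
    then show False using sn m r by simp
  qed
  then have "s (Suc n) \<le> s m" using strict_mono_less_eq[OF strict_mono_s] by simp
  then have "s (Suc n) \<le> 2 * (y + k)" using m r by simp
  then have "real (s (Suc n)) \<le> X" using X by linarith
  then have "s (Suc n) - s n \<in> gaps_upto X" unfolding gaps_upto_def by blast
  then have "s (Suc n) - s n \<le> g X" unfolding g_def by (intro Max_ge finite_gaps_upto)
  then show ?thesis using sn big by linarith
qed

section \<open>Choice of parameters and asymptotics\<close>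

lemma filterlim_nat_div_at_top:
  assumes "b > (0::nat)"
  shows "filterlim (\<lambda>k. 4 * k div b) at_top sequentially"
  unfolding filterlim_at_top
proof
  fix Z :: nat
  show "\<forall>\<^sub>F k in sequentially. Z \<le> 4 * k div b"
    using eventually_ge_at_top[of "Z * b"]
  proof eventually_elim
    case (elim k)
    then have "Z * b \<le> 4 * k" by linarith
    then show ?case using assms by (simp add: less_eq_div_iff_mult_less_eq)
  qed
qed

lemma filterlim_nat_floor_mult_at_top:
  assumes "d > (0::real)"
  shows "filterlim (\<lambda>k. nat \<lfloor>d * real k\<rfloor>) at_top sequentially"
  unfolding filterlim_at_top
proof
  fix Z :: nat
  have "\<forall>\<^sub>F k in sequentially. real k \<ge> real Z / d" by real_asymp
  then show "\<forall>\<^sub>F k in sequentially. Z \<le> nat \<lfloor>d * real k\<rfloor>"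
  proof eventually_elim
    case (elim k)
    then have "real Z \<le> d * real k" using assms by (simp add: field_simps)
    then show ?case by (rule le_nat_floor)
  qed
qed

text \<open>For \<open>p > d * k\<close> both quotients are bounded in terms of \<open>d\<close>
  alone, so the sum is at most a constant times \<open>card N\<close>, which is of order
  \<open>k / ln k\<close> in the application.\<close>

lemma sum_div_products_less:
  fixes N :: "nat set"
  assumes N: "finite N" "\<And>p. p \<in> N \<Longrightarrow> d * real k < real p" and d: "d > 0" and k: "k \<ge> 1"
    and small: "real (card N) * ((2 / d + 1) * (4 / d + 1)) < 4 * real k"
  shows "(\<Sum>p\<in>N. ((k + 1) div p + 1) * (4 * k div p + 1)) < 4 * k"
proof -
  have "real (\<Sum>p\<in>N. ((k + 1) div p + 1) * (4 * k div p + 1)) = (\<Sum>p\<in>N. (real ((k + 1) div p) + 1) * (real (4 * k div p) + 1))"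
    by (simp only: of_nat_sum of_nat_mult of_nat_add of_nat_1)
  also have "\<dots> \<le> (\<Sum>p\<in>N. (2 / d + 1) * (4 / d + 1))"
  proof (rule sum_mono)
    fix p assume p: "p \<in> N"
    have dk: "0 < d * real k" using d k by simp
    have p0: "real p > 0" using N(2)[OF p] dk by linarith
    have bound: "real (m div p) \<le> b / d" if "real m \<le> b * real k" "b \<ge> 0" for m b
    proof -
      have "real (m div p) \<le> real m / real p" by (rule of_nat_div_le_of_nat)
      also have "\<dots> \<le> (b * real k) / (d * real k)"
        using that N(2)[OF p] dk k by (intro frac_le) auto
      also have "\<dots> = b / d" using k by simp
      finally show ?thesis .
    qed
    have "real ((k + 1) div p) \<le> 2 / d" using k by (intro bound) auto
    moreover have "real (4 * k div p) \<le> 4 / d" by (intro bound) auto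
    ultimately show "(real ((k + 1) div p) + 1) * (real (4 * k div p) + 1) \<le> (2 / d + 1) * (4 / d + 1)"
      using d by (intro mult_mono) auto
  qed
  also have "\<dots> < 4 * real k" using small by simp
  finally have "real (\<Sum>p\<in>N. ((k + 1) div p + 1) * (4 * k div p + 1)) < real (4 * k)" by simp
  then show ?thesis by (simp only: of_nat_less_iff)
qed

text \<open>Each factor is at most \<open>n\<^sup>2\<close>: \<open>p ^ f p\<close> and the
  additional \<open>p\<close> are both at most \<open>n\<close>.\<close>

lemma ln_small_prime_powers_le:
  assumes f: "\<And>p. p \<in> primes_3mod4 z \<Longrightarrow> p ^ f p \<le> n" and z: "z \<le> n"
  shows "ln (real (\<Prod>p\<in>primes_3mod4 z. p ^ (f p + 1))) \<le> real (card (primes_3mod4 z)) * (2 * ln (real n))"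
proof -
  have p0: "p > 0" if "p \<in> primes_3mod4 z" for p using that by (simp add: primes_3mod4_def prime_gt_0_nat)
  have "ln (real (\<Prod>p\<in>primes_3mod4 z. p ^ (f p + 1))) = (\<Sum>p\<in>primes_3mod4 z. ln (real (p ^ (f p + 1))))"
    unfolding of_nat_prod using p0 by (intro ln_prod) auto
  also have "\<dots> \<le> (\<Sum>p\<in>primes_3mod4 z. 2 * ln (real n))"
  proof (rule sum_mono)
    fix p assume p: "p \<in> primes_3mod4 z"
    have le: "p \<le> n" using p z by (simp add: primes_3mod4_def)
    have "ln (real (p ^ (f p + 1))) = ln (real (p ^ f p)) + ln (real p)"
      using p0[OF p] by (simp add: ln_mult ln_realpow)
    also have "\<dots> \<le> ln (real n) + ln (real n)"
      using p0[OF p] f[OF p] le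
      by (intro add_mono; subst ln_le_cancel_iff) (auto simp flip: of_nat_power)
    finally show "ln (real (p ^ (f p + 1))) \<le> 2 * ln (real n)" by simp
  qed
  finally show ?thesis by simp
qed

lemma eventually_gap:
  fixes d :: real
  assumes d: "d > 0"
  shows "\<forall>\<^sub>F k in sequentially. \<exists>y\<ge>1. (\<forall>j\<in>{1..k}. y + j \<notin> sums_of_two_squares) \<and>
    ln (2 * real (y + k)) \<le> (449 / 390 + d) * real k"
proof -
  have "(0::real) < d / 8" using d by simp
  then obtain A0 where A0: "(1 / 2 :: real) ^ A0 < d / 8" using real_arch_pow_inv[of "d / 8" "1 / 2"] by auto
  define A where "A = max 4 A0"
  have A: "A \<ge> 4" by (simp add: A_def)
  have "(1 / 2 :: real) ^ A \<le> (1 / 2) ^ A0" by (intro power_decreasing) (auto simp: A_def)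
  then have eta: "1 / 2 ^ A \<le> d / 8" using A0 by (simp add: power_divide)
  have eta1: "1 / 2 ^ A \<le> (1::real)" by simp
  \<comment> \<open>\<open>e1\<close> gets multiplied by a factor of at most 7 and so costs
    \<open>d / 4\<close>; the choice of \<open>A\<close> costs another \<open>d / 4\<close>.
    Together they are the \<open>d / 2\<close> in \<open>lnQ1\<close>.\<close>
  define e1 where "e1 = d / 28"
  have e1: "e1 > 0" using d by (simp add: e1_def)
  \<comment> \<open>The powers of primes up to \<open>r * k\<close> cost at most
    \<open>16 * r * k\<close>, which is to stay below \<open>d / 8 * k\<close>.\<close>
  define r where "r = min (d / 128) 1"
  have r: "r > 0" "r \<le> 1" "r \<le> d / 128" using d by (auto simp: r_def)
  define C where "C = (2 / r + 1) * (4 / r + 1)"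
  have C: "C > 0" using r by (simp add: C_def add_pos_pos)
  have th: "\<forall>\<^sub>F k in sequentially. theta_3mod4 (4 * k div b) \<le> (1 / 2 + e1) * real (4 * k div b)" if "b > 0" for b
    using theta_3mod4_le[OF e1] filterlim_nat_div_at_top[OF that] by (rule eventually_compose_filterlim)
  have ev1: "\<forall>\<^sub>F k in sequentially. real (card (primes_3mod4 (4 * k div 1))) \<le> 4 * real (4 * k div 1) / ln (real (4 * k div 1))"
    using card_primes_3mod4_le filterlim_nat_div_at_top[of 1] by (intro eventually_compose_filterlim[of _ _ "\<lambda>k. 4 * k div 1"]) auto
  have ev2: "\<forall>\<^sub>F k in sequentially. real (card (primes_3mod4 (nat \<lfloor>r * real k\<rfloor>))) \<le>
      4 * real (nat \<lfloor>r * real k\<rfloor>) / ln (real (nat \<lfloor>r * real k\<rfloor>))"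
    using card_primes_3mod4_le filterlim_nat_floor_mult_at_top[OF r(1)] by (rule eventually_compose_filterlim)
  \<comment> \<open>Makes \<open>ln (4 * k)\<close> comparable to \<open>ln z\<close> for
    \<open>z\<close> near \<open>r * k\<close>, so that the number of primes up to \<open>z\<close>
    times \<open>ln (4 * k)\<close> is of order \<open>z\<close>.\<close>
  have ev3: "\<forall>\<^sub>F k in sequentially. ln (4 * real k) \<le> 2 * ln (r * real k - 1)" using r(1) by real_asymp
  have ev4: "\<forall>\<^sub>F k in sequentially. real A * ln 2 + ln (2 * (5 * real k + 2)) \<le> d / 8 * real k" using d by real_asymp
  have ev5: "\<forall>\<^sub>F k in sequentially. 4 * C < ln (4 * real k)" by real_asymp
  have ev6: "\<forall>\<^sub>F k in sequentially. r * real k \<ge> 3" using r(1) by real_asymp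
  show ?thesis
    using th[of 1, OF zero_less_one] th[of 5, OF zero_less_numeral] th[of 9, OF zero_less_numeral] th[of 13, OF zero_less_numeral]
      ev1 ev2 ev3 ev4 ev5 ev6 eventually_ge_at_top[of 1]
  proof eventually_elim
    case (elim k)
    note th1 = elim(1)[simplified] and th5 = elim(2) and th9 = elim(3) and th13 = elim(4) and c4 = elim(5)[simplified] and cz = elim(6)
      and lz = elim(7) and lA = elim(8) and lC = elim(9) and rk = elim(10) and k = elim(11)
    define z where "z = nat \<lfloor>r * real k\<rfloor>"
    have z: "real z \<le> r * real k" "r * real k - 1 \<le> real z" "r * real k < real z + 1"
      using rk unfolding z_def by linarith+
    have zk: "z \<le> 4 * k"
    proof -
      have "r * real k \<le> 1 * real k" using r by (intro mult_right_mono) auto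
      then have "real z \<le> real (4 * k)" using z(1) by simp
      then show ?thesis by (simp only: of_nat_le_iff)
    qed
    have lz': "ln (4 * real k) \<le> 2 * ln (real z)"
    proof -
      have "ln (r * real k - 1) \<le> ln (real z)" using z(2) rk by (subst ln_le_cancel_iff) auto
      then show ?thesis using lz by linarith
    qed
    \<comment> \<open>\<open>p ^ (f p + 1)\<close> is then the least power of \<open>p\<close> above
      \<open>4 * k\<close>.\<close>
    have "\<exists>i. p ^ i \<le> 4 * k \<and> 4 * k < p ^ (i + 1)" if "p \<in> primes_3mod4 z" for p
      using that k by (intro ex_power_ivl1) (auto simp: primes_3mod4_def prime_ge_2_nat)
    then obtain f where f: "\<And>p. p \<in> primes_3mod4 z \<Longrightarrow> p ^ f p \<le> 4 * k" "\<And>p. p \<in> primes_3mod4 z \<Longrightarrow> 4 * k < p ^ (f p + 1)"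
      by metis
    obtain c where c: "(\<Sum>p | p \<in> primes_3mod4 (4 * k) \<and> needed A k c p. ln (real p)) \<le>
      (1 / 2 + 1 / 2 ^ A) * theta_3mod4 (4 * k) + 1 / 4 * theta_3mod4 (4 * k div 5) +
      3 / 16 * theta_3mod4 (4 * k div 9) + 1 / 16 * theta_3mod4 (4 * k div 13)"
      using exists_good_shift[OF A] by blast
    define N where "N = {p \<in> primes_3mod4 (4 * k). needed A k c p \<and> z < p}"
    define Q0 where "Q0 = (\<Prod>p\<in>primes_3mod4 z. p ^ (f p + 1))"
    define Q1 where "Q1 = \<Prod>N"
    have finN: "finite N" by (simp add: N_def)
    have NP: "N \<subseteq> primes_3mod4 (4 * k)" by (auto simp: N_def)
    have l4k: "ln (4 * real k) > 0" using lC C by simp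
    have "(\<Sum>p\<in>N. ((k + 1) div p + 1) * (4 * k div p + 1)) < 4 * k"
    proof (rule sum_div_products_less[OF finN _ r(1) k])
      show "r * real k < real p" if "p \<in> N" for p
      proof -
        have "z + 1 \<le> p" using that by (simp add: N_def)
        then have "real z + 1 \<le> real p" by linarith
        then show ?thesis using z(3) by linarith
      qed
      have "real (card N) * C \<le> (4 * real (4 * k) / ln (4 * real k)) * C"
        using c4 card_mono[OF finite_primes_3mod4 NP] C by (intro mult_right_mono) auto
      also have "\<dots> = 4 * C * (4 * real k) / ln (4 * real k)" by simp
      also have "\<dots> < ln (4 * real k) * (4 * real k) / ln (4 * real k)"
        using lC l4k k by (intro divide_strict_right_mono mult_strict_right_mono) auto
      also have "\<dots> = 4 * real k" using l4k by simp
      finally show "real (card N) * ((2 / r + 1) * (4 / r + 1)) < 4 * real k" by (simp add: C_def)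
    qed
    then obtain y where y: "y \<ge> 1" "y \<le> (4 * k + 2) * (2 ^ A * (Q0 * Q1))" "\<And>j. j \<in> {1..k} \<Longrightarrow> y + j \<notin> sums_of_two_squares"
      using exists_gap[where k = k and z = z and e = "\<lambda>p. f p + 1" and A = A and c = c and T = "4 * k"] k f(2) unfolding N_def Q0_def Q1_def by blast
    have Q0: "Q0 > 0" unfolding Q0_def by (auto simp: primes_3mod4_def prime_gt_0_nat intro!: prod_pos)
    have Q1: "Q1 > 0" unfolding Q1_def using NP by (auto simp: primes_3mod4_def prime_gt_0_nat intro!: prod_pos)
    have lnQ0: "ln (real Q0) \<le> d / 8 * real k"
    proof -
      have "ln (real Q0) \<le> real (card (primes_3mod4 z)) * (2 * ln (real (4 * k)))"
        unfolding Q0_def using f(1) zk by (rule ln_small_prime_powers_le)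
      also have "\<dots> \<le> (4 * real z / ln (real z)) * (2 * (2 * ln (real z)))"
        using cz lz' l4k unfolding z_def[symmetric] by (intro mult_mono) auto
      also have "\<dots> = 16 * real z" using lz' l4k by simp
      also have "\<dots> \<le> 16 * (r * real k)" using z(1) by simp
      also have "\<dots> \<le> 16 * (d / 128 * real k)" using r(3) by (intro mult_left_mono mult_right_mono) auto
      finally show ?thesis by simp
    qed
    have lnQ1: "ln (real Q1) \<le> (449 / 390 + d / 2) * real k"
    proof -
      have "ln (real Q1) = (\<Sum>p\<in>N. ln (real p))"
        unfolding Q1_def of_nat_prod using NP
        by (intro ln_prod) (auto simp: primes_3mod4_def prime_gt_0_nat finN)
      also have "\<dots> \<le> (\<Sum>p | p \<in> primes_3mod4 (4 * k) \<and> needed A k c p. ln (real p))"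
        by (rule sum_mono2) (auto simp: N_def primes_3mod4_def Suc_le_eq prime_gt_0_nat)
      also have "\<dots> \<le> (1 / 2 + 1 / 2 ^ A) * theta_3mod4 (4 * k) + 1 / 4 * theta_3mod4 (4 * k div 5) +
        3 / 16 * theta_3mod4 (4 * k div 9) + 1 / 16 * theta_3mod4 (4 * k div 13)" by (rule c)
      also have "\<dots> \<le> (1 / 2 + 1 / 2 ^ A) * ((1 / 2 + e1) * (4 * real k)) + 1 / 4 * ((1 / 2 + e1) * (4 * real k / 5)) +
        3 / 16 * ((1 / 2 + e1) * (4 * real k / 9)) + 1 / 16 * ((1 / 2 + e1) * (4 * real k / 13))"
      proof -
        have t: "theta_3mod4 (4 * k div b) \<le> (1 / 2 + e1) * (4 * real k / real b)"
          if "theta_3mod4 (4 * k div b) \<le> (1 / 2 + e1) * real (4 * k div b)" for b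
        proof -
          have "real (4 * k div b) \<le> 4 * real k / real b" using of_nat_div_le_of_nat[of "4 * k" b] by simp
          then have "(1 / 2 + e1) * real (4 * k div b) \<le> (1 / 2 + e1) * (4 * real k / real b)"
            using e1 by (intro mult_left_mono) auto
          then show ?thesis using that by linarith
        qed
        show ?thesis using th1 t[OF th5] t[OF th9] t[OF th13] by (intro add_mono mult_left_mono) auto
      qed
      \<comment> \<open>Here 898/390 is 4 (1/2 + 1/20 + 1/48 + 1/208); the factor 1/2, the density
        of the primes 3 modulo 4, halves it to 449/390.\<close>
      also have "\<dots> = (1 / 2 + e1) * (898 / 390 + 4 * (1 / 2 ^ A)) * real k"
      proof -
        have "(1 / 2 + w) * (h * (4 * x)) + 1 / 4 * (h * (4 * x / 5)) + 3 / 16 * (h * (4 * x / 9)) +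
          1 / 16 * (h * (4 * x / 13)) = h * (898 / 390 + 4 * w) * x" for w x h :: real
          by (simp add: field_simps)
        then show ?thesis .
      qed
      also have "\<dots> \<le> (449 / 390 + d / 2) * real k"
      proof (rule mult_right_mono)
        have "(1 / 2 + h) * (898 / 390 + 4 * w) = 449 / 390 + 2 * w + h * (898 / 390 + 4 * w)" for h w :: real
          by (simp add: field_simps)
        then have "(1 / 2 + e1) * (898 / 390 + 4 * (1 / 2 ^ A)) = 449 / 390 + 2 * (1 / 2 ^ A) + e1 * (898 / 390 + 4 * (1 / 2 ^ A))" .
        also have "\<dots> \<le> 449 / 390 + 2 * (d / 8) + e1 * 7"
        proof -
          have "898 / 390 + 4 * (1 / 2 ^ A) \<le> (7::real)" using eta1 by linarith
          then show ?thesis using eta e1 by (intro add_mono mult_left_mono) auto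
        qed
        also have "\<dots> = 449 / 390 + d / 2" by (simp add: e1_def)
        finally show "(1 / 2 + e1) * (898 / 390 + 4 * (1 / 2 ^ A)) \<le> 449 / 390 + d / 2" .
      qed simp
      finally show ?thesis .
    qed
    define M where "M = 2 ^ A * (Q0 * Q1)"
    have M: "M > 0" using Q0 Q1 by (simp add: M_def)
    have lnM: "ln (real M) = real A * ln 2 + (ln (real Q0) + ln (real Q1))"
      using Q0 Q1 by (simp add: M_def ln_mult ln_realpow)
    have "y + k \<le> (4 * k + 2) * M + k * M" using y(2) M unfolding M_def[symmetric] by (intro add_mono) auto
    then have "2 * (y + k) \<le> 2 * (5 * k + 2) * M" by (simp add: algebra_simps)
    then have "real (2 * (y + k)) \<le> real (2 * (5 * k + 2) * M)" by (rule of_nat_mono)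
    then have "2 * real (y + k) \<le> (2 * (5 * real k + 2)) * real M" by (simp add: algebra_simps)
    then have "ln (2 * real (y + k)) \<le> ln ((2 * (5 * real k + 2)) * real M)"
      using y(1) M by (subst ln_le_cancel_iff) auto
    also have "\<dots> = ln (2 * (5 * real k + 2)) + ln (real M)"
      using M by (intro ln_mult_pos) auto
    also have "\<dots> \<le> (449 / 390 + d) * real k"
    proof -
      have "ln (2 * (5 * real k + 2)) + ln (real M) \<le> d / 8 * real k + (d / 8 * real k + (449 / 390 + d / 2) * real k)"
        using lA lnQ0 lnQ1 lnM by linarith
      also have "\<dots> = (449 / 390 + d * (3 / 4)) * real k" by (simp add: algebra_simps)
      also have "\<dots> \<le> (449 / 390 + d) * real k" using d by (intro mult_right_mono) auto
      finally show ?thesis .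
    qed
    finally show ?case using y(1,3) by blast
  qed
qed

lemma eventually_g_ge:
  fixes d :: real
  assumes d: "d > 0"
  shows "\<forall>\<^sub>F X in at_top. real (g X) \<ge> (390 / 449 - d) * ln X"
proof -
  define a where "a = 449 / 390 + d"
  have a: "a > 1" using d by (simp add: a_def)
  obtain K where K: "\<And>k. k \<ge> K \<Longrightarrow> \<exists>y\<ge>1. (\<forall>j\<in>{1..k}. y + j \<notin> sums_of_two_squares) \<and> ln (2 * real (y + k)) \<le> a * real k"
    using eventually_gap[OF d] unfolding eventually_sequentially a_def by blast
  have "\<forall>\<^sub>F X::real in at_top. ln X / a \<ge> real K + 1" using a by real_asymp
  then show ?thesis using eventually_gt_at_top[of 1]
  proof eventually_elim
    case (elim X)
    \<comment> \<open>Rounding down makes the modulus fit below \<open>X\<close>; the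
      \<open>+ 1\<close> in \<open>g_ge_of_gap\<close> compensates for it.\<close>
    define k where "k = nat \<lfloor>ln X / a\<rfloor>"
    have k: "real k \<le> ln X / a" "ln X / a < real k + 1" "K \<le> k"
      using elim(1) unfolding k_def by linarith+
    obtain y where y: "y \<ge> 1" "\<And>j. j \<in> {1..k} \<Longrightarrow> y + j \<notin> sums_of_two_squares" "ln (2 * real (y + k)) \<le> a * real k"
      using K[OF k(3)] by blast
    have "a * real k \<le> ln X" using k(1) a by (simp add: field_simps)
    then have "ln (2 * real (y + k)) \<le> ln X" using y(3) by linarith
    then have "2 * real (y + k) \<le> X" using y(1) elim(2) by (subst (asm) ln_le_cancel_iff) auto
    then have "g X \<ge> k + 1" using g_ge_of_gap[OF y(1,2)] by blast
    then have "real (g X) \<ge> real k + 1" by linarith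
    then have "real (g X) \<ge> ln X / a" using k(2) by linarith
    moreover have "(390 / 449 - d) * ln X \<le> (1 / a) * ln X"
    proof (rule mult_right_mono)
      have "(390 / 449 - d) * a \<le> 1"
      proof -
        have "(390 / 449 - d) * a = 1 - d * (449 / 390 - 390 / 449) - d * d" by (simp add: a_def algebra_simps)
        moreover have "d * (449 / 390 - 390 / 449) \<ge> 0" "d * d \<ge> 0" using d by (simp_all add: mult_nonneg_nonneg)
        ultimately show ?thesis by linarith
      qed
      then show "390 / 449 - d \<le> 1 / a" using a by (simp add: field_simps)
    qed (use elim(2) in simp)
    ultimately show ?case by simp
  qed
qed

theorem theorem1:
  shows "\<exists>\<epsilon> :: real \<Rightarrow> real. (\<epsilon> \<longlongrightarrow> 0) at_top \<and>
           (\<forall>X\<ge>2. real (g X) \<ge> (390 / 449 - \<epsilon> X) * ln X)"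
proof (intro exI conjI allI impI)
  \<comment> \<open>The least nonnegative error for which the bound holds at \<open>X\<close>, so
    that the inequality is immediate for all \<open>X \<ge> 2\<close> and only the limit
    remains.\<close>
  let ?e = "\<lambda>X. max 0 (390 / 449 - real (g X) / ln X)"
  show "(?e \<longlongrightarrow> 0) at_top"
  proof (rule tendstoI)
    fix d :: real assume d: "d > 0"
    have "\<forall>\<^sub>F X in at_top. real (g X) \<ge> (390 / 449 - d / 2) * ln X" using d by (intro eventually_g_ge) simp
    then show "\<forall>\<^sub>F X in at_top. dist (?e X) 0 < d" using eventually_gt_at_top[of 1]
    proof eventually_elim
      case (elim X)
      then have "real (g X) / ln X \<ge> 390 / 449 - d / 2" by (simp add: pos_le_divide_eq)
      then show ?case using d by (simp add: dist_real_def)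
    qed
  qed
  fix X :: real assume "X \<ge> 2"
  then have l: "ln X > 0" by simp
  have "(390 / 449 - ?e X) * ln X \<le> real (g X) / ln X * ln X"
    using l by (intro mult_right_mono) auto
  then show "real (g X) \<ge> (390 / 449 - ?e X) * ln X" using l by simp
qed

end
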